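(* Let $M$ be a closed oriented 3-manifold given by an open book $(\Sigma,\phi)$ with connected binding $B$, let $\hat M$ be the mapping torus obtained by the canonical $0$-surgery along $B$, with distinguished orbit $\hat e$, and let $\mathbb R\times M$ and $\mathbb R\times\hat M$ be equipped with the matching almost complex structures $J$ and $\hat J$ described in the context. Let $C\subset\mathbb R\times M$ be a $J$-holomorphic cylinder bounding Reeb orbits $\gamma_\pm$ at $\pm\infty$, with $\gamma_\pm$ not equal to any multiple of $B$. Suppose that $C$ intersects $\mathbb R\times B$ at $s$ points with intersection multiplicities $m_1,\dots,m_s\in\mathbb N$. Then $C$ lifts, via the canonical $0$-surgery along $B$, to a $(2+s)$-punctured $\hat J$-holomorphic sphere in $\mathbb R\times\hat M$. Moreover, the $i$-th extra puncture converges to the $m_i$-th iterate of $\hat e$ at $-\infty$, for $i=1,\dots,s$.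
   Context: Open book: $\Sigma_\phi=\Sigma\times[0,1]/(\phi(x),0)\sim(x,1)$ with $\phi$ symplectic and equal to the identity near $\partial\Sigma$, and $M=\Sigma_\phi\cup_{id}(B\times D^2)$. The mapping torus is $\hat M=\hat\Sigma_{\hat\phi}$, $\hat\Sigma=\Sigma\cup D^2$, $\hat\phi|_\Sigma=\phi$, $\hat\phi|_{D^2}=id$. Local model. Fix $c>0$ irrational and a small $\epsilon>0$; write $z_j=r_je^{i\theta_j}$ on $\mathbb C^2$, $J_o$ the standard complex structure, $X=-\partial_{\theta_1}+c\,\partial_{\theta_2}$, $Y=-J_oX=-r_1\partial_{r_1}+c\,r_2\partial_{r_2}$ with flow $Y^t(z_1,z_2)=(e^{-t}z_1,e^{ct}z_2)$. Let $N=\{-r_1^2+r_2^2=-1\}\cap\{r_2<\epsilon\}$, $\gamma=N\cap\{r_2=0\}$, with contact form $\lambda'=\frac{-(1+r_2^2)d\theta_1+r_2^2d\theta_2}{1+(1+c)r_2^2}$ whose Reeb field is $X|_N$. Let $\hat N=\{-e^{-2s}r_1^2+e^{2cs}r_2^2=1\}\cap\{r_2<\epsilon\}$, where $s=s(r_2)>0$ is a smooth function such that $\hat N$ is a solid torus transverse to $Y$ and $\hat N\cap\{r_2>\epsilon'\}=N\cap\{r_2>\epsilon'\}$ for some $0<\epsilon'<\epsilon$; let $\hat\gamma=\hat N\cap\{r_1=0\}$, oriented by $X$. Identify $\mathbb R\times N$ and $\mathbb R\times\hat N$ with subsets of $\mathbb C^2$ by $\{t\}\times N\leftrightarrow Y^t(N)$,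 $\{t\}\times\hat N\leftrightarrow Y^t(\hat N)$. Global structures. The neighborhood $B\times D^2$ of $B$ is identified with $N$ by $\Phi(p,r,\theta)=(\sqrt{1+r^2}e^{-ip},re^{i\theta})$ (so $B\leftrightarrow\gamma$), $\alpha$ is a contact form on $M$ supported by the open book with $\alpha=\Phi^*\lambda'$ on $B\times D^2$, and $\hat M=\Sigma_\phi\cup\hat N$ with $\hat e=\hat\gamma$. $J$ is an $\alpha$-admissible almost complex structure on $\mathbb R\times M$ (i.e. $\mathbb R$-invariant, preserving $\ker\alpha$, $d\alpha$-compatible there, and $J\partial_t=R_\alpha$) equal to $J_o$ on $\mathbb R\times N\subset\mathbb C^2$; $\hat J$ equals $J$ on $\mathbb R\times\Sigma_\phi$ and $J_o$ on $\mathbb R\times\hat N\subset\mathbb C^2$. Lifting: $\mathbb R\times(M\setminus B)$ and $\mathbb R\times(\hat M\setminus\hat e)$ are identified, by the identity over $\Sigma_\phi$ and, over $N\setminus\gamma$ and $\hat N\setminus\hat\gamma$, by the identity of the common image $\{z_1z_2\ne0\}\cap\bigcup_tY^t(N)$ in $\mathbb C^2$; the lift of $C$ is the curve $C\setminus(\mathbb R\times B)$ viewed in $\mathbb R\times\hat M$, the intersection points with $\mathbb R\times B$ becoming extra punctures. "Bounding $\gamma_\pm$ at $\pm\infty$" means $C$ has one positive and one negative puncture asymptotic to cylinders over $\gamma_+$, $\gamma_-$ respectively. *)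

theory Defs
  imports "HOL-Complex_Analysis.Complex_Analysis"
begin

section \<open>Smooth maps and submanifolds of Euclidean spaces\<close>

text \<open>
  Manifolds are subsets of a Euclidean space of arbitrary dimension that are locally diffeomorphic
  to a model (the definition in Milnor's ``Topology from the Differentiable Viewpoint'').  By
  Whitney's embedding theorem this is no restriction.
\<close>

primrec Ck_on :: "nat \<Rightarrow> 'a::real_normed_vector set \<Rightarrow> ('a \<Rightarrow> 'b::real_normed_vector) \<Rightarrow> bool" where
  "Ck_on 0 U f \<longleftrightarrow> continuous_on U f"
| "Ck_on (Suc k) U f \<longleftrightarrow> (\<forall>x\<in>U. f differentiable (at x)) \<and>
     (\<forall>v. Ck_on k U (\<lambda>x. frechet_derivative f (at x) v))"

text \<open>On an arbitrary subset, a smooth map is one that locally extends to a smooth map on an open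
  set of the ambient space.\<close>

definition smooth_on :: "'a::real_normed_vector set \<Rightarrow> ('a \<Rightarrow> 'b::real_normed_vector) \<Rightarrow> bool" where
  "smooth_on A f \<longleftrightarrow> (\<forall>x\<in>A. \<exists>U g. open U \<and> x \<in> U \<and> (\<forall>k. Ck_on k U g) \<and> (\<forall>y\<in>A \<inter> U. f y = g y))"

definition diffeo :: "'a::real_normed_vector set \<Rightarrow> 'b::real_normed_vector set \<Rightarrow> ('a \<Rightarrow> 'b) \<Rightarrow> bool" where
  "diffeo A B f \<longleftrightarrow> bij_betw f A B \<and> smooth_on A f \<and> smooth_on B (the_inv_into A f)"

definition closed_three_manifold :: "'m::euclidean_space set \<Rightarrow> bool" where
  "closed_three_manifold M \<longleftrightarrow> compact M \<and>
     (\<forall>x\<in>M. \<exists>W V f. x \<in> W \<and> openin (top_of_set M) W \<and> open (V :: (real^3) set) \<and> diffeo W V f)"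

definition half_plane_chart ::
    "'a::euclidean_space set \<Rightarrow> 'a set \<Rightarrow> complex set \<Rightarrow> ('a \<Rightarrow> complex) \<Rightarrow> bool" where
  "half_plane_chart S W V f \<longleftrightarrow>
     openin (top_of_set S) W \<and> openin (top_of_set {z. Im z \<ge> 0}) V \<and> diffeo W V f"

definition compact_surface :: "'a::euclidean_space set \<Rightarrow> bool" where
  "compact_surface S \<longleftrightarrow> compact S \<and> (\<forall>x\<in>S. \<exists>W V f. x \<in> W \<and> half_plane_chart S W V f)"

definition surface_boundary :: "'a::euclidean_space set \<Rightarrow> 'a set" where
  "surface_boundary S = {x\<in>S. \<exists>W V f. x \<in> W \<and> half_plane_chart S W V f \<and> Im (f x) = 0}"

text \<open>Spanned by one-sided velocities, so that it is the full tangent space at boundary points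
  as well.\<close>

definition tangent_space :: "'a::euclidean_space set \<Rightarrow> 'a \<Rightarrow> 'a set" where
  "tangent_space A x = span {v. \<exists>g e. e > 0 \<and> smooth_on {0..<e} g \<and> g ` {0..<e} \<subseteq> A \<and> g 0 = x \<and>
      (g has_vector_derivative v) (at 0 within {0..<e::real})}"

text \<open>
  Throughout, the differential of a map along a submanifold \<open>A\<close> is any \<open>D\<close> with
  \<open>(f has_derivative D) (at x within A)\<close>; such a \<open>D\<close> is unique on \<open>tangent_space A x\<close>, and it is
  only ever applied there.
\<close>

definition immersion_on :: "'a::euclidean_space set \<Rightarrow> ('a \<Rightarrow> 'b::euclidean_space) \<Rightarrow> bool" where
  "immersion_on A f \<longleftrightarrow> smooth_on A f \<and>
     (\<forall>x\<in>A. \<forall>D. (f has_derivative D) (at x within A) \<longrightarrow> (\<forall>v\<in>tangent_space A x. D v = 0 \<longrightarrow> v = 0))"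


section \<open>The local model in \<open>\<complex>\<^sup>2\<close>\<close>

definition Jo :: "complex \<times> complex \<Rightarrow> complex \<times> complex" where
  "Jo v = (\<i> * fst v, \<i> * snd v)"

definition Xfield :: "real \<Rightarrow> complex \<times> complex \<Rightarrow> complex \<times> complex" where
  "Xfield c z = (- \<i> * fst z, of_real c * \<i> * snd z)"

definition Yfield :: "real \<Rightarrow> complex \<times> complex \<Rightarrow> complex \<times> complex" where
  "Yfield c z = - Jo (Xfield c z)"

definition Xflow :: "real \<Rightarrow> real \<Rightarrow> complex \<times> complex \<Rightarrow> complex \<times> complex" where
  "Xflow c t z = (cis (- t) * fst z, cis (c * t) * snd z)"

definition Yflow :: "real \<Rightarrow> real \<Rightarrow> complex \<times> complex \<Rightarrow> complex \<times> complex" where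
  "Yflow c t z = (of_real (exp (- t)) * fst z, of_real (exp (c * t)) * snd z)"

definition nbhd :: "real \<Rightarrow> (complex \<times> complex) set" where
  "nbhd \<epsilon> = {z. - (norm (fst z))\<^sup>2 + (norm (snd z))\<^sup>2 = -1 \<and> norm (snd z) < \<epsilon>}"

definition nhat :: "real \<Rightarrow> real \<Rightarrow> (real \<Rightarrow> real) \<Rightarrow> (complex \<times> complex) set" where
  "nhat c \<epsilon> s = {z. - exp (- 2 * s (norm (snd z))) * (norm (fst z))\<^sup>2
       + exp (2 * c * s (norm (snd z))) * (norm (snd z))\<^sup>2 = 1 \<and> norm (snd z) < \<epsilon>}"

definition gamma_hat :: "real \<Rightarrow> real \<Rightarrow> (real \<Rightarrow> real) \<Rightarrow> (complex \<times> complex) set" where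
  "gamma_hat c \<epsilon> s = {z \<in> nhat c \<epsilon> s. fst z = 0}"

text \<open>The value at \<open>r\<^sub>2 = 0\<close> is irrelevant: no point of \<^term>\<open>nhat c \<epsilon> s\<close> has \<open>r\<^sub>2 = 0\<close>.\<close>

definition surgery_profile :: "real \<Rightarrow> real \<Rightarrow> real \<Rightarrow> (real \<Rightarrow> real) \<Rightarrow> bool" where
  "surgery_profile c \<epsilon> \<epsilon>' s \<longleftrightarrow>
     0 < \<epsilon>' \<and> \<epsilon>' < \<epsilon> \<and> smooth_on {0<..<\<epsilon>} s \<and> (\<forall>r\<in>{0<..<\<epsilon>}. s r > 0) \<and>
     {z \<in> nhat c \<epsilon> s. norm (snd z) > \<epsilon>'} = {z \<in> nbhd \<epsilon>. norm (snd z) > \<epsilon>'} \<and>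
     (\<exists>f. diffeo (ball (0::complex) 1 \<times> sphere (0::complex) 1) (nhat c \<epsilon> s) f \<and>
          f ` ({0} \<times> sphere 0 1) = gamma_hat c \<epsilon> s) \<and>
     (\<forall>z \<in> nhat c \<epsilon> s. Yfield c z \<notin> tangent_space (nhat c \<epsilon> s) z)"

text \<open>The one-form \<open>\<lambda>'\<close>, with \<open>r\<^sub>j\<^sup>2 d\<theta>\<^sub>j (v) = Im (cnj z\<^sub>j * v\<^sub>j)\<close>.\<close>

definition lambda' :: "real \<Rightarrow> complex \<times> complex \<Rightarrow> complex \<times> complex \<Rightarrow> real" where
  "lambda' c z v =
     (- (1 + (norm (snd z))\<^sup>2) * (Im (cnj (fst z) * fst v) / (norm (fst z))\<^sup>2) + Im (cnj (snd z) * snd v))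
       / (1 + (1 + c) * (norm (snd z))\<^sup>2)"

definition Phi :: "real \<Rightarrow> real \<Rightarrow> real \<Rightarrow> complex \<times> complex" where
  "Phi p r \<theta> = (of_real (sqrt (1 + r\<^sup>2)) * cis (- p), of_real r * cis \<theta>)"


section \<open>Open books\<close>

definition area_form :: "'a::euclidean_space set \<Rightarrow> ('a \<Rightarrow> 'a \<Rightarrow> 'a \<Rightarrow> real) \<Rightarrow> bool" where
  "area_form S \<omega> \<longleftrightarrow> (\<forall>v w. smooth_on S (\<lambda>x. \<omega> x v w)) \<and>
     (\<forall>x\<in>S. bilinear (\<omega> x) \<and> (\<forall>v\<in>tangent_space S x. \<omega> x v v = 0) \<and>
        (\<forall>v\<in>tangent_space S x. v \<noteq> 0 \<longrightarrow> (\<exists>w\<in>tangent_space S x. \<omega> x v w \<noteq> 0)))"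

definition symplecto :: "'a::euclidean_space set \<Rightarrow> ('a \<Rightarrow> 'a \<Rightarrow> 'a \<Rightarrow> real) \<Rightarrow> ('a \<Rightarrow> 'a) \<Rightarrow> bool" where
  "symplecto S \<omega> \<phi> \<longleftrightarrow> diffeo S S \<phi> \<and>
     (\<forall>x\<in>S. \<forall>D. (\<phi> has_derivative D) (at x within S) \<longrightarrow>
        (\<forall>v\<in>tangent_space S x. \<forall>w\<in>tangent_space S x. \<omega> (\<phi> x) (D v) (D w) = \<omega> x v w))"

text \<open>
  A page with connected boundary and its monodromy.  The boundary circle comes with a collar
  \<open>\<beta> (p, r)\<close>, \<open>\<epsilon> \<le> r < \<epsilon>1\<close>, with \<open>p\<close> of period \<open>2\<pi>\<close>, on which the monodromy is the identity; it
  fixes the smooth structure of the glued manifold.  The sign condition says that \<open>p\<close> runs along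
  the boundary in the boundary orientation (\<open>r\<close> increases towards the interior of the page).
\<close>

definition page_with_monodromy ::
    "real \<Rightarrow> real \<Rightarrow> 'a::euclidean_space set \<Rightarrow> ('a \<Rightarrow> 'a \<Rightarrow> 'a \<Rightarrow> real) \<Rightarrow> ('a \<Rightarrow> 'a)
      \<Rightarrow> (real \<times> real \<Rightarrow> 'a) \<Rightarrow> bool" where
  "page_with_monodromy \<epsilon> \<epsilon>1 S \<omega> \<phi> \<beta> \<longleftrightarrow>
     compact_surface S \<and> connected S \<and> area_form S \<omega> \<and> symplecto S \<omega> \<phi> \<and>
     smooth_on (UNIV \<times> {\<epsilon>..<\<epsilon>1}) \<beta> \<and>
     (\<forall>p. \<forall>r\<in>{\<epsilon>..<\<epsilon>1}. \<beta> (p + 2 * pi, r) = \<beta> (p, r) \<and> \<phi> (\<beta> (p, r)) = \<beta> (p, r)) \<and>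
     inj_on \<beta> ({0..<2 * pi} \<times> {\<epsilon>..<\<epsilon>1}) \<and>
     openin (top_of_set S) (\<beta> ` (UNIV \<times> {\<epsilon>..<\<epsilon>1})) \<and>
     surface_boundary S = \<beta> ` (UNIV \<times> {\<epsilon>}) \<and>
     (\<forall>p. \<forall>r\<in>{\<epsilon>..<\<epsilon>1}. \<forall>D. (\<beta> has_derivative D) (at (p, r) within UNIV \<times> {\<epsilon>..<\<epsilon>1}) \<longrightarrow>
        \<omega> (\<beta> (p, r)) (D (1, 0)) (D (0, 1)) > 0)"

text \<open>\<open>T\<close> is the mapping torus of \<open>f\<close>; \<open>q\<close> is the quotient map extended from \<open>S \<times> [0,1]\<close> to the
  infinite cyclic cover \<open>S \<times> \<real>\<close>, which encodes the smooth structure at the seam.\<close>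

definition mapping_torus ::
    "'a::euclidean_space set \<Rightarrow> ('a \<Rightarrow> 'a) \<Rightarrow> 'm::euclidean_space set \<Rightarrow> ('a \<times> real \<Rightarrow> 'm) \<Rightarrow> bool" where
  "mapping_torus S f T q \<longleftrightarrow>
     immersion_on (S \<times> UNIV) q \<and> q ` (S \<times> UNIV) = T \<and>
     (\<forall>x\<in>S. \<forall>t. q (f x, t) = q (x, t + 1)) \<and> inj_on q (S \<times> {0..<1})"

text \<open>
  \<open>M = \<Sigma>\<^sub>\<phi> \<union> (B \<times> D\<^sup>2)\<close>, where \<open>q\<close> parametrises \<open>\<Sigma>\<^sub>\<phi>\<close> and \<open>\<Psi>\<close> embeds the solid torus
  \<^term>\<open>nbhd \<epsilon>1\<close>; the part over \<open>r \<ge> \<epsilon>\<close> overlaps the collar, the part \<^term>\<open>nbhd \<epsilon>\<close> is the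
  neighbourhood called \<open>N\<close>.  \<open>M\<close> is oriented by the orientation of the page followed by \<open>\<partial>\<^sub>t\<close>.
\<close>

definition open_book ::
    "real \<Rightarrow> real \<Rightarrow> 'a::euclidean_space set \<Rightarrow> ('a \<Rightarrow> 'a \<Rightarrow> 'a \<Rightarrow> real) \<Rightarrow> ('a \<Rightarrow> 'a) \<Rightarrow> (real \<times> real \<Rightarrow> 'a)
      \<Rightarrow> 'm::euclidean_space set \<Rightarrow> ('a \<times> real \<Rightarrow> 'm) \<Rightarrow> (complex \<times> complex \<Rightarrow> 'm) \<Rightarrow> bool" where
  "open_book \<epsilon> \<epsilon>1 S \<omega> \<phi> \<beta> M q \<Psi> \<longleftrightarrow>
     0 < \<epsilon> \<and> \<epsilon> < \<epsilon>1 \<and> page_with_monodromy \<epsilon> \<epsilon>1 S \<omega> \<phi> \<beta> \<and>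
     closed_three_manifold M \<and>
     mapping_torus S \<phi> (q ` (S \<times> UNIV)) q \<and>
     diffeo (nbhd \<epsilon>1) (\<Psi> ` nbhd \<epsilon>1) \<Psi> \<and>
     M = q ` (S \<times> UNIV) \<union> \<Psi> ` nbhd \<epsilon>1 \<and>
     q ` (S \<times> UNIV) \<inter> \<Psi> ` nbhd \<epsilon>1 = \<Psi> ` {z \<in> nbhd \<epsilon>1. norm (snd z) \<ge> \<epsilon>} \<and>
     (\<forall>p t. \<forall>r\<in>{\<epsilon>..<\<epsilon>1}. q (\<beta> (p, r), t) = \<Psi> (Phi p r (2 * pi * t)))"

definition binding :: "(complex \<times> complex \<Rightarrow> 'm) \<Rightarrow> 'm set" where
  "binding \<Psi> = range (\<lambda>p. \<Psi> (Phi p 0 0))"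


section \<open>Contact forms and almost complex structures\<close>

definition ext_deriv :: "('m::euclidean_space \<Rightarrow> 'm \<Rightarrow> real) \<Rightarrow> 'm \<Rightarrow> 'm \<Rightarrow> 'm \<Rightarrow> real" where
  "ext_deriv \<alpha> x v w =
     frechet_derivative (\<lambda>y. \<alpha> y w) (at x) v - frechet_derivative (\<lambda>y. \<alpha> y v) (at x) w"

definition wedge_d :: "('m::euclidean_space \<Rightarrow> 'm \<Rightarrow> real) \<Rightarrow> 'm \<Rightarrow> 'm \<Rightarrow> 'm \<Rightarrow> 'm \<Rightarrow> real" where
  "wedge_d \<alpha> x u v w =
     \<alpha> x u * ext_deriv \<alpha> x v w + \<alpha> x v * ext_deriv \<alpha> x w u + \<alpha> x w * ext_deriv \<alpha> x u v"

text \<open>A form on \<open>M\<close> is given by an extension to a neighbourhood of \<open>M\<close> in the ambient space; on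
  tangent vectors its exterior derivative does not depend on the extension.\<close>

definition contact_form :: "'m::euclidean_space set \<Rightarrow> ('m \<Rightarrow> 'm \<Rightarrow> real) \<Rightarrow> bool" where
  "contact_form M \<alpha> \<longleftrightarrow>
     (\<exists>U. open U \<and> M \<subseteq> U \<and> (\<forall>x\<in>U. linear (\<alpha> x)) \<and> (\<forall>v. smooth_on U (\<lambda>x. \<alpha> x v))) \<and>
     (\<forall>x\<in>M. \<exists>u\<in>tangent_space M x. \<exists>v\<in>tangent_space M x. \<exists>w\<in>tangent_space M x. wedge_d \<alpha> x u v w \<noteq> 0)"

text \<open>Giroux's conditions: \<open>\<alpha>\<close> is a positive contact form, positive on the oriented binding, and
  \<open>d\<alpha>\<close> is a positive area form on the pages.\<close>

definition supported_by ::
    "('m::euclidean_space \<Rightarrow> 'm \<Rightarrow> real) \<Rightarrow> 'a::euclidean_space set \<Rightarrow> ('a \<Rightarrow> 'a \<Rightarrow> 'a \<Rightarrow> real)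
      \<Rightarrow> ('a \<times> real \<Rightarrow> 'm) \<Rightarrow> (complex \<times> complex \<Rightarrow> 'm) \<Rightarrow> bool" where
  "supported_by \<alpha> S \<omega> q \<Psi> \<longleftrightarrow>
     (\<forall>p v. ((\<lambda>p. \<Psi> (Phi p 0 0)) has_vector_derivative v) (at p) \<longrightarrow> \<alpha> (\<Psi> (Phi p 0 0)) v > 0) \<and>
     (\<forall>x\<in>S. \<forall>t D. (q has_derivative D) (at (x, t) within S \<times> UNIV) \<longrightarrow>
        (\<forall>v\<in>tangent_space S x. \<forall>w\<in>tangent_space S x. \<omega> x v w > 0 \<longrightarrow>
           ext_deriv \<alpha> (q (x, t)) (D (v, 0)) (D (w, 0)) > 0 \<and>
           wedge_d \<alpha> (q (x, t)) (D (v, 0)) (D (w, 0)) (D (0, 1)) > 0))"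

text \<open>\<open>\<alpha> = \<Phi>\<^sup>* \<lambda>'\<close> on \<open>B \<times> D\<^sup>2\<close>.  With \<^const>\<open>supported_by\<close> this covers also the part of the pages inside \<open>N\<close>,
  where the positivity conditions hold for \<^const>\<open>lambda'\<close>.\<close>

definition standard_near_binding ::
    "real \<Rightarrow> real \<Rightarrow> (complex \<times> complex \<Rightarrow> 'm::euclidean_space) \<Rightarrow> ('m \<Rightarrow> 'm \<Rightarrow> real) \<Rightarrow> bool" where
  "standard_near_binding c \<epsilon> \<Psi> \<alpha> \<longleftrightarrow>
     (\<forall>z\<in>nbhd \<epsilon>. \<forall>D. (\<Psi> has_derivative D) (at z within nbhd \<epsilon>) \<longrightarrow>
        (\<forall>v\<in>tangent_space (nbhd \<epsilon>) z. \<alpha> (\<Psi> z) (D v) = lambda' c z v))"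

definition reeb_field :: "'m::euclidean_space set \<Rightarrow> ('m \<Rightarrow> 'm \<Rightarrow> real) \<Rightarrow> ('m \<Rightarrow> 'm) \<Rightarrow> bool" where
  "reeb_field M \<alpha> R \<longleftrightarrow> (\<forall>x\<in>M. R x \<in> tangent_space M x \<and> \<alpha> x (R x) = 1 \<and>
     (\<forall>v\<in>tangent_space M x. ext_deriv \<alpha> x (R x) v = 0))"

definition closed_orbit :: "'m::euclidean_space set \<Rightarrow> ('m \<Rightarrow> 'm) \<Rightarrow> (real \<Rightarrow> 'm) \<Rightarrow> real \<Rightarrow> bool" where
  "closed_orbit M R \<gamma> T \<longleftrightarrow> T > 0 \<and>
     (\<forall>t. \<gamma> t \<in> M \<and> (\<gamma> has_vector_derivative R (\<gamma> t)) (at t) \<and> \<gamma> (t + T) = \<gamma> t)"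

text \<open>On \<open>N\<close> the Reeb field is \<^const>\<open>Xfield\<close>, so the binding \<open>p \<mapsto> \<Psi> (Phi p 0 0)\<close> is a Reeb orbit of
  period \<open>2\<pi>\<close>.\<close>

definition multiple_of_binding :: "(complex \<times> complex \<Rightarrow> 'm) \<Rightarrow> (real \<Rightarrow> 'm) \<Rightarrow> real \<Rightarrow> bool" where
  "multiple_of_binding \<Psi> \<gamma> T \<longleftrightarrow>
     (\<exists>k::nat. T = real k * (2 * pi)) \<and> (\<exists>d. \<forall>t. \<gamma> t = \<Psi> (Phi (t + d) 0 0))"

text \<open>\<open>\<real>\<close>-invariant almost complex structures on \<open>\<real> \<times> M\<close>.  They are given by linear maps of the
  ambient space preserving the tangent spaces of \<open>\<real> \<times> M\<close>; only their restriction to these is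
  meaningful.\<close>

definition invariant_almost_complex ::
    "'m::euclidean_space set \<Rightarrow> (real \<times> 'm \<Rightarrow> real \<times> 'm \<Rightarrow> real \<times> 'm) \<Rightarrow> bool" where
  "invariant_almost_complex M J \<longleftrightarrow>
     (\<forall>v. smooth_on (UNIV \<times> M) (\<lambda>p. J p v)) \<and>
     (\<forall>p\<in>UNIV \<times> M. linear (J p) \<and>
        (\<forall>v\<in>tangent_space (UNIV \<times> M) p. J p v \<in> tangent_space (UNIV \<times> M) p \<and> J p (J p v) = - v)) \<and>
     (\<forall>t. \<forall>x\<in>M. J (t, x) = J (0, x))"

definition admissible ::
    "'m::euclidean_space set \<Rightarrow> ('m \<Rightarrow> 'm \<Rightarrow> real) \<Rightarrow> ('m \<Rightarrow> 'm)
      \<Rightarrow> (real \<times> 'm \<Rightarrow> real \<times> 'm \<Rightarrow> real \<times> 'm) \<Rightarrow> bool" where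
  "admissible M \<alpha> R J \<longleftrightarrow> invariant_almost_complex M J \<and>
     (\<forall>t. \<forall>x\<in>M. J (t, x) (1, 0) = (0, R x) \<and>
        (\<forall>v\<in>tangent_space M x. \<alpha> x v = 0 \<longrightarrow>
           fst (J (t, x) (0, v)) = 0 \<and> \<alpha> x (snd (J (t, x) (0, v))) = 0 \<and>
           (v \<noteq> 0 \<longrightarrow> ext_deriv \<alpha> x v (snd (J (t, x) (0, v))) > 0) \<and>
           (\<forall>w\<in>tangent_space M x. \<alpha> x w = 0 \<longrightarrow>
              ext_deriv \<alpha> x (snd (J (t, x) (0, v))) (snd (J (t, x) (0, w))) = ext_deriv \<alpha> x v w)))"

text \<open>
  \<open>E\<close> and \<open>F\<close> identify \<open>A\<close> with subsets (of full dimension) of two almost complex manifolds, and under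
  these identifications the almost complex structures \<open>JE\<close> and \<open>JF\<close> agree.
\<close>

definition structures_agree ::
    "'x::euclidean_space set \<Rightarrow> ('x \<Rightarrow> 'y::euclidean_space) \<Rightarrow> ('y \<Rightarrow> 'y \<Rightarrow> 'y)
      \<Rightarrow> ('x \<Rightarrow> 'z::euclidean_space) \<Rightarrow> ('z \<Rightarrow> 'z \<Rightarrow> 'z) \<Rightarrow> bool" where
  "structures_agree A E JE F JF \<longleftrightarrow>
     (\<forall>x\<in>A. \<forall>DE DF. (E has_derivative DE) (at x within A) \<longrightarrow> (F has_derivative DF) (at x within A) \<longrightarrow>
        (\<forall>v\<in>tangent_space A x. \<forall>w\<in>tangent_space A x.
           DE w = JE (E x) (DE v) \<longrightarrow> DF w = JF (F x) (DF v)))"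

text \<open>\<open>J = J\<^sub>o\<close> on \<open>\<real> \<times> N\<close>, where \<open>A = N\<close> is embedded by \<open>\<Psi>\<close>, and \<open>{t} \<times> N\<close> is identified with
  \<open>Y\<^sup>t N\<close>; likewise for \<^const>\<open>nhat\<close>.\<close>

definition standard_complex_on ::
    "real \<Rightarrow> (complex \<times> complex) set \<Rightarrow> (complex \<times> complex \<Rightarrow> 'm::euclidean_space)
      \<Rightarrow> (real \<times> 'm \<Rightarrow> real \<times> 'm \<Rightarrow> real \<times> 'm) \<Rightarrow> bool" where
  "standard_complex_on c A \<Psi> J \<longleftrightarrow>
     structures_agree (UNIV \<times> A) (\<lambda>(t, z). Yflow c t z) (\<lambda>_. Jo) (\<lambda>(t, z). (t, \<Psi> z)) J"


section \<open>The \<open>0\<close>-surgery\<close>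

text \<open>
  The surgered manifold \<open>Mh\<close> is the union of \<open>\<Sigma>\<^sub>\<phi>\<close> and the solid torus \<^const>\<open>nhat\<close>, where \<open>\<psi>\<close> is the inclusion of \<open>M\<close> minus a smaller solid torus and \<open>\<Psi>h\<close> that
  of \<^const>\<open>nhat\<close>; they agree on the common part \<open>r\<^sub>2 > \<epsilon>'\<close>.  At the same time \<open>Mh\<close> is the mapping torus of
  the extension \<open>\<phi>h\<close> of \<open>\<phi>\<close> by the identity to \<open>Sh = S \<union> D\<close>, with quotient map \<open>qh\<close>; the
  discs in the fibres lie in the slices \<open>\<theta>\<^sub>2 = 2\<pi>t\<close> of \<^const>\<open>nhat\<close>.
\<close>

definition zero_surgery ::
    "real \<Rightarrow> real \<Rightarrow> real \<Rightarrow> (real \<Rightarrow> real) \<Rightarrow> 'a::euclidean_space set \<Rightarrow> ('a \<Rightarrow> 'a)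
      \<Rightarrow> 'm::euclidean_space set \<Rightarrow> ('a \<times> real \<Rightarrow> 'm) \<Rightarrow> (complex \<times> complex \<Rightarrow> 'm)
      \<Rightarrow> 'a set \<Rightarrow> 'a set \<Rightarrow> ('a \<Rightarrow> 'a)
      \<Rightarrow> 'n::euclidean_space set \<Rightarrow> ('a \<times> real \<Rightarrow> 'n) \<Rightarrow> ('m \<Rightarrow> 'n) \<Rightarrow> (complex \<times> complex \<Rightarrow> 'n) \<Rightarrow> bool" where
  "zero_surgery c \<epsilon> \<epsilon>' s S \<phi> M q \<Psi> Sh D \<phi>h Mh qh \<psi> \<Psi>h \<longleftrightarrow>
     compact_surface Sh \<and> surface_boundary Sh = {} \<and>
     Sh = S \<union> D \<and> S \<inter> D = surface_boundary S \<and> (\<exists>f. diffeo (cball (0::complex) 1) D f) \<and>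
     (\<forall>x\<in>S. \<phi>h x = \<phi> x) \<and> (\<forall>x\<in>D. \<phi>h x = x) \<and>
     closed_three_manifold Mh \<and> mapping_torus Sh \<phi>h Mh qh \<and>
     diffeo (M - \<Psi> ` {z \<in> nbhd \<epsilon>. norm (snd z) \<le> \<epsilon>'})
            (\<psi> ` (M - \<Psi> ` {z \<in> nbhd \<epsilon>. norm (snd z) \<le> \<epsilon>'})) \<psi> \<and>
     diffeo (nhat c \<epsilon> s) (\<Psi>h ` nhat c \<epsilon> s) \<Psi>h \<and>
     (\<forall>z\<in>nbhd \<epsilon>. norm (snd z) > \<epsilon>' \<longrightarrow> \<psi> (\<Psi> z) = \<Psi>h z) \<and>
     (\<forall>x\<in>S. \<forall>t. \<psi> (q (x, t)) = qh (x, t)) \<and>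
     Mh = \<psi> ` q ` (S \<times> UNIV) \<union> \<Psi>h ` nhat c \<epsilon> s \<and>
     \<psi> ` q ` (S \<times> UNIV) \<inter> \<Psi>h ` nhat c \<epsilon> s = {} \<and>
     (\<forall>x\<in>D - S. \<forall>t. \<exists>z\<in>nhat c \<epsilon> s. qh (x, t) = \<Psi>h z \<and> snd z = of_real (norm (snd z)) * cis (2 * pi * t))"

text \<open>
  The identification of \<open>\<real> \<times> (M - B)\<close> with the complement in \<open>\<real> \<times> Mh\<close> of \<open>\<real> \<times> e\<close>, where
  \<open>e = \<Psi>h ` \<close>\<^const>\<open>gamma_hat\<close> is the distinguished orbit (traversed by \<^const>\<open>Xflow\<close>, so of simple
  period \<open>2\<pi>/c\<close>): the identity over
  \<open>\<Sigma>\<^sub>\<phi>\<close>, and over \<open>N\<close> the identity of the common image in \<open>\<complex>\<^sup>2\<close>, that is,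
  \<open>(t, z) \<mapsto> (t', z')\<close> with \<open>Y\<^sup>t z = Y\<^sup>t\<^sup>' z'\<close>.  It has no meaning on \<open>\<real> \<times> B\<close>.
\<close>

definition transfer ::
    "real \<Rightarrow> real \<Rightarrow> (real \<Rightarrow> real) \<Rightarrow> (complex \<times> complex \<Rightarrow> 'm) \<Rightarrow> ('m \<Rightarrow> 'n) \<Rightarrow> (complex \<times> complex \<Rightarrow> 'n)
      \<Rightarrow> real \<times> 'm \<Rightarrow> real \<times> 'n" where
  "transfer c \<epsilon> s \<Psi> \<psi> \<Psi>h y =
     (if snd y \<in> \<Psi> ` nbhd \<epsilon> then
        (let y' = the_inv_into (UNIV \<times> nhat c \<epsilon> s) (\<lambda>(t, z). Yflow c t z)
                    (Yflow c (fst y) (the_inv_into (nbhd \<epsilon>) \<Psi> (snd y)))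
         in (fst y', \<Psi>h (snd y')))
      else (fst y, \<psi> (snd y)))"


section \<open>Holomorphic curves\<close>

text \<open>Domains are open subsets of \<open>\<complex>\<close>, regarded as part of the Riemann sphere.\<close>

definition J_holomorphic_on ::
    "complex set \<Rightarrow> 'm::euclidean_space set \<Rightarrow> (real \<times> 'm \<Rightarrow> real \<times> 'm \<Rightarrow> real \<times> 'm)
      \<Rightarrow> (complex \<Rightarrow> real \<times> 'm) \<Rightarrow> bool" where
  "J_holomorphic_on U M J u \<longleftrightarrow> open U \<and> smooth_on U u \<and> u ` U \<subseteq> UNIV \<times> M \<and>
     (\<forall>w\<in>U. \<forall>v. frechet_derivative u (at w) (\<i> * v) = J (u w) (frechet_derivative u (at w) v))"

text \<open>
  Convergence to the cylinder over the \<open>T\<close>-periodic orbit \<open>\<gamma>\<close> in holomorphic cylindrical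
  coordinates \<open>\<sigma> + i\<tau>\<close>, \<open>\<tau> \<in> \<real>/\<int>\<close>, at a puncture at \<open>\<infinity>\<close> (positive end) or at a finite point
  \<open>w\<^sub>0\<close> (negative end).  For a simple orbit of period \<open>T\<^sub>0\<close>, its \<open>m\<close>-th iterate is the case
  \<open>T = m T\<^sub>0\<close>.
\<close>

definition positive_end_at_infinity ::
    "(complex \<Rightarrow> real \<times> 'm::euclidean_space) \<Rightarrow> (real \<Rightarrow> 'm) \<Rightarrow> real \<Rightarrow> bool" where
  "positive_end_at_infinity u \<gamma> T \<longleftrightarrow>
     (\<exists>a d. uniform_limit UNIV (\<lambda>\<sigma> \<tau>. u (exp (of_real (2 * pi) * Complex \<sigma> \<tau>)) - (T * \<sigma>, 0))
              (\<lambda>\<tau>. (a, \<gamma> (T * \<tau> + d))) at_top)"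

definition negative_end_at ::
    "complex \<Rightarrow> (complex \<Rightarrow> real \<times> 'm::euclidean_space) \<Rightarrow> (real \<Rightarrow> 'm) \<Rightarrow> real \<Rightarrow> bool" where
  "negative_end_at w0 u \<gamma> T \<longleftrightarrow>
     (\<exists>a d. uniform_limit UNIV (\<lambda>\<sigma> \<tau>. u (w0 + exp (of_real (2 * pi) * Complex \<sigma> \<tau>)) - (T * \<sigma>, 0))
              (\<lambda>\<tau>. (a, \<gamma> (T * \<tau> + d))) at_bot)"

text \<open>The local intersection number with \<open>\<real> \<times> B\<close> at \<open>u w\<close>: the degree around \<open>w\<close> of the normal
  coordinate \<open>z\<^sub>2\<close>.\<close>

definition intersection_multiplicity ::
    "real \<Rightarrow> (complex \<times> complex \<Rightarrow> 'm) \<Rightarrow> (complex \<Rightarrow> real \<times> 'm) \<Rightarrow> complex \<Rightarrow> nat \<Rightarrow> bool" where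
  "intersection_multiplicity \<epsilon> \<Psi> u w m \<longleftrightarrow>
     (\<forall>\<^sub>F r in at_right 0.
        winding_number (\<lambda>x. snd (the_inv_into (nbhd \<epsilon>) \<Psi> (snd (u (circlepath w r x))))) 0 = of_nat m)"

end

theory Submission
  imports Defs
begin

text \<open>
  Along the flow of \<open>Y\<close> both solid tori \<open>N\<close> and \<open>N'\<close> (the new one) project to curves in the quadrant
  \<open>(r\<^sub>1, r\<^sub>2)\<close>, and \<open>c ln r\<^sub>1 + ln r\<^sub>2\<close> is a first integral which, by transversality, is strictly increasing
  in \<open>r\<^sub>2\<close> on each of them.  Matching its values expresses the identification of the two
  symplectizations off the binding as \<open>(t, z) \<mapsto> (t + \<delta>, Y\<^sup>-\<^sup>\<delta> z)\<close> with \<open>\<delta>\<close> a smooth function of \<open>r\<^sub>2 > 0\<close>.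
  Over \<open>N\<close> a curve and its lift have the same image in \<open>\<complex>\<^sup>2\<close>, so one is holomorphic iff the other is.
  Near a point of \<open>\<real> \<times> B\<close> the coordinate \<open>z\<^sub>2\<close> of the curve is \<open>(w - p)\<^sup>m G(w)\<close> by removable singularities,
  while \<open>r\<^sub>2\<close> of the lift tends to the radius of the new core; hence the \<open>\<real>\<close>-coordinate of the lift is
  \<open>(m ln |w - p|) / c\<close> up to a convergent term, and \<open>\<theta>\<^sub>2\<close> winds \<open>m\<close> times.  A Reeb orbit other than a
  multiple of \<open>B\<close> avoids \<open>B\<close> by uniqueness for the linear flow of \<open>X\<close>, and the identification is continuous
  there, which gives the asymptotics at the two old ends.
\<close>

section \<open>Smooth maps\<close>

text \<open>Nonvanishing of the derivative only makes the first integral monotone on the new torus;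
  the direction comes from its tending to minus infinity at the new core, where
  \<open>r\<^sub>1\<close> vanishes. As \<open>r\<^sub>2\<close> tends to 0 on \<open>N\<close>, the
  matching radius tends to the positive radius of that core, so the time shift tends to minus
  infinity: this is why every extra puncture is negative. The obstacle in comparing complex
  structures is that \<open>structures_agree\<close> carries a relation between tangent vectors from
  one chart to another in one direction only, and that differentials along a subset are determined
  on tangent vectors alone. Going from \<open>M\<close> back to \<open>\<complex>\<^sup>2\<close>
  therefore uses that the differential of the flow chart is onto, which is established off
  \<open>z\<^sub>2 = 0\<close>. The points left out are the intersections with the binding, where
  removable singularities take over.\<close>

lemma Ck_on_cong:
  assumes "open U" "\<And>x. x \<in> U \<Longrightarrow> f x = g x" "Ck_on k U f"
  shows "Ck_on k U g"
  using assms(2,3)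
proof (induction k arbitrary: f g)
  case 0
  then show ?case by (simp cong: continuous_on_cong)
next
  case (Suc k)
  have D: "(g has_derivative frechet_derivative f (at x)) (at x)" if "x \<in> U" for x
  proof (rule has_derivative_transform_within_open[OF _ assms(1) that])
    show "(f has_derivative frechet_derivative f (at x)) (at x)"
      using Suc.prems(2) that frechet_derivative_works by auto
  qed (use Suc.prems in auto)
  then have "frechet_derivative g (at x) = frechet_derivative f (at x)" if "x \<in> U" for x
    using frechet_derivative_at that by metis
  then have "Ck_on k U (\<lambda>x. frechet_derivative g (at x) v)" for v
    using Suc.IH[of "\<lambda>x. frechet_derivative f (at x) v" "\<lambda>x. frechet_derivative g (at x) v"] Suc.prems(2) by auto
  then show ?case
    using D by (auto simp: differentiable_def)
qed

text \<open>\<open>Ck_on\<close> refers to \<open>frechet_derivative\<close>, a choice operator. On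
  an open set uniqueness of the derivative identifies it with any explicit formula \<open>D\<close>,
  so regularity can be proved from formulas.\<close>

lemma Ck_on_SucI:
  assumes "open U" "\<And>x. x \<in> U \<Longrightarrow> (f has_derivative D x) (at x)" "\<And>v. Ck_on k U (\<lambda>x. D x v)"
  shows "Ck_on (Suc k) U f"
proof -
  have "Ck_on k U (\<lambda>x. frechet_derivative f (at x) v)" for v
    by (rule Ck_on_cong[OF assms(1) _ assms(3)[of v]]) (use assms(2) frechet_derivative_at in metis)
  then show ?thesis
    using assms(2) by (auto simp: differentiable_def)
qed

lemma Ck_on_has_derivative:
  "Ck_on (Suc k) U f \<Longrightarrow> x \<in> U \<Longrightarrow> (f has_derivative frechet_derivative f (at x)) (at x)"
  using frechet_derivative_works by auto

lemma Ck_on_subset: "Ck_on k U f \<Longrightarrow> V \<subseteq> U \<Longrightarrow> Ck_on k V f"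
  by (induction k arbitrary: f) (auto intro: continuous_on_subset)

lemma Ck_on_SucD: "Ck_on (Suc k) U f \<Longrightarrow> Ck_on k U f"
proof (induction k arbitrary: f)
  case 0
  then show ?case
    by (auto intro!: continuous_at_imp_continuous_on dest: differentiable_imp_continuous_within)
next
  case (Suc k)
  then show ?case by (metis Ck_on.simps(2))
qed

lemma Ck_on_local:
  assumes "\<And>x. x \<in> U \<Longrightarrow> \<exists>V. open V \<and> x \<in> V \<and> Ck_on k V f"
  shows "Ck_on k U f"
  using assms
proof (induction k arbitrary: f)
  case 0
  then have "continuous (at x) f" if "x \<in> U" for x
    using that by (metis Ck_on.simps(1) continuous_on_eq_continuous_at)
  then show ?case by (simp add: continuous_at_imp_continuous_on)
next
  case (Suc k)
  have "Ck_on k U (\<lambda>x. frechet_derivative f (at x) v)" for v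
    by (rule Suc.IH) (use Suc.prems in \<open>metis Ck_on.simps(2)\<close>)
  moreover have "\<forall>x\<in>U. f differentiable (at x)"
    using Suc.prems by (metis Ck_on.simps(2))
  ultimately show ?case by simp
qed

lemma Ck_on_const: "open U \<Longrightarrow> Ck_on k U (\<lambda>x. a)"
proof (induction k arbitrary: a)
  case (Suc k)
  show ?case by (rule Ck_on_SucI[OF Suc.prems, where D = "\<lambda>x v. 0"]) (use Suc in auto)
qed auto

lemma Ck_on_bounded_linear: "open U \<Longrightarrow> bounded_linear f \<Longrightarrow> Ck_on k U f"
proof (cases k)
  case 0
  assume "bounded_linear f" then show ?thesis using 0 by (simp add: linear_continuous_on)
next
  case (Suc j)
  assume "open U" "bounded_linear f"
  then show ?thesis
    unfolding Suc by (intro Ck_on_SucI[where D = "\<lambda>x. f"]) (auto simp: bounded_linear_imp_has_derivative Ck_on_const)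
qed

lemma Ck_on_linear_compose: "open U \<Longrightarrow> bounded_linear L \<Longrightarrow> Ck_on k U f \<Longrightarrow> Ck_on k U (\<lambda>x. L (f x))"
proof (induction k arbitrary: f)
  case 0
  then show ?case by (simp add: bounded_linear.continuous_on)
next
  case (Suc k)
  show ?case
  proof (rule Ck_on_SucI[OF Suc.prems(1)])
    show "((\<lambda>x. L (f x)) has_derivative (\<lambda>v. L (frechet_derivative f (at x) v))) (at x)" if "x \<in> U" for x
      by (rule bounded_linear.has_derivative[OF Suc.prems(2) Ck_on_has_derivative[OF Suc.prems(3) that]])
    show "Ck_on k U (\<lambda>x. L (frechet_derivative f (at x) v))" for v
      using Suc by auto
  qed
qed

lemma Ck_on_add: "open U \<Longrightarrow> Ck_on k U f \<Longrightarrow> Ck_on k U g \<Longrightarrow> Ck_on k U (\<lambda>x. f x + g x)"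
proof (induction k arbitrary: f g)
  case 0
  then show ?case by (simp add: continuous_on_add)
next
  case (Suc k)
  show ?case
  proof (rule Ck_on_SucI[OF Suc.prems(1)])
    show "((\<lambda>x. f x + g x) has_derivative (\<lambda>v. frechet_derivative f (at x) v + frechet_derivative g (at x) v)) (at x)"
      if "x \<in> U" for x
      using Suc.prems that by (intro has_derivative_add Ck_on_has_derivative) auto
    show "Ck_on k U (\<lambda>x. frechet_derivative f (at x) v + frechet_derivative g (at x) v)" for v
      using Suc by auto
  qed
qed

lemma Ck_on_sum: "open U \<Longrightarrow> (\<And>i. i \<in> I \<Longrightarrow> Ck_on k U (f i)) \<Longrightarrow> Ck_on k U (\<lambda>x. \<Sum>i\<in>I. f i x)"
  by (induction I rule: infinite_finite_induct) (auto intro: Ck_on_const Ck_on_add)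

lemma Ck_on_bilinear:
  assumes "bounded_bilinear p" "open U"
  shows "Ck_on k U f \<Longrightarrow> Ck_on k U g \<Longrightarrow> Ck_on k U (\<lambda>x. p (f x) (g x))"
proof (induction k arbitrary: f g)
  case 0
  then show ?case by (simp add: bounded_bilinear.continuous_on[OF assms(1)])
next
  case (Suc k)
  show ?case
  proof (rule Ck_on_SucI[where D = "\<lambda>x v. p (f x) (frechet_derivative g (at x) v) + p (frechet_derivative f (at x) v) (g x)"])
    show "((\<lambda>x. p (f x) (g x)) has_derivative (\<lambda>v. p (f x) (frechet_derivative g (at x) v) + p (frechet_derivative f (at x) v) (g x))) (at x)"
      if "x \<in> U" for x
      by (rule bounded_bilinear.FDERIV[OF assms(1) Ck_on_has_derivative[OF Suc.prems(1) that]
            Ck_on_has_derivative[OF Suc.prems(2) that]])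
    show "Ck_on k U (\<lambda>x. p (f x) (frechet_derivative g (at x) v) + p (frechet_derivative f (at x) v) (g x))" for v
      using Suc.prems Suc.prems[THEN Ck_on_SucD] by (intro Ck_on_add Suc.IH assms) auto
  qed (rule assms)
qed

lemma Ck_on_compose:
  fixes f :: "'a::real_normed_vector \<Rightarrow> 'b::euclidean_space" and g :: "'b \<Rightarrow> 'c::real_normed_vector"
  assumes "open U" "open V" "f ` U \<subseteq> V"
  shows "Ck_on k U f \<Longrightarrow> Ck_on k V g \<Longrightarrow> Ck_on k U (\<lambda>x. g (f x))"
proof (induction k arbitrary: g)
  case 0
  then show ?case using assms(3) continuous_on_compose2 by auto
next
  case (Suc k)
  note df = Ck_on_has_derivative[OF Suc.prems(1)] and dg = Ck_on_has_derivative[OF Suc.prems(2)]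
  show ?case
  proof (rule Ck_on_SucI[OF assms(1), where D = "\<lambda>x v. frechet_derivative g (at (f x)) (frechet_derivative f (at x) v)"])
    show "((\<lambda>x. g (f x)) has_derivative (\<lambda>v. frechet_derivative g (at (f x)) (frechet_derivative f (at x) v))) (at x)"
      if "x \<in> U" for x
      using diff_chain_at[OF df dg] that assms(3) by (auto simp: o_def)
    fix v
    \<comment> \<open>\<open>Ck_on\<close> differentiates in fixed directions, whereas the chain
      rule evaluates the derivative of \<open>g\<close> in a direction that moves with
      \<open>x\<close>. Expanding that direction in \<open>Basis\<close> leaves products of
      functions with fixed directions, which the induction hypothesis and the product rule
      cover.\<close>
    have eq: "(\<Sum>b\<in>Basis. (frechet_derivative f (at x) v \<bullet> b) *\<^sub>R frechet_derivative g (at (f x)) b)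
        = frechet_derivative g (at (f x)) (frechet_derivative f (at x) v)" if "x \<in> U" for x
    proof -
      have "linear (frechet_derivative g (at (f x)))"
        using dg that assms(3) has_derivative_linear by blast
      then have "frechet_derivative g (at (f x)) (\<Sum>b\<in>Basis. (frechet_derivative f (at x) v \<bullet> b) *\<^sub>R b)
          = (\<Sum>b\<in>Basis. (frechet_derivative f (at x) v \<bullet> b) *\<^sub>R frechet_derivative g (at (f x)) b)"
        by (simp add: linear_sum linear_scale)
      then show ?thesis by (simp add: euclidean_representation)
    qed
    show "Ck_on k U (\<lambda>x. frechet_derivative g (at (f x)) (frechet_derivative f (at x) v))"
    proof (rule Ck_on_cong[OF assms(1) eq])
      show "Ck_on k U (\<lambda>x. \<Sum>b\<in>Basis. (frechet_derivative f (at x) v \<bullet> b) *\<^sub>R frechet_derivative g (at (f x)) b)"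
      proof (intro Ck_on_sum Ck_on_bilinear[OF bounded_bilinear_scaleR] assms)
        show "Ck_on k U (\<lambda>x. frechet_derivative f (at x) v \<bullet> b)" for b
          using Suc.prems(1) by (intro Ck_on_linear_compose[OF assms(1) bounded_linear_inner_left]) auto
        show "Ck_on k U (\<lambda>x. frechet_derivative g (at (f x)) b)" for b
          using Suc.prems(2) Suc.prems(1)[THEN Ck_on_SucD] by (intro Suc.IH) auto
      qed
    qed
  qed
qed

lemma Ck_on_Pair: "open U \<Longrightarrow> Ck_on k U f \<Longrightarrow> Ck_on k U g \<Longrightarrow> Ck_on k U (\<lambda>x. (f x, g x))"
  using Ck_on_add[OF _ Ck_on_linear_compose[where L = "\<lambda>y. (y, 0)"] Ck_on_linear_compose[where L = "\<lambda>y. (0, y)"], of U k f g]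
  by (simp add: bounded_linear_Pair bounded_linear_ident bounded_linear_zero)

section \<open>Elementary functions and inverse functions of one variable\<close>

lemma Ck_on_field_derivativeI:
  fixes f :: "real \<Rightarrow> real"
  assumes "open U" "\<And>x. x \<in> U \<Longrightarrow> (f has_field_derivative f' x) (at x)" "Ck_on k U f'"
  shows "Ck_on (Suc k) U f"
proof (rule Ck_on_SucI[OF assms(1)])
  show "(f has_derivative (\<lambda>v. f' x * v)) (at x)" if "x \<in> U" for x
    using assms(2)[OF that] by (simp add: has_field_derivative_def)
  show "Ck_on k U (\<lambda>x. f' x * v)" for v
    by (rule Ck_on_linear_compose[OF assms(1) bounded_linear_mult_left assms(3)])
qed

lemma Ck_on_exp: "Ck_on k UNIV (exp :: real \<Rightarrow> real)"
proof (induction k)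
  case (Suc k)
  show ?case by (rule Ck_on_field_derivativeI[OF _ _ Suc]) auto
qed (auto intro!: continuous_intros)

lemma Ck_on_inverse: "Ck_on k (-{0}) (inverse :: real \<Rightarrow> real)"
proof (induction k)
  case 0 show ?case by (auto intro!: continuous_intros)
next
  case (Suc k)
  have "Ck_on k (-{0}) (\<lambda>x::real. - (inverse x * inverse x))"
    by (rule Ck_on_linear_compose[OF _ bounded_linear_minus[OF bounded_linear_ident] Ck_on_bilinear[OF bounded_bilinear_mult _ Suc Suc]]) auto
  then show ?case
    by (intro Ck_on_field_derivativeI[where f' = "\<lambda>x. - (inverse x * inverse x)"])
       (auto intro!: derivative_eq_intros)
qed

lemma Ck_on_ln: "Ck_on k {0<..} (ln :: real \<Rightarrow> real)"
proof (cases k)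
  case 0 then show ?thesis by (auto intro!: continuous_intros)
next
  case (Suc j)
  have "Ck_on j {0<..} (inverse :: real \<Rightarrow> real)"
    by (rule Ck_on_subset[OF Ck_on_inverse]) auto
  then show ?thesis
    unfolding Suc by (intro Ck_on_field_derivativeI[where f' = inverse]) (auto intro!: DERIV_ln)
qed

lemma Ck_on_sqrt: "Ck_on k {0<..} sqrt"
proof (induction k)
  case 0 show ?case by (auto intro!: continuous_intros)
next
  case (Suc k)
  have "Ck_on k {0<..} (\<lambda>x. inverse (sqrt x) / 2)"
    by (rule Ck_on_linear_compose[OF _ bounded_linear_divide Ck_on_compose[OF _ _ _ Suc Ck_on_inverse]]) auto
  then show ?case
    by (intro Ck_on_field_derivativeI[where f' = "\<lambda>x. inverse (sqrt x) / 2"]) (auto intro!: DERIV_real_sqrt)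
qed

lemma Ck_on_cis: "Ck_on k UNIV cis"
proof (induction k)
  case 0 show ?case by (auto intro!: continuous_intros)
next
  case (Suc k)
  show ?case
  proof (rule Ck_on_SucI[where D = "\<lambda>x v. v *\<^sub>R (\<i> * cis x)"])
    show "(cis has_derivative (\<lambda>v. v *\<^sub>R (\<i> * cis x))) (at x)" for x
      using has_derivative_cis[OF has_derivative_ident, of x] by simp
    show "Ck_on k UNIV (\<lambda>x. v *\<^sub>R (\<i> * cis x))" for v
      by (rule Ck_on_linear_compose[OF _ bounded_linear_compose[OF bounded_linear_scaleR_right bounded_linear_mult_right] Suc]) auto
  qed auto
qed

text \<open>Bootstrapping: the derivative of \<open>g\<close> is
  \<open>inverse (deriv f (g y))\<close>, so \<open>k\<close> orders of regularity of
  \<open>g\<close> yield one more.\<close>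

lemma Ck_on_real_inverse:
  fixes f g :: "real \<Rightarrow> real"
  assumes "open U" "\<And>k. Ck_on k U f" "\<And>x. x \<in> U \<Longrightarrow> deriv f x \<noteq> 0"
    "open V" "\<And>y. y \<in> V \<Longrightarrow> g y \<in> U \<and> f (g y) = y" "\<And>x. x \<in> U \<Longrightarrow> g (f x) = x"
  shows "Ck_on k V g"
proof -
  have df: "(f has_field_derivative deriv f x) (at x)" if "x \<in> U" for x
    using assms(2)[of 1] that by (simp add: DERIV_deriv_iff_real_differentiable)
  have fd: "frechet_derivative f (at x) = (\<lambda>v. deriv f x * v)" if "x \<in> U" for x
    using frechet_derivative_at[OF df[OF that, unfolded has_field_derivative_def]] by simp
  have Cd: "Ck_on k U (deriv f)" for k
  proof (rule Ck_on_cong[OF assms(1)])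
    show "Ck_on k U (\<lambda>x. frechet_derivative f (at x) 1)"
      using assms(2)[of "Suc k"] by simp
  qed (simp add: fd)
  have cont: "continuous_on U f" using assms(2)[of 0] by simp
  have dg: "(g has_field_derivative inverse (deriv f (g y))) (at y)" if "y \<in> V" for y
    using has_field_derivative_inverse_strong[OF df _ assms(1) _ cont, of "g y" g] assms(3,5,6) that by metis
  show ?thesis
  proof (induction k)
    case 0
    show ?case using dg DERIV_isCont by (auto intro!: continuous_at_imp_continuous_on)
  next
    case (Suc k)
    have 1: "Ck_on k V (\<lambda>y. deriv f (g y))"
      by (rule Ck_on_compose[OF assms(4,1) _ Suc Cd]) (use assms(5) in auto)
    have "Ck_on k V (\<lambda>y. inverse (deriv f (g y)))"
      by (rule Ck_on_compose[OF assms(4) _ _ 1 Ck_on_inverse]) (use assms(3,5) in auto)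
    from Ck_on_field_derivativeI[OF assms(4) dg this] show ?case .
  qed
qed

section \<open>Smooth maps on arbitrary subsets\<close>

lemma smooth_onI: "open U \<Longrightarrow> A \<subseteq> U \<Longrightarrow> (\<And>k. Ck_on k U f) \<Longrightarrow> smooth_on A f"
  unfolding smooth_on_def by blast

lemma smooth_on_open_iff: "open U \<Longrightarrow> smooth_on U f \<longleftrightarrow> (\<forall>k. Ck_on k U f)"
proof
  assume U: "open U" and "smooth_on U f"
  show "\<forall>k. Ck_on k U f"
  proof (intro allI Ck_on_local)
    fix k x assume "x \<in> U"
    then obtain W g where "open W" "x \<in> W" "Ck_on k W g" "\<forall>y\<in>U \<inter> W. f y = g y"
      using \<open>smooth_on U f\<close> unfolding smooth_on_def by metis
    then have "Ck_on k (U \<inter> W) f"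
      using U by (intro Ck_on_cong[of _ g f]) (auto intro: Ck_on_subset)
    then show "\<exists>V. open V \<and> x \<in> V \<and> Ck_on k V f"
      using U \<open>open W\<close> \<open>x \<in> W\<close> \<open>x \<in> U\<close> by blast
  qed
qed (auto intro: smooth_onI)

lemma smooth_onE:
  assumes "smooth_on A f" "x \<in> A"
  obtains U g where "open U" "x \<in> U" "\<And>k. Ck_on k U g" "\<And>y. y \<in> A \<Longrightarrow> y \<in> U \<Longrightarrow> f y = g y"
  using assms unfolding smooth_on_def by (metis IntI)

lemma smooth_on_localI:
  assumes "\<And>x. x \<in> A \<Longrightarrow> \<exists>U g. open U \<and> x \<in> U \<and> (\<forall>k. Ck_on k U g) \<and> (\<forall>y\<in>A. y \<in> U \<longrightarrow> f y = g y)"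
  shows "smooth_on A f"
  unfolding smooth_on_def
proof
  fix x assume "x \<in> A"
  from assms[OF this] show "\<exists>U g. open U \<and> x \<in> U \<and> (\<forall>k. Ck_on k U g) \<and> (\<forall>y\<in>A \<inter> U. f y = g y)"
    by (elim ex_forward conj_forward) auto
qed

lemma smooth_on_subset: 
  assumes "smooth_on A f" "B \<subseteq> A"
  shows "smooth_on B f"
proof (rule smooth_on_localI)
  fix x assume "x \<in> B"
  with assms(2) have "x \<in> A" by auto
  from smooth_onE[OF assms(1) this] obtain U g
    where "open U" "x \<in> U" "\<And>k. Ck_on k U g" "\<And>y. y \<in> A \<Longrightarrow> y \<in> U \<Longrightarrow> f y = g y" by blast
  then show "\<exists>U g. open U \<and> x \<in> U \<and> (\<forall>k. Ck_on k U g) \<and> (\<forall>y\<in>B. y \<in> U \<longrightarrow> f y = g y)"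
    using assms(2) by (intro exI[of _ U] exI[of _ g]) auto
qed

lemma smooth_on_cong: 
  assumes "smooth_on A f" "\<And>x. x \<in> A \<Longrightarrow> f x = g x"
  shows "smooth_on A g"
proof (rule smooth_on_localI)
  fix x assume "x \<in> A"
  from smooth_onE[OF assms(1) this] obtain U h
    where "open U" "x \<in> U" "\<And>k. Ck_on k U h" "\<And>y. y \<in> A \<Longrightarrow> y \<in> U \<Longrightarrow> f y = h y" by blast
  then show "\<exists>U h. open U \<and> x \<in> U \<and> (\<forall>k. Ck_on k U h) \<and> (\<forall>y\<in>A. y \<in> U \<longrightarrow> g y = h y)"
    using assms(2) by (intro exI[of _ U] exI[of _ h]) auto
qed

lemma smooth_on_compose:
  fixes f :: "'a::real_normed_vector \<Rightarrow> 'b::euclidean_space" and g :: "'b \<Rightarrow> 'c::real_normed_vector"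
  assumes "smooth_on B g" "smooth_on A f" "f ` A \<subseteq> B"
  shows "smooth_on A (\<lambda>x. g (f x))"
  unfolding smooth_on_def
proof
  fix x assume x: "x \<in> A"
  from smooth_onE[OF assms(2) x] obtain U f1 where f1: "open U" "x \<in> U" "\<And>k. Ck_on k U f1" "\<And>y. y \<in> A \<Longrightarrow> y \<in> U \<Longrightarrow> f y = f1 y"
    by blast
  have "f x \<in> B" using x assms(3) by auto
  then obtain V g1 where g1: "open V" "f x \<in> V" "\<And>k. Ck_on k V g1" "\<And>y. y \<in> B \<inter> V \<Longrightarrow> g y = g1 y"
    using assms(1) unfolding smooth_on_def by metis
  define W where "W = U \<inter> f1 -` V"
  have "open W"
    using f1(3)[of 0] f1(1) g1(1) unfolding W_def by (auto simp: continuous_on_open_vimage Int_commute)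
  moreover have "Ck_on k W (\<lambda>x. g1 (f1 x))" for k
    by (rule Ck_on_compose[OF \<open>open W\<close> g1(1) _ Ck_on_subset[OF f1(3)] g1(3)]) (auto simp: W_def)
  moreover have "x \<in> W" "\<forall>y\<in>A \<inter> W. g (f y) = g1 (f1 y)"
    using f1 g1 x assms(3) by (auto simp: W_def)
  ultimately show "\<exists>U h. open U \<and> x \<in> U \<and> (\<forall>k. Ck_on k U h) \<and> (\<forall>y\<in>A \<inter> U. g (f y) = h y)"
    by blast
qed

lemma smooth_on_bilinear:
  assumes "bounded_bilinear p" "smooth_on A f" "smooth_on A g"
  shows "smooth_on A (\<lambda>x. p (f x) (g x))"
  unfolding smooth_on_def
proof
  fix x assume x: "x \<in> A"
  from smooth_onE[OF assms(2) x] obtain U f1 where f1: "open U" "x \<in> U" "\<And>k. Ck_on k U f1" "\<And>y. y \<in> A \<Longrightarrow> y \<in> U \<Longrightarrow> f y = f1 y"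
    by blast
  from smooth_onE[OF assms(3) x] obtain V g1 where g1: "open V" "x \<in> V" "\<And>k. Ck_on k V g1" "\<And>y. y \<in> A \<Longrightarrow> y \<in> V \<Longrightarrow> g y = g1 y"
    by blast
  have "Ck_on k (U \<inter> V) (\<lambda>x. p (f1 x) (g1 x))" for k
    using f1 g1 by (intro Ck_on_bilinear[OF assms(1)] open_Int) (auto intro: Ck_on_subset)
  then show "\<exists>W h. open W \<and> x \<in> W \<and> (\<forall>k. Ck_on k W h) \<and> (\<forall>y\<in>A \<inter> W. p (f y) (g y) = h y)"
    using f1 g1 by (intro exI[of _ "U \<inter> V"] exI[of _ "\<lambda>x. p (f1 x) (g1 x)"]) auto
qed

lemma smooth_on_Pair:
  assumes "smooth_on A f" "smooth_on A g"
  shows "smooth_on A (\<lambda>x. (f x, g x))"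
  unfolding smooth_on_def
proof
  fix x assume x: "x \<in> A"
  from smooth_onE[OF assms(1) x] obtain U f1 where f1: "open U" "x \<in> U" "\<And>k. Ck_on k U f1" "\<And>y. y \<in> A \<Longrightarrow> y \<in> U \<Longrightarrow> f y = f1 y"
    by blast
  from smooth_onE[OF assms(2) x] obtain V g1 where g1: "open V" "x \<in> V" "\<And>k. Ck_on k V g1" "\<And>y. y \<in> A \<Longrightarrow> y \<in> V \<Longrightarrow> g y = g1 y"
    by blast
  have "Ck_on k (U \<inter> V) (\<lambda>x. (f1 x, g1 x))" for k
    using f1 g1 by (intro Ck_on_Pair open_Int) (auto intro: Ck_on_subset)
  then show "\<exists>W h. open W \<and> x \<in> W \<and> (\<forall>k. Ck_on k W h) \<and> (\<forall>y\<in>A \<inter> W. (f y, g y) = h y)"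
    using f1 g1 by (intro exI[of _ "U \<inter> V"] exI[of _ "\<lambda>x. (f1 x, g1 x)"]) auto
qed

lemma smooth_on_bounded_linear: "bounded_linear f \<Longrightarrow> smooth_on A f"
  by (rule smooth_onI[OF open_UNIV]) (auto intro: Ck_on_bounded_linear)

lemma smooth_on_const: "smooth_on A (\<lambda>x. a)"
  by (rule smooth_onI[OF open_UNIV]) (auto intro: Ck_on_const)

lemma smooth_on_linear_compose:
  assumes "bounded_linear L" "smooth_on A f"
  shows "smooth_on A (\<lambda>x. L (f x))"
proof (rule smooth_on_localI)
  fix x assume "x \<in> A"
  from smooth_onE[OF assms(2) this] obtain U h
    where h: "open U" "x \<in> U" "\<And>k. Ck_on k U h" "\<And>y. y \<in> A \<Longrightarrow> y \<in> U \<Longrightarrow> f y = h y" by blast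
  have "Ck_on k U (\<lambda>x. L (h x))" for k
    by (rule Ck_on_linear_compose[OF h(1) assms(1) h(3)])
  then show "\<exists>U h. open U \<and> x \<in> U \<and> (\<forall>k. Ck_on k U h) \<and> (\<forall>y\<in>A. y \<in> U \<longrightarrow> L (f y) = h y)"
    using h by (intro exI[of _ U] exI[of _ "\<lambda>x. L (h x)"]) auto
qed

lemma smooth_on_add:
  fixes f g :: "'a::real_normed_vector \<Rightarrow> 'b::real_normed_vector"
  assumes "smooth_on A f" "smooth_on A g"
  shows "smooth_on A (\<lambda>x. f x + g x)"
proof -
  have "bounded_linear (\<lambda>y::'b \<times> 'b. fst y + snd y)"
    by (intro bounded_linear_intros)
  from smooth_on_linear_compose[OF this smooth_on_Pair[OF assms]] show ?thesis by simp
qed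

lemma smooth_on_has_derivative:
  assumes "smooth_on A f" "x \<in> A"
  shows "\<exists>D. (f has_derivative D) (at x within A)"
proof -
  from smooth_onE[OF assms] obtain U g
    where g: "open U" "x \<in> U" "\<And>k. Ck_on k U g" "\<And>y. y \<in> A \<Longrightarrow> y \<in> U \<Longrightarrow> f y = g y" by blast
  then have "(g has_derivative frechet_derivative g (at x)) (at x within A)"
    by (meson Ck_on_has_derivative has_derivative_at_withinI)
  moreover obtain d where "d > 0" "ball x d \<subseteq> U"
    using g(1,2) open_contains_ball by blast
  ultimately show ?thesis
    using has_derivative_transform_within[of g _ x A d f] g assms by (metis dist_commute mem_ball subsetD)
qed

lemma smooth_on_continuous: "smooth_on A f \<Longrightarrow> continuous_on A f"
  unfolding continuous_on_eq_continuous_within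
  using smooth_on_has_derivative has_derivative_continuous by blast

lemma smooth_on_frechet_derivative:
  assumes "smooth_on U f" "open U" "x \<in> U"
  shows "(f has_derivative frechet_derivative f (at x)) (at x)"
  using assms Ck_on_has_derivative[of 0 U f x] by (simp add: smooth_on_open_iff del: Ck_on.simps)

lemma smooth_on_continuous_frechet_derivative:
  assumes "smooth_on U f" "open U"
  shows "continuous_on U (\<lambda>x. frechet_derivative f (at x) v)"
proof -
  have "Ck_on (Suc 0) U f" using assms by (simp add: smooth_on_open_iff del: Ck_on.simps)
  then show ?thesis by simp
qed

lemma Ck_on_norm_complex: "Ck_on k (-{0}) (norm :: complex \<Rightarrow> real)"
proof -
  have id: "Ck_on k (-{0}) (\<lambda>z::complex. z)"
    by (rule Ck_on_bounded_linear) (auto simp: bounded_linear_ident)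
  have "Ck_on k (-{0}) (\<lambda>z::complex. sqrt (z \<bullet> z))"
    by (rule Ck_on_compose[OF _ _ _ Ck_on_bilinear[OF bounded_bilinear_inner _ id id] Ck_on_sqrt]) auto
  then show ?thesis by (simp add: norm_eq_sqrt_inner[abs_def])
qed

section \<open>Tangent spaces\<close>

lemma subspace_tangent_space: "subspace (tangent_space A x)"
  by (simp add: tangent_space_def)

lemma tangent_spaceI:
  assumes "e > 0" "smooth_on {0..<e} g" "\<And>t. 0 \<le> t \<Longrightarrow> t < e \<Longrightarrow> g t \<in> A" "g 0 = x"
    "(g has_vector_derivative v) (at 0 within {0..<e::real})"
  shows "v \<in> tangent_space A x"
proof -
  have "g ` {0..<e} \<subseteq> A" using assms(3) by auto
  with assms show ?thesis
    unfolding tangent_space_def by (intro span_base CollectI exI[of _ g] exI[of _ e] conjI)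
qed

text \<open>The image of a straight segment issuing from \<open>w\<close> is a curve of the kind
  whose velocities span \<open>tangent_space\<close>. This is what allows the differential of a
  holomorphic curve to be fed into \<open>structures_agree\<close>.\<close>

lemma derivative_in_tangent_space:
  fixes u :: "'a::euclidean_space \<Rightarrow> 'b::euclidean_space"
  assumes "smooth_on U u" "open U" "w \<in> U" "u ` U \<subseteq> A" "(u has_derivative D) (at w)"
  shows "D v \<in> tangent_space A (u w)"
proof -
  define l where "l t = w + t *\<^sub>R v" for t :: real
  have "isCont l 0" unfolding l_def by (intro continuous_intros)
  moreover have "l 0 \<in> U" using assms(3) by (simp add: l_def)
  ultimately have "\<forall>\<^sub>F t in at 0. l t \<in> U"
    using assms(2) topological_tendstoD[of l "l 0" "at 0" U] by (auto simp: isCont_def)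
  then obtain e where e: "e > 0" "\<And>t. t \<noteq> 0 \<Longrightarrow> \<bar>t\<bar> < e \<Longrightarrow> l t \<in> U"
    by (auto simp: eventually_at dist_real_def)
  have lU: "l t \<in> U" if "0 \<le> t" "t < e" for t
    using e(2)[of t] \<open>l 0 \<in> U\<close> that by (cases "t = 0") auto
  have Dl: "(l has_derivative (\<lambda>t. t *\<^sub>R v)) (at 0)"
    unfolding l_def by (auto intro!: derivative_eq_intros)
  show ?thesis
  proof (rule tangent_spaceI[OF e(1), where g = "\<lambda>t. u (l t)"])
    have "smooth_on {0..<e} l"
      unfolding l_def by (intro smooth_on_add smooth_on_const smooth_on_bounded_linear bounded_linear_scaleR_left)
    then show "smooth_on {0..<e} (\<lambda>t. u (l t))"
      by (rule smooth_on_compose[OF assms(1)]) (use lU in auto)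
    have "((\<lambda>t. u (l t)) has_derivative (\<lambda>t. D (t *\<^sub>R v))) (at 0)"
      by (rule diff_chain_at[OF Dl, of u D, unfolded o_def]) (use assms(5) in \<open>simp add: l_def\<close>)
    then show "((\<lambda>t. u (l t)) has_vector_derivative D v) (at 0 within {0..<e})"
      unfolding has_vector_derivative_def
      using has_derivative_linear[OF assms(5)] by (simp add: linear_scale has_derivative_at_withinI)
  qed (use lU assms(4) in \<open>auto simp: l_def\<close>)
qed

text \<open>Composing \<open>f\<close> with a one-sided curve in \<open>A\<close> determines the
  differential on its velocity, because 0 is a limit point of the half-open interval; linearity
  extends this to the span.\<close>

lemma derivative_unique_tangent:
  assumes "(f has_derivative D1) (at x within A)" "(f has_derivative D2) (at x within A)"
    "v \<in> tangent_space A x"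
  shows "D1 v = D2 v"
proof -
  have lin: "linear D1" "linear D2" using assms has_derivative_linear by auto
  have "D1 v = D2 v" if "e > 0" "g ` {0..<e} \<subseteq> A" "g 0 = x"
    "(g has_vector_derivative v) (at 0 within {0..<e::real})" for v g e
  proof -
    have "(f \<circ> g has_vector_derivative D v) (at 0 within {0..<e})"
      if "(f has_derivative D) (at x within A)" for D
      using vector_derivative_diff_chain_within[OF \<open>(g has_vector_derivative v) _\<close>] that
        has_derivative_subset[OF that] \<open>g ` {0..<e} \<subseteq> A\<close> \<open>g 0 = x\<close> by blast
    moreover have "at 0 within {0..<e} \<noteq> bot"
      using \<open>e > 0\<close> by (simp add: trivial_limit_within islimpt_Ico)
    ultimately show ?thesis
      using vector_derivative_unique_within assms(1,2) by blast
  qed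
  then show ?thesis
    using assms(3) lin unfolding tangent_space_def
    by (intro linear_eq_on_span[OF lin _ assms(3)[unfolded tangent_space_def]]) auto
qed

text \<open>The composite differential is a derivative of the identity along \<open>A\<close>. Such
  derivatives are determined on tangent vectors, hence the restriction on \<open>v\<close>.\<close>

lemma derivative_left_inverse:
  assumes "(F has_derivative DF) (at x within A)" "(G has_derivative DG) (at (F x) within F ` A)"
    "\<And>y. y \<in> A \<Longrightarrow> G (F y) = y" "x \<in> A" "v \<in> tangent_space A x"
  shows "DG (DF v) = v"
proof -
  have "((\<lambda>y. G (F y)) has_derivative (\<lambda>v. DG (DF v))) (at x within A)"
    using diff_chain_within[OF assms(1,2)] by (simp add: o_def)
  then have "((\<lambda>y. y) has_derivative (\<lambda>v. DG (DF v))) (at x within A)"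
    by (rule has_derivative_transform_within[OF _ zero_less_one]) (use assms in auto)
  from derivative_unique_tangent[OF this has_derivative_ident assms(5)] show ?thesis .
qed

section \<open>Continuity and uniform limits\<close>

text \<open>An almost complex structure is given as smooth for each fixed vector; expansion in a
  finite basis turns this into continuity when point and vector move together.\<close>

lemma continuous_on_apply_linear:
  fixes L :: "'x::topological_space \<Rightarrow> 'a::euclidean_space \<Rightarrow> 'b::real_normed_vector"
  assumes "\<And>v. continuous_on B (\<lambda>p. L p v)" "\<And>p. p \<in> B \<Longrightarrow> linear (L p)"
    "continuous_on X f" "f ` X \<subseteq> B" "continuous_on X V"
  shows "continuous_on X (\<lambda>x. L (f x) (V x))"
proof -
  have "continuous_on X (\<lambda>x. \<Sum>b\<in>Basis. (V x \<bullet> b) *\<^sub>R L (f x) b)"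
    by (intro continuous_intros assms continuous_on_compose2[OF assms(1,3)])
  then show ?thesis
  proof (rule continuous_on_eq)
    fix x assume "x \<in> X"
    then have "linear (L (f x))" using assms by auto
    then have "L (f x) (\<Sum>b\<in>Basis. (V x \<bullet> b) *\<^sub>R b) = (\<Sum>b\<in>Basis. (V x \<bullet> b) *\<^sub>R L (f x) b)"
      by (simp add: linear_sum linear_scale)
    then show "(\<Sum>b\<in>Basis. (V x \<bullet> b) *\<^sub>R L (f x) b) = L (f x) (V x)"
      by (simp add: euclidean_representation)
  qed
qed

text \<open>A form of the Heine-Cantor theorem in which only one of the two points lies in the
  compact set. A failure would produce two sequences with a common limit in \<open>K\<close> whose
  values under \<open>f\<close> stay apart.\<close>

lemma compact_near_uniform:
  fixes f :: "'a::metric_space \<Rightarrow> 'b::metric_space"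
  assumes "compact K" "K \<subseteq> U" "continuous_on U f" "e > 0"
  shows "\<exists>d>0. \<forall>x\<in>K. \<forall>y\<in>U. dist y x < d \<longrightarrow> dist (f y) (f x) < e"
proof (rule ccontr)
  assume "\<not> ?thesis"
  then have "\<forall>n. \<exists>x y. x \<in> K \<and> y \<in> U \<and> dist y x < inverse (real (Suc n)) \<and> dist (f y) (f x) \<ge> e"
    by (metis inverse_positive_iff_positive not_less of_nat_0_less_iff zero_less_Suc)
  then obtain x y where xy: "\<And>n. x n \<in> K" "\<And>n. y n \<in> U" "\<And>n. dist (y n) (x n) < inverse (real (Suc n))"
    "\<And>n. dist (f (y n)) (f (x n)) \<ge> e" by metis
  obtain l r where l: "l \<in> K" "strict_mono r" "(x \<circ> r) \<longlonglongrightarrow> l"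
    using assms(1) xy(1) unfolding compact_def by metis
  have "(\<lambda>n. dist (y n) (x n)) \<longlonglongrightarrow> 0"
    by (rule tendsto_sandwich[OF _ _ tendsto_const LIMSEQ_inverse_real_of_nat])
       (auto intro!: always_eventually less_imp_le xy(3) simp del: of_nat_Suc)
  then have "(\<lambda>n. dist (y (r n)) (x (r n))) \<longlonglongrightarrow> 0"
    using LIMSEQ_subseq_LIMSEQ[OF _ l(2)] by (auto simp: o_def)
  moreover have "(\<lambda>n. dist (x (r n)) l) \<longlonglongrightarrow> 0"
    using tendsto_dist_iff[THEN iffD1, OF l(3)] by (simp add: o_def)
  ultimately have "(\<lambda>n. dist (y (r n)) (x (r n)) + dist (x (r n)) l) \<longlonglongrightarrow> 0"
    using tendsto_add_zero by blast
  from tendsto_sandwich[OF always_eventually always_eventually tendsto_const this, of "\<lambda>n. dist (y (r n)) l"]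
  have "(\<lambda>n. dist (y (r n)) l) \<longlonglongrightarrow> 0" by (simp add: dist_triangle)
  then have yl: "(y \<circ> r) \<longlonglongrightarrow> l"
    using tendsto_dist_iff[THEN iffD2, of "y \<circ> r"] by (simp add: o_def)
  have xU: "x n \<in> U" for n using xy(1) assms(2) by blast
  have "(\<lambda>n. f ((y \<circ> r) n)) \<longlonglongrightarrow> f l" "(\<lambda>n. f ((x \<circ> r) n)) \<longlonglongrightarrow> f l"
    by (rule continuous_on_tendsto_compose[OF assms(3) yl];
          use l(1) xU xy(2) assms(2) in auto)
       (rule continuous_on_tendsto_compose[OF assms(3) l(3)];
          use l(1) xU xy(2) assms(2) in auto)
  then have "(\<lambda>n. dist (f ((y \<circ> r) n)) (f ((x \<circ> r) n))) \<longlonglongrightarrow> dist (f l) (f l)"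
    by (rule tendsto_dist)
  then have "\<forall>\<^sub>F n in sequentially. dist (f ((y \<circ> r) n)) (f ((x \<circ> r) n)) < e"
    using assms(4) by (auto intro: order_tendstoD)
  then obtain n where "dist (f ((y \<circ> r) n)) (f ((x \<circ> r) n)) < e"
    by (auto simp: eventually_sequentially)
  then show False using xy(4)[of "r n"] by simp
qed

text \<open>Carries asymptotics through a map that is merely continuous on a possibly noncompact
  domain: the limits stay in a compact set, and the approximating values need to lie in
  \<open>U\<close> only eventually.\<close>

lemma uniform_limit_compose_compact:
  assumes "uniform_limit X f l F" "compact K" "l ` X \<subseteq> K" "K \<subseteq> U" "continuous_on U T"
    "\<forall>\<^sub>F n in F. \<forall>x\<in>X. f n x \<in> U"
  shows "uniform_limit X (\<lambda>n x. T (f n x)) (\<lambda>x. T (l x)) F"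
proof (rule uniform_limitI)
  fix e :: real assume "e > 0"
  from compact_near_uniform[OF assms(2,4,5) this]
  obtain d where d: "d > 0" "\<And>x y. x \<in> K \<Longrightarrow> y \<in> U \<Longrightarrow> dist y x < d \<Longrightarrow> dist (T y) (T x) < e" by blast
  show "\<forall>\<^sub>F n in F. \<forall>x\<in>X. dist (T (f n x)) (T (l x)) < e"
    using uniform_limitD[OF assms(1) d(1)] assms(6)
    by eventually_elim (use d assms(3) in blast)
qed

section \<open>The profile of the surgery\<close>

lemma Yflow_add: "Yflow c a (Yflow c b z) = Yflow c (a + b) z"
proof -
  have "exp (- a) * exp (- b) = exp (- (a + b))" "exp (c * a) * exp (c * b) = exp (c * (a + b))"
    by (simp_all add: mult_exp_exp distrib_left)
  then show ?thesis
    unfolding Yflow_def fst_conv snd_conv by (metis mult.assoc of_real_mult)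
qed

lemma Yflow_0 [simp]: "Yflow c 0 z = z"
  by (simp add: Yflow_def)

lemma norm_Yflow:
  "norm (fst (Yflow c t z)) = exp (- t) * norm (fst z)"
  "norm (snd (Yflow c t z)) = exp (c * t) * norm (snd z)"
  by (simp_all add: Yflow_def norm_mult)

lemma nbhd_fst_nonzero: "z \<in> nbhd \<epsilon> \<Longrightarrow> fst z \<noteq> 0"
  by (auto simp: nbhd_def) (smt (verit) zero_le_power2)

locale surgery =
  fixes c \<epsilon> \<epsilon>' :: real and s :: "real \<Rightarrow> real"
  assumes c_pos: "c > 0" and profile: "surgery_profile c \<epsilon> \<epsilon>' s"
begin

lemma eps: "0 < \<epsilon>'" "\<epsilon>' < \<epsilon>"
  using profile by (auto simp: surgery_profile_def)

lemma s_smooth: "Ck_on k {0<..<\<epsilon>} s"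
  using profile by (auto simp: surgery_profile_def smooth_on_open_iff simp del: Ck_on.simps)

text \<open>The equation of \<open>nhat\<close> solved for the square of \<open>r\<^sub>1\<close>:
  the radii occurring on the torus are those between 0 and \<open>\<epsilon>\<close> where this is
  nonnegative, and the core sits at its zeros.\<close>

definition rsq :: "real \<Rightarrow> real" where
  "rsq r = exp (2 * s r) * (exp (2 * c * s r) * r\<^sup>2 - 1)"

lemma nhat_iff:
  "z \<in> nhat c \<epsilon> s \<longleftrightarrow> 0 < norm (snd z) \<and> norm (snd z) < \<epsilon> \<and> (norm (fst z))\<^sup>2 = rsq (norm (snd z))"
proof (cases "snd z = 0")
  case True
  have "\<not> - exp (- (2 * s 0)) * (norm (fst z))\<^sup>2 = 1"
    by (smt (verit) mult_minus_left mult_nonneg_nonneg exp_ge_zero zero_le_power2)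
  then show ?thesis using True by (simp add: nhat_def)
next
  case False
  have e: "exp (- (2 * a)) = inverse (exp (2 * a :: real))" for a by (simp add: exp_minus)
  show ?thesis using False by (auto simp: nhat_def rsq_def e field_simps)
qed

lemma nhatI:
  "0 < r \<Longrightarrow> r < \<epsilon> \<Longrightarrow> 0 \<le> rsq r \<Longrightarrow> (complex_of_real (sqrt (rsq r)), complex_of_real r) \<in> nhat c \<epsilon> s"
  by (simp add: nhat_iff)

lemma rsq_outer:
  assumes "\<epsilon>' < r" "r < \<epsilon>"
  shows "rsq r = 1 + r\<^sup>2"
proof -
  have "r > 0" using assms eps by auto
  then have "(complex_of_real (sqrt (1 + r\<^sup>2)), complex_of_real r) \<in> {z \<in> nbhd \<epsilon>. norm (snd z) > \<epsilon>'}"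
    using assms by (simp add: nbhd_def)
  then have "(complex_of_real (sqrt (1 + r\<^sup>2)), complex_of_real r) \<in> nhat c \<epsilon> s"
    using profile unfolding surgery_profile_def by blast
  then show ?thesis using \<open>r > 0\<close> by (simp add: nhat_iff)
qed

lemma rsq_smooth: "Ck_on k {0<..<\<epsilon>} rsq"
proof -
  have id: "Ck_on k {0<..<\<epsilon>} (\<lambda>r. r)" by (rule Ck_on_bounded_linear) (auto simp: bounded_linear_ident)
  have e: "Ck_on k {0<..<\<epsilon>} (\<lambda>r. exp (a * s r))" for a
    by (rule Ck_on_compose[OF _ open_UNIV _ Ck_on_linear_compose[OF _ bounded_linear_mult_right s_smooth] Ck_on_exp]) auto
  note mul = Ck_on_bilinear[OF bounded_bilinear_mult open_greaterThanLessThan]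
  have "Ck_on k {0<..<\<epsilon>} (\<lambda>r. exp (2 * s r) * (exp ((2 * c) * s r) * (r * r) + (-1)))"
    by (intro mul Ck_on_add id e Ck_on_const open_greaterThanLessThan)
  then show ?thesis by (simp add: rsq_def[abs_def] power2_eq_square)
qed

lemma rsq_cont: "0 < r \<Longrightarrow> r < \<epsilon> \<Longrightarrow> isCont rsq r"
  using rsq_smooth[of 0] by (auto simp: continuous_on_eq_continuous_at)

lemma transversal: "z \<in> nhat c \<epsilon> s \<Longrightarrow> Yfield c z \<notin> tangent_space (nhat c \<epsilon> s) z"
  using profile by (simp add: surgery_profile_def)

lemma torus_diffeo:
  obtains f where "diffeo (ball (0::complex) 1 \<times> sphere (0::complex) 1) (nhat c \<epsilon> s) f"
    "f ` ({0} \<times> sphere 0 1) = gamma_hat c \<epsilon> s"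
  using profile unfolding surgery_profile_def by blast

text \<open>The model solid torus, its core and the complement of the core are connected, and the
  modulus of the second coordinate is continuous. Here the global shape of the torus enters, as
  opposed to its equation.\<close>

lemma connected_radii: 
  "connected {r. 0 < r \<and> r < \<epsilon> \<and> 0 \<le> rsq r}" "connected {r. 0 < r \<and> r < \<epsilon> \<and> 0 < rsq r}"
  "connected {r. 0 < r \<and> r < \<epsilon> \<and> rsq r = 0}" "\<exists>r. 0 < r \<and> r < \<epsilon> \<and> rsq r = 0"
proof -
  obtain f where f: "diffeo (ball (0::complex) 1 \<times> sphere (0::complex) 1) (nhat c \<epsilon> s) f"
    "f ` ({0} \<times> sphere 0 1) = gamma_hat c \<epsilon> s" using torus_diffeo .
  define X where "X = ball (0::complex) 1 \<times> sphere (0::complex) 1"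
  have bij: "bij_betw f X (nhat c \<epsilon> s)" and cont: "continuous_on X f"
    using f(1) by (auto simp: diffeo_def X_def smooth_on_continuous)
  have img: "f ` X = nhat c \<epsilon> s" and inj: "inj_on f X" using bij by (auto simp: bij_betw_def)
  have conn: "connected ((\<lambda>z. norm (snd z)) ` f ` Z)" if "connected Z" "Z \<subseteq> X" for Z
    by (intro connected_continuous_image that continuous_on_subset[OF cont] continuous_intros)
  have sub: "{0} \<times> sphere 0 1 \<subseteq> X" by (auto simp: X_def)
  have sph: "connected (sphere (0::complex) 1)" by (rule connected_sphere) simp
  have mem: "(complex_of_real (sqrt (rsq r)), complex_of_real r) \<in> nhat c \<epsilon> s"
    if "0 < r" "r < \<epsilon>" "0 \<le> rsq r" for r using nhatI that by auto
  have "(\<lambda>z. norm (snd z)) ` nhat c \<epsilon> s = {r. 0 < r \<and> r < \<epsilon> \<and> 0 \<le> rsq r}"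
  proof safe
    fix r assume "0 < r" "r < \<epsilon>" "0 \<le> rsq r"
    then show "r \<in> (\<lambda>z. norm (snd z)) ` nhat c \<epsilon> s"
      using mem[of r] by (intro image_eqI) auto
  qed (auto simp: nhat_iff, metis zero_le_power2)
  with conn[of X] img show "connected {r. 0 < r \<and> r < \<epsilon> \<and> 0 \<le> rsq r}"
    by (simp add: X_def connected_Times sph)
  have "(\<lambda>z. norm (snd z)) ` gamma_hat c \<epsilon> s = {r. 0 < r \<and> r < \<epsilon> \<and> rsq r = 0}"
  proof safe
    fix r assume "0 < r" "r < \<epsilon>" "rsq r = 0"
    then show "r \<in> (\<lambda>z. norm (snd z)) ` gamma_hat c \<epsilon> s"
      using mem[of r] by (intro image_eqI[where x = "(0, complex_of_real r)"]) (auto simp: gamma_hat_def)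
  qed (auto simp: nhat_iff gamma_hat_def)
  then show "connected {r. 0 < r \<and> r < \<epsilon> \<and> rsq r = 0}"
    using conn[OF _ sub] f(2) by (simp add: connected_Times sph)
  have "gamma_hat c \<epsilon> s \<noteq> {}" using f(2) by force
  then show "\<exists>r. 0 < r \<and> r < \<epsilon> \<and> rsq r = 0"
    by (fastforce simp: gamma_hat_def nhat_iff)
  \<comment> \<open>Injectivity of \<open>f\<close> turns the condition on the core into one on the
    complement, which is a punctured disc times a circle and hence still connected.\<close>
  have "f ` (X - {0} \<times> sphere 0 1) = nhat c \<epsilon> s - gamma_hat c \<epsilon> s"
    using inj_on_image_set_diff[OF inj, of X "{0} \<times> sphere 0 1"] img f(2) sub by simp
  moreover have "X - {0} \<times> sphere 0 1 = (ball 0 1 - {0}) \<times> sphere 0 1" by (auto simp: X_def)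
  ultimately have 1: "f ` ((ball 0 1 - {0}) \<times> sphere 0 1) = nhat c \<epsilon> s - gamma_hat c \<epsilon> s" by simp
  have "(\<lambda>z. norm (snd z)) ` (nhat c \<epsilon> s - gamma_hat c \<epsilon> s) = {r. 0 < r \<and> r < \<epsilon> \<and> 0 < rsq r}"
  proof safe
    fix r assume "0 < r" "r < \<epsilon>" "0 < rsq r"
    then show "r \<in> (\<lambda>z. norm (snd z)) ` (nhat c \<epsilon> s - gamma_hat c \<epsilon> s)"
      using mem[of r] by (intro image_eqI) (auto simp: gamma_hat_def)
  qed (auto simp: nhat_iff gamma_hat_def, metis zero_less_norm_iff zero_less_power)
  with conn[of "(ball 0 1 - {0}) \<times> sphere 0 1"] 1 show "connected {r. 0 < r \<and> r < \<epsilon> \<and> 0 < rsq r}"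
    by (auto simp: X_def connected_Times sph connected_punctured_ball)
qed

text \<open>The radius of the new core. The choice is shown to be the only one in
  \<open>rsq_zero_unique\<close>.\<close>

definition r0 :: real where "r0 = (SOME r. 0 < r \<and> r < \<epsilon> \<and> rsq r = 0)"

lemma r0: "0 < r0" "r0 < \<epsilon>" "rsq r0 = 0"
  using someI_ex[OF connected_radii(4)] by (auto simp: r0_def)

lemma r0_le: "r0 \<le> \<epsilon>'"
  using rsq_outer[of r0] r0 by (smt (verit) zero_le_power2)

text \<open>Zeros of \<open>rsq\<close> form a connected set, and \<open>Y\<close> would be tangent to the torus on an interval of them.\<close>

lemma not_two_zeros_rsq:
  assumes "0 < a" "a < b" "b < \<epsilon>" "rsq a = 0" "rsq b = 0"
  shows False
proof -
  have z: "rsq r = 0" if "a \<le> r" "r \<le> b" for r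
    using connected_contains_Icc[OF connected_radii(3), of a b] assms that by (auto simp: subset_iff)
  define C where "C t = (0::complex, complex_of_real (a + t))" for t
  have "(0, complex_of_real 1) \<in> tangent_space (nhat c \<epsilon> s) (0, complex_of_real a)"
  proof (rule tangent_spaceI[of "b - a" C])
    show "smooth_on {0..<b - a} C"
      unfolding C_def of_real_add
      by (intro smooth_on_Pair smooth_on_const smooth_on_add smooth_on_bounded_linear bounded_linear_of_real)
    show "(C has_vector_derivative (0, complex_of_real 1)) (at 0 within {0..<b - a})"
      unfolding C_def has_vector_derivative_def by (auto intro!: derivative_eq_intros simp: scaleR_conv_of_real)
  qed (use assms z in \<open>auto simp: C_def nhat_iff simp del: of_real_add\<close>)
  then have "(c * a) *\<^sub>R (0, complex_of_real 1) \<in> tangent_space (nhat c \<epsilon> s) (0, complex_of_real a)"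
    by (rule subspace_scale[OF subspace_tangent_space])
  moreover have "(c * a) *\<^sub>R (0, complex_of_real 1) = Yfield c (0, complex_of_real a)"
    by (simp add: Yfield_def Xfield_def Jo_def scaleR_conv_of_real algebra_simps)
  ultimately show False
    using transversal[of "(0, complex_of_real a)"] assms by (auto simp: nhat_iff)
qed

lemma rsq_zero_unique: "0 < r \<Longrightarrow> r < \<epsilon> \<Longrightarrow> rsq r = 0 \<Longrightarrow> r = r0"
  using not_two_zeros_rsq[of r r0] not_two_zeros_rsq[of r0 r] r0 by (cases r r0 rule: linorder_cases) auto

text \<open>In the region where both tori coincide \<open>rsq\<close> is positive. Connectedness of
  its positivity set rules out positive values at or inside \<open>r0\<close>; connectedness of its
  nonnegativity set rules out negative values beyond.\<close>

lemma rsq_pos_iff: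
  assumes "0 < r" "r < \<epsilon>"
  shows "0 < rsq r \<longleftrightarrow> r0 < r"
proof
  \<comment> \<open>A reference radius beyond both \<open>r\<close> and the modified region but
    below \<open>\<epsilon>\<close>, where \<open>rsq\<close> is known explicitly.\<close>
  define e where "e = (\<epsilon> + max \<epsilon>' r) / 2"
  have e: "\<epsilon>' < e" "r < e" "e < \<epsilon>" using eps assms by (auto simp: e_def)
  then have "0 < rsq e" using rsq_outer[of e] by (smt (verit) zero_le_power2)
  {
    assume "0 < rsq r"
    show "r0 < r"
    proof (rule ccontr)
      assume "\<not> r0 < r"
      then have "r0 \<in> {r..e}" using r0_le e by auto
      then have "0 < rsq r0"
        using connected_contains_Icc[OF connected_radii(2), of r e] assms e \<open>0 < rsq r\<close> \<open>0 < rsq e\<close> by auto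
      then show False using r0 by simp
    qed
  next
    assume "r0 < r"
    then have "r \<in> {r0..e}" using e by auto
    then have "0 \<le> rsq r"
      using subsetD[OF connected_contains_Icc[OF connected_radii(1), of r0 e], of r] assms e r0 \<open>0 < rsq e\<close> by auto
    then show "0 < rsq r" using rsq_zero_unique[of r] assms \<open>r0 < r\<close> by (cases "rsq r = 0") auto
  }
qed

text \<open>The flow of \<open>Y\<close> preserves \<open>c ln r\<^sub>1 + ln r\<^sub>2\<close>; its values on the two solid tori are
  \<open>Lhat r\<^sub>2\<close> and \<open>LN r\<^sub>2\<close>.\<close>

definition Lhat :: "real \<Rightarrow> real" where "Lhat r = c / 2 * ln (rsq r) + ln r"
definition LN :: "real \<Rightarrow> real" where "LN r = c / 2 * ln (1 + r\<^sup>2) + ln r"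

section \<open>The first integral along the new torus\<close>

lemma Lhat_smooth: "Ck_on k {r0<..<\<epsilon>} Lhat"
proof -
  have 1: "Ck_on k {r0<..<\<epsilon>} (\<lambda>r. ln (rsq r))"
    by (rule Ck_on_compose[OF _ _ _ Ck_on_subset[OF rsq_smooth] Ck_on_ln]) (use rsq_pos_iff r0 in auto)
  have "Ck_on k {r0<..<\<epsilon>} ln" by (rule Ck_on_subset[OF Ck_on_ln]) (use r0 in auto)
  then show ?thesis
    unfolding Lhat_def[abs_def]
    by (intro Ck_on_add Ck_on_linear_compose[OF open_greaterThanLessThan bounded_linear_mult_right 1]) auto
qed

lemma Lhat_outer: "\<epsilon>' < r \<Longrightarrow> r < \<epsilon> \<Longrightarrow> Lhat r = LN r"
  by (simp add: Lhat_def LN_def rsq_outer)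

lemma Lhat_has_derivative:
  assumes "r0 < r" "r < \<epsilon>"
  shows "(Lhat has_field_derivative deriv Lhat r) (at r)"
  using Lhat_smooth[of 1] assms by (simp add: DERIV_deriv_iff_real_differentiable)

text \<open>The curve of points with positive real coordinates lies on the torus. At a critical
  point of \<open>Lhat\<close> its velocity is proportional to (\<open>- r\<^sub>1\<close>,
  \<open>c * r\<^sub>2\<close>), which is \<open>Yfield\<close> there, against
  transversality.\<close>

lemma Lhat_deriv_nonzero:
  assumes r: "r0 < r" "r < \<epsilon>"
  shows "deriv Lhat r \<noteq> 0"
proof
  assume 0: "deriv Lhat r = 0"
  have rp: "0 < r" and gp: "0 < rsq r" using r r0 rsq_pos_iff[of r] by auto
  define g' where "g' = deriv rsq r"
  have g': "(rsq has_field_derivative g') (at r)"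
    using rsq_smooth[of 1] rp r by (simp add: DERIV_deriv_iff_real_differentiable g'_def)
  have "(Lhat has_field_derivative c / 2 * (g' / rsq r) + 1 / r) (at r)"
    unfolding Lhat_def[abs_def] using gp rp
    by (auto intro!: derivative_eq_intros g')
  from DERIV_unique[OF this Lhat_has_derivative[OF r]] have eq: "c * r * g' = - (2 * rsq r)"
    using gp rp 0 by (simp add: field_simps)
  define C where "C t = (complex_of_real (sqrt (rsq (r + t))), complex_of_real (r + t))" for t
  have gt: "0 < rsq (r + t)" if "0 \<le> t" "t < \<epsilon> - r" for t
    using that rp r rsq_pos_iff[of "r + t"] by auto
  have "(complex_of_real (g' / (2 * sqrt (rsq r))), 1) \<in> tangent_space (nhat c \<epsilon> s) (of_real (sqrt (rsq r)), of_real r)"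
  proof (rule tangent_spaceI[of "\<epsilon> - r" C])
    have 1: "smooth_on {0..<\<epsilon> - r} (\<lambda>t. r + t)"
      by (intro smooth_on_add smooth_on_const smooth_on_bounded_linear bounded_linear_ident)
    have "smooth_on {0..<\<epsilon> - r} (\<lambda>t. rsq (r + t))"
      by (rule smooth_on_compose[OF smooth_onI[OF open_greaterThanLessThan order_refl rsq_smooth] 1]) (use rp r in auto)
    then have 2: "smooth_on {0..<\<epsilon> - r} (\<lambda>t. sqrt (rsq (r + t)))"
      by (rule smooth_on_compose[OF smooth_onI[OF open_greaterThan order_refl Ck_on_sqrt]]) (use gt in auto)
    show "smooth_on {0..<\<epsilon> - r} C"
      unfolding C_def by (intro smooth_on_Pair smooth_on_linear_compose[OF bounded_linear_of_real] 1 2)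
    have sh: "((\<lambda>t. r + t) has_field_derivative 1) (at 0)"
      by (auto intro!: derivative_eq_intros)
    have 3: "((\<lambda>t. rsq (r + t)) has_field_derivative g') (at 0)"
      using DERIV_chain'[OF sh, of rsq g'] g' by simp
    have "((\<lambda>t. sqrt (rsq (r + t))) has_field_derivative inverse (sqrt (rsq (r + 0))) / 2 * g') (at 0)"
      by (rule DERIV_chain2[OF DERIV_real_sqrt 3]) (use gp in simp)
    moreover have "inverse (sqrt (rsq (r + 0))) / 2 * g' = g' / (2 * sqrt (rsq r))"
      by (simp add: inverse_eq_divide)
    ultimately have 4: "((\<lambda>t. sqrt (rsq (r + t))) has_field_derivative g' / (2 * sqrt (rsq r))) (at 0)"
      by (simp only:)
    have "(C has_vector_derivative (complex_of_real (g' / (2 * sqrt (rsq r))), complex_of_real 1)) (at 0)"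
      unfolding C_def by (intro has_vector_derivative_Pair has_vector_derivative_of_real 4 sh)
    then show "(C has_vector_derivative (complex_of_real (g' / (2 * sqrt (rsq r))), 1)) (at 0 within {0..<\<epsilon> - r})"
      by (simp add: has_vector_derivative_at_within)
  qed (use r rp gt in \<open>auto simp: C_def nhat_iff less_imp_le simp del: of_real_add\<close>)
  \<comment> \<open>The factor is the second component of \<open>Yfield\<close>, since the curve has
    unit speed in that coordinate.\<close>
  then have "(c * r) *\<^sub>R (complex_of_real (g' / (2 * sqrt (rsq r))), 1)
      \<in> tangent_space (nhat c \<epsilon> s) (of_real (sqrt (rsq r)), of_real r)"
    by (rule subspace_scale[OF subspace_tangent_space])
  moreover have "c * r * (g' / (2 * sqrt (rsq r))) = - sqrt (rsq r)"
    using eq gp by (simp add: field_simps)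
  then have "complex_of_real (c * r * (g' / (2 * sqrt (rsq r)))) = complex_of_real (- sqrt (rsq r))"
    by (rule arg_cong)
  then have "(c * r) *\<^sub>R (complex_of_real (g' / (2 * sqrt (rsq r))), 1) = (complex_of_real (- sqrt (rsq r)), complex_of_real (c * r))"
    unfolding scaleR_Pair scaleR_conv_of_real of_real_mult[symmetric] by simp
  moreover have "\<dots> = Yfield c (of_real (sqrt (rsq r)), of_real r)"
    by (simp add: Yfield_def Xfield_def Jo_def algebra_simps)
  ultimately show False
    using transversal[of "(of_real (sqrt (rsq r)), of_real r)"] nhatI[of r] gp rp r by auto
qed

lemma Lhat_cont: "r0 < a \<Longrightarrow> b < \<epsilon> \<Longrightarrow> continuous_on {a..b} Lhat"
  using Lhat_smooth[of 0] by (auto intro: continuous_on_subset)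

lemma Lhat_inj: "inj_on Lhat {r0<..<\<epsilon>}"
proof -
  have "Lhat x \<noteq> Lhat y" if "r0 < x" "x < y" "y < \<epsilon>" for x y
  proof
    assume "Lhat x = Lhat y"
    from Rolle[OF \<open>x < y\<close> this Lhat_cont] that obtain z where "x < z" "z < y" "DERIV Lhat z :> 0"
      using Lhat_has_derivative real_differentiable_def by (metis order_less_trans)
    then show False using Lhat_deriv_nonzero[of z] Lhat_has_derivative[of z] that DERIV_unique by fastforce
  qed
  then show ?thesis
    by (intro inj_onI) (metis greaterThanLessThan_iff linorder_neqE)
qed

lemma rsq_tendsto_r0: "(rsq \<longlongrightarrow> 0) (at r0)"
  using rsq_cont[of r0] r0 by (simp add: isCont_def)

lemma Lhat_at_r0: "filterlim Lhat at_bot (at_right r0)"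
proof -
  have near: "\<forall>\<^sub>F r in at_right r0. r0 < r \<and> r < \<epsilon>"
    using eventually_at_right_less eventually_at_right_field r0(2) by (auto simp: eventually_conj_iff)
  have "filterlim rsq (at_right 0) (at_right r0)"
    unfolding filterlim_at
  proof
    show "\<forall>\<^sub>F r in at_right r0. rsq r \<in> {0<..} \<and> rsq r \<noteq> 0"
      using near
    proof eventually_elim
      case (elim r)
      then show ?case using rsq_pos_iff[of r] r0 by auto
    qed
    show "(rsq \<longlongrightarrow> 0) (at_right r0)" using rsq_tendsto_r0 by (rule filterlim_mono) (auto simp: at_le)
  qed
  then have 1: "filterlim (\<lambda>r. c / 2 * ln (rsq r)) at_bot (at_right r0)"
    using filterlim_tendsto_pos_mult_at_bot[OF tendsto_const _ filterlim_compose[OF ln_at_0], of "c / 2"] c_pos by simp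
  have "(ln \<longlongrightarrow> ln r0) (at_right r0)"
    using r0(1) by (intro tendsto_ln tendsto_ident_at) auto
  from filterlim_tendsto_add_at_bot_iff[THEN iffD2, OF this 1] show ?thesis
    unfolding Lhat_def[abs_def] by (simp add: add.commute)
qed

lemma Lhat_small:
  assumes "r0 < x" "x < \<epsilon>"
  obtains y where "r0 < y" "y < x" "Lhat y < b"
proof -
  have "\<forall>\<^sub>F r in at_right r0. Lhat r < b"
    using Lhat_at_r0 by (simp add: filterlim_at_bot_dense)
  then obtain d where d: "d > r0" "\<And>r. r0 < r \<Longrightarrow> r < d \<Longrightarrow> Lhat r < b"
    by (auto simp: eventually_at_right_field)
  define y where "y = (r0 + min d x) / 2"
  have "r0 < y" "y < x" "y < d" using d(1) assms by (auto simp: y_def)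
  with d(2) that show ?thesis by blast
qed

text \<open>If the value dropped from \<open>x\<close> to \<open>y\<close>, then, since
  \<open>Lhat\<close> is arbitrarily low near \<open>r0\<close>, the value at \<open>y\<close> would
  already be taken at or before \<open>x\<close>, contradicting injectivity.\<close>

lemma Lhat_strict_mono:
  assumes "r0 < x" "x < y" "y < \<epsilon>"
  shows "Lhat x < Lhat y"
proof (rule ccontr)
  assume "\<not> Lhat x < Lhat y"
  moreover have "Lhat x \<noteq> Lhat y" using Lhat_inj assms by (auto dest: inj_onD)
  ultimately have gt: "Lhat y < Lhat x" by auto
  have "x < \<epsilon>" using assms by auto
  from Lhat_small[OF assms(1) this] obtain x0 where x0: "r0 < x0" "x0 < x" "Lhat x0 < Lhat y" .
  obtain v where "x0 \<le> v" "v \<le> x" "Lhat v = Lhat y"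
    using IVT'[of Lhat x0 "Lhat y" x] x0 gt Lhat_cont[of x0 x] assms by auto
  then show False using Lhat_inj x0 assms by (auto dest: inj_onD)
qed

lemma LN_strict_mono: "0 < x \<Longrightarrow> x < y \<Longrightarrow> LN x < LN y"
  unfolding LN_def using c_pos by (intro add_le_less_mono mult_left_mono) (auto simp: power_mono add_pos_nonneg)

text \<open>In the unmodified region \<open>r\<close> itself works. Otherwise the intermediate value
  theorem applies between a radius near the core, where \<open>Lhat\<close> is low, and a radius
  \<open>e\<close> beyond \<open>\<epsilon>'\<close>, where \<open>Lhat\<close> equals
  \<open>LN\<close> and so exceeds \<open>LN r\<close>.\<close>

lemma rho_exists:
  assumes "0 < r" "r < \<epsilon>"
  shows "\<exists>x. r0 < x \<and> x < \<epsilon> \<and> Lhat x = LN r"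
proof (cases "\<epsilon>' < r")
  case True
  then show ?thesis using Lhat_outer[of r] r0_le assms by (intro exI[of _ r]) auto
next
  case False
  define e where "e = (\<epsilon>' + \<epsilon>) / 2"
  have e: "\<epsilon>' < e" "e < \<epsilon>" "r0 < e" using eps r0_le by (auto simp: e_def)
  then have "LN r < Lhat e" using Lhat_outer LN_strict_mono[of r e] False assms by auto
  from Lhat_small[OF e(3,2)] obtain y where y: "r0 < y" "y < e" "Lhat y < LN r" .
  show ?thesis
    using IVT'[of Lhat y "LN r" e] y e \<open>LN r < Lhat e\<close> Lhat_cont[of y e] by (meson less_imp_le order.strict_trans1 order.strict_trans2)
qed

text \<open>The flow line of \<open>Y\<close> through a point of \<open>N\<close> at radius
  \<open>r\<close> meets the new torus at radius \<open>rho r\<close>.\<close>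

definition rho :: "real \<Rightarrow> real" where "rho r = the_inv_into {r0<..<\<epsilon>} Lhat (LN r)"

lemma rho:
  assumes "0 < r" "r < \<epsilon>"
  shows "r0 < rho r" "rho r < \<epsilon>" "Lhat (rho r) = LN r"
proof -
  have *: "LN r \<in> Lhat ` {r0<..<\<epsilon>}" using rho_exists[OF assms] by (metis greaterThanLessThan_iff imageI)
  show "Lhat (rho r) = LN r" unfolding rho_def by (rule f_the_inv_into_f[OF Lhat_inj *])
  have "rho r \<in> {r0<..<\<epsilon>}" unfolding rho_def by (rule the_inv_into_into[OF Lhat_inj *]) auto
  then show "r0 < rho r" "rho r < \<epsilon>" by auto
qed

lemma rho_unique: "0 < r \<Longrightarrow> r < \<epsilon> \<Longrightarrow> r0 < x \<Longrightarrow> x < \<epsilon> \<Longrightarrow> Lhat x = LN r \<Longrightarrow> rho r = x"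
  using rho[of r] inj_onD[OF Lhat_inj, of "rho r" x] by auto

lemma rho_outer: "\<epsilon>' < r \<Longrightarrow> r < \<epsilon> \<Longrightarrow> rho r = r"
  using rho_unique[of r r] Lhat_outer eps r0_le by auto

lemma rho_pos: "0 < r \<Longrightarrow> r < \<epsilon> \<Longrightarrow> 0 < rho r"
  using rho r0 by fastforce

lemma LN_smooth: "Ck_on k {0<..<\<epsilon>} LN"
proof -
  have id: "Ck_on k {0<..<\<epsilon>} (\<lambda>r. r)" by (rule Ck_on_bounded_linear) (auto simp: bounded_linear_ident)
  have 0: "Ck_on k {0<..<\<epsilon>} (\<lambda>r. 1 + r * r)"
    by (intro Ck_on_add Ck_on_const Ck_on_bilinear[OF bounded_bilinear_mult] id) auto
  have 1: "Ck_on k {0<..<\<epsilon>} (\<lambda>r. ln (1 + r * r))"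
    by (rule Ck_on_compose[OF _ _ _ 0 Ck_on_ln]) (auto simp: add_pos_nonneg)
  have "Ck_on k {0<..<\<epsilon>} ln" by (rule Ck_on_subset[OF Ck_on_ln]) auto
  then show ?thesis
    unfolding LN_def[abs_def] power2_eq_square
    by (intro Ck_on_add Ck_on_linear_compose[OF open_greaterThanLessThan bounded_linear_mult_right 1]) auto
qed

text \<open>\<open>Lhat\<close> has nonvanishing derivative and, by invariance of domain, an open
  image; \<open>rho\<close> is \<open>LN\<close> followed by its smooth inverse.\<close>

lemma rho_smooth: "Ck_on k {0<..<\<epsilon>} rho"
proof -
  let ?V = "Lhat ` {r0<..<\<epsilon>}"
  have V: "open ?V"
    by (rule invariance_of_domain) (use Lhat_smooth[of 0] Lhat_inj in auto)
  have inv: "Ck_on k ?V (the_inv_into {r0<..<\<epsilon>} Lhat)"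
    by (rule Ck_on_real_inverse[OF open_greaterThanLessThan Lhat_smooth _ V])
       (use Lhat_inj Lhat_deriv_nonzero in \<open>auto simp: the_inv_into_f_f\<close>)
  have "LN ` {0<..<\<epsilon>} \<subseteq> ?V"
    using rho by (force simp: image_iff)
  then show ?thesis
    unfolding rho_def[abs_def] by (intro Ck_on_compose[OF _ V _ LN_smooth inv]) auto
qed

text \<open>On \<open>N\<close> the first integral tends to minus infinity at the binding; on the
  new torus low values occur only close to the core.\<close>

lemma rho_tendsto: "(rho \<longlongrightarrow> r0) (at_right 0)"
proof (rule order_tendstoI)
  have near: "\<forall>\<^sub>F r in at_right 0. 0 < r \<and> r < \<epsilon>"
    using eventually_at_right_real[of 0 \<epsilon>] eps by simp
  fix a
  {
    assume "a < r0"
    show "\<forall>\<^sub>F r in at_right 0. a < rho r"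
      using near by (rule eventually_mono) (use \<open>a < r0\<close> rho(1) in \<open>force intro: less_trans\<close>)
  next
    assume a: "r0 < a"
    \<comment> \<open>Cut off below \<open>\<epsilon>\<close>, so that \<open>b\<close> lies where
      \<open>Lhat\<close> is strictly increasing.\<close>
    define b where "b = min a ((r0 + \<epsilon>) / 2)"
    have b: "r0 < b" "b < \<epsilon>" "b \<le> a" using a r0 by (auto simp: b_def min_less_iff_disj)
    have "((\<lambda>r. c / 2 * ln (1 + r\<^sup>2)) \<longlongrightarrow> c / 2 * ln (1 + 0\<^sup>2)) (at_right 0)"
      by (intro tendsto_intros) auto
    from filterlim_tendsto_add_at_bot_iff[THEN iffD2, OF this ln_at_0] have "filterlim LN at_bot (at_right 0)"
      unfolding LN_def[abs_def] .
    then have "\<forall>\<^sub>F r in at_right 0. LN r < Lhat b" by (simp add: filterlim_at_bot_dense)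
    then show "\<forall>\<^sub>F r in at_right 0. rho r < a"
      using near
    proof eventually_elim
      case (elim r)
      then have "Lhat (rho r) < Lhat b" using rho by auto
      then have "rho r < b" using Lhat_strict_mono[of b "rho r"] rho[of r] b elim by (cases b "rho r" rule: linorder_cases) auto
      then show ?case using b by auto
    qed
  }
qed

text \<open>Chosen so that flowing along \<open>Y\<close> for time \<open>- delta r\<close> changes
  the radius \<open>r\<close> into \<open>rho r\<close>; see \<open>exp_delta\<close>.\<close>

definition delta :: "real \<Rightarrow> real" where "delta r = (ln r - ln (rho r)) / c"

lemma delta_outer: "\<epsilon>' < r \<Longrightarrow> r < \<epsilon> \<Longrightarrow> delta r = 0"
  by (simp add: delta_def rho_outer)

lemma delta_smooth: "Ck_on k {0<..<\<epsilon>} delta"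
proof -
  have 1: "Ck_on k {0<..<\<epsilon>} (\<lambda>r. ln (rho r))"
    by (rule Ck_on_compose[OF _ _ _ rho_smooth Ck_on_ln]) (use rho_pos in auto)
  have 2: "Ck_on k {0<..<\<epsilon>} ln" by (rule Ck_on_subset[OF Ck_on_ln]) auto
  have "Ck_on k {0<..<\<epsilon>} (\<lambda>r. (1 / c) * (ln r + - ln (rho r)))"
    by (intro Ck_on_linear_compose[OF open_greaterThanLessThan bounded_linear_mult_right]
         Ck_on_add 2 Ck_on_linear_compose[OF open_greaterThanLessThan bounded_linear_minus[OF bounded_linear_ident] 1]) auto
  then show ?thesis by (simp add: delta_def[abs_def])
qed

definition hat :: "complex \<times> complex \<Rightarrow> complex \<times> complex" where
  "hat z = Yflow c (- delta (norm (snd z))) z"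

lemma nbhd_snd: "z \<in> nbhd \<epsilon> \<Longrightarrow> norm (snd z) < \<epsilon>"
  by (simp add: nbhd_def)

lemma exp_delta: "0 < r \<Longrightarrow> r < \<epsilon> \<Longrightarrow> exp (- (c * delta r)) * r = rho r"
  using c_pos rho_pos by (simp add: delta_def exp_diff)

lemma norm_snd_hat: "z \<in> nbhd \<epsilon> \<Longrightarrow> snd z \<noteq> 0 \<Longrightarrow> norm (snd (hat z)) = rho (norm (snd z))"
  using exp_delta[of "norm (snd z)"] nbhd_snd by (simp add: hat_def norm_Yflow)

text \<open>The shift is computed from \<open>r\<^sub>2\<close> alone; equality of the first
  integrals makes \<open>r\<^sub>1\<close> come out right as well.\<close>

lemma norm_fst_hat:
  assumes "z \<in> nbhd \<epsilon>" "snd z \<noteq> 0"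
  shows "(norm (fst (hat z)))\<^sup>2 = rsq (rho (norm (snd z)))"
proof -
  define r where "r = norm (snd z)"
  have r: "0 < r" "r < \<epsilon>" using assms nbhd_snd by (auto simp: r_def)
  have n1: "(norm (fst z))\<^sup>2 = 1 + r\<^sup>2" using assms by (simp add: nbhd_def r_def)
  have gp: "0 < rsq (rho r)" using rsq_pos_iff rho[OF r] rho_pos[OF r] by auto
  have "c * delta r = ln r - ln (rho r)" using c_pos by (simp add: delta_def)
  also have "\<dots> = c / 2 * (ln (rsq (rho r)) - ln (1 + r\<^sup>2))"
    using rho(3)[OF r] by (simp add: Lhat_def LN_def algebra_simps)
  finally have "c * delta r = c / 2 * (ln (rsq (rho r)) - ln (1 + r\<^sup>2))" .
  then have "c * (2 * delta r) = c * (ln (rsq (rho r)) - ln (1 + r\<^sup>2))" by linarith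
  then have "2 * delta r = ln (rsq (rho r)) - ln (1 + r\<^sup>2)"
    using c_pos mult_left_cancel[of c "2 * delta r" "ln (rsq (rho r)) - ln (1 + r\<^sup>2)"] by linarith
  then have "exp (delta r) ^ 2 * (1 + r\<^sup>2) = rsq (rho r)"
    using gp add_pos_nonneg[of 1 "r\<^sup>2"] by (simp add: exp_double[symmetric] exp_diff)
  then show ?thesis
    using n1 by (simp add: hat_def norm_Yflow power_mult_distrib r_def)
qed

lemma hat_in_nhat: "z \<in> nbhd \<epsilon> \<Longrightarrow> snd z \<noteq> 0 \<Longrightarrow> hat z \<in> nhat c \<epsilon> s"
  using norm_fst_hat norm_snd_hat rho rho_pos nbhd_snd by (simp add: nhat_iff)

lemma Yflow_hat: "Yflow c (t + delta (norm (snd z))) (hat z) = Yflow c t z"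
  by (simp add: hat_def Yflow_add)

text \<open>Both points lie on one flow line of \<open>Y\<close>, so the first integral agrees on
  them. The first coordinate of \<open>z'\<close> is nonzero, which puts its radius beyond
  \<open>r0\<close>, where \<open>Lhat\<close> is injective. This forces the radius and then the
  time.\<close>

lemma hat_unique:
  assumes z: "z \<in> nbhd \<epsilon>" "snd z \<noteq> 0" and z': "z' \<in> nhat c \<epsilon> s" and eq: "Yflow c t' z' = Yflow c t z"
  shows "t' = t + delta (norm (snd z))" "z' = hat z"
proof -
  define r where "r = norm (snd z)"
  define r' where "r' = norm (snd z')"
  have r: "0 < r" "r < \<epsilon>" using z nbhd_snd by (auto simp: r_def)
  have z'eq: "z' = Yflow c (t - t') z"
    using arg_cong[OF eq, of "Yflow c (- t')"] by (simp add: Yflow_add)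
  then have n: "norm (fst z') = exp (t' - t) * norm (fst z)" "r' = exp (c * (t - t')) * r"
    by (simp_all add: norm_Yflow r_def r'_def)
  have "(norm (fst z'))\<^sup>2 = rsq r'" "0 < r'" "r' < \<epsilon>" using z' by (auto simp: nhat_iff r'_def)
  moreover have "(norm (fst z'))\<^sup>2 > 0" using n nbhd_fst_nonzero[OF z(1)] by simp
  ultimately have gp: "0 < rsq r'" and r'0: "r0 < r'" using rsq_pos_iff[of r'] by auto
  have "(norm (fst z))\<^sup>2 = 1 + r\<^sup>2" using z by (simp add: nbhd_def r_def)
  then have "rsq r' = exp (2 * (t' - t)) * (1 + r\<^sup>2)"
    unfolding exp_double using n \<open>(norm (fst z'))\<^sup>2 = rsq r'\<close> by (simp add: power_mult_distrib)
  then have lnq: "ln (rsq r') = ln (exp (2 * (t' - t))) + ln (1 + r\<^sup>2)"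
    using ln_mult_pos[of "exp (2 * (t' - t))" "1 + r\<^sup>2"] by (simp add: add_pos_nonneg)
  have lnr: "ln r' = c * (t - t') + ln r" using n r by (simp add: ln_mult)
  have "Lhat r' = LN r"
    unfolding Lhat_def LN_def lnq lnr ln_exp by (simp add: algebra_simps)
  then have rr: "rho r = r'" using rho_unique r r'0 \<open>r' < \<epsilon>\<close> by auto
  have "ln r' = c * (t - t') + ln r" using n r by (simp add: ln_mult)
  then show t': "t' = t + delta (norm (snd z))"
    using c_pos rr by (simp add: delta_def r_def[symmetric] field_simps)
  show "z' = hat z" using z'eq t' by (simp add: hat_def)
qed

text \<open>\<open>the_inv_into\<close> is a definite description; \<open>hat_in_nhat\<close>
  supplies existence and \<open>hat_unique\<close> uniqueness.\<close>

lemma the_inv_into_Yflow: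
  assumes "z \<in> nbhd \<epsilon>" "snd z \<noteq> 0"
  shows "the_inv_into (UNIV \<times> nhat c \<epsilon> s) (\<lambda>(t, z). Yflow c t z) (Yflow c t z) = (t + delta (norm (snd z)), hat z)"
  unfolding the_inv_into_def
proof (rule the_equality)
  show "(t + delta (norm (snd z)), hat z) \<in> UNIV \<times> nhat c \<epsilon> s \<and>
      (case (t + delta (norm (snd z)), hat z) of (t, z) \<Rightarrow> Yflow c t z) = Yflow c t z"
    using hat_in_nhat assms by (simp add: Yflow_hat)
  show "\<And>p. p \<in> UNIV \<times> nhat c \<epsilon> s \<and> (case p of (t, z) \<Rightarrow> Yflow c t z) = Yflow c t z
      \<Longrightarrow> p = (t + delta (norm (snd z)), hat z)"
    using hat_unique[OF assms] by force
qed

lemma hat_outer: "\<epsilon>' < norm (snd z) \<Longrightarrow> norm (snd z) < \<epsilon> \<Longrightarrow> hat z = z"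
  by (simp add: hat_def delta_outer)

lemma gamma_hat_eq: "gamma_hat c \<epsilon> s = {z. fst z = 0 \<and> norm (snd z) = r0}"
proof (intro set_eqI iffI)
  fix z assume "z \<in> gamma_hat c \<epsilon> s"
  then have "fst z = 0" "0 < norm (snd z)" "norm (snd z) < \<epsilon>" "rsq (norm (snd z)) = 0"
    by (auto simp: gamma_hat_def nhat_iff)
  with rsq_zero_unique show "z \<in> {z. fst z = 0 \<and> norm (snd z) = r0}" by blast
next
  fix z assume "z \<in> {z::complex \<times> complex. fst z = 0 \<and> norm (snd z) = r0}"
  then have "fst z = 0" "norm (snd z) = r0" by auto
  then show "z \<in> gamma_hat c \<epsilon> s" using r0 unfolding gamma_hat_def nhat_iff by auto
qed

end

section \<open>Tangent vectors of the model and Cauchy--Riemann equations\<close>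

lemma smooth_on_openin_cover:
  assumes "\<And>x. x \<in> A \<Longrightarrow> \<exists>B. openin (top_of_set A) B \<and> x \<in> B \<and> smooth_on B f"
  shows "smooth_on A f"
proof (rule smooth_on_localI)
  fix x assume "x \<in> A"
  from assms[OF this] obtain B where B: "openin (top_of_set A) B" "x \<in> B" "smooth_on B f" by blast
  from B(1) obtain W where W: "open W" "B = A \<inter> W" by (auto simp: openin_open)
  from smooth_onE[OF B(3,2)] obtain U g
    where g: "open U" "x \<in> U" "\<And>k. Ck_on k U g" "\<And>y. y \<in> B \<Longrightarrow> y \<in> U \<Longrightarrow> f y = g y" by blast
  have "open (U \<inter> W)" using g W by auto
  moreover have "Ck_on k (U \<inter> W) g" for k by (rule Ck_on_subset[OF g(3)]) auto
  ultimately show "\<exists>U g. open U \<and> x \<in> U \<and> (\<forall>k. Ck_on k U g) \<and> (\<forall>y\<in>A. y \<in> U \<longrightarrow> f y = g y)"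
    using g W B(2) by (intro exI[of _ "U \<inter> W"] exI[of _ g]) auto
qed

lemma smooth_on_fst: "smooth_on A f \<Longrightarrow> smooth_on A (\<lambda>x. fst (f x))"
  by (rule smooth_on_linear_compose[OF bounded_linear_fst])

lemma smooth_on_snd: "smooth_on A f \<Longrightarrow> smooth_on A (\<lambda>x. snd (f x))"
  by (rule smooth_on_linear_compose[OF bounded_linear_snd])

lemma smooth_on_ident: "smooth_on A (\<lambda>x. x)"
  by (rule smooth_on_bounded_linear[OF bounded_linear_ident])

lemma smooth_on_exp: "smooth_on A f \<Longrightarrow> smooth_on A (\<lambda>x. exp (f x :: real))"
  by (rule smooth_on_compose[OF smooth_onI[OF open_UNIV order_refl Ck_on_exp]]) auto

lemma smooth_on_Yflow:
  assumes "smooth_on A f" "smooth_on A g"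
  shows "smooth_on A (\<lambda>x. Yflow c (f x) (g x))"
proof -
  have "smooth_on A (\<lambda>x. exp ((-1) * f x) *\<^sub>R fst (g x))" "smooth_on A (\<lambda>x. exp (c * f x) *\<^sub>R snd (g x))"
    by (intro smooth_on_bilinear[OF bounded_bilinear_scaleR] smooth_on_exp smooth_on_fst smooth_on_snd
        smooth_on_linear_compose[OF bounded_linear_mult_right] assms)+
  from smooth_on_Pair[OF this] show ?thesis by (simp add: Yflow_def scaleR_conv_of_real)
qed

lemma Yflow_has_derivative:
  "((\<lambda>(t, z). Yflow c t z) has_derivative
     (\<lambda>(\<tau>, \<zeta>). (exp (- t) *\<^sub>R (fst \<zeta> - \<tau> *\<^sub>R fst z), exp (c * t) *\<^sub>R (snd \<zeta> + (c * \<tau>) *\<^sub>R snd z))))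
   (at (t, z) within A)"
proof -
  have "((\<lambda>p. (exp (- fst p) *\<^sub>R fst (snd p), exp (c * fst p) *\<^sub>R snd (snd p))) has_derivative
     (\<lambda>p. (exp (- t) *\<^sub>R (fst (snd p) - fst p *\<^sub>R fst z), exp (c * t) *\<^sub>R (snd (snd p) + (c * fst p) *\<^sub>R snd z))))
   (at (t, z) within A)"
    by (auto intro!: derivative_eq_intros simp: algebra_simps)
  then show ?thesis
    by (simp add: case_prod_unfold Yflow_def scaleR_conv_of_real)
qed

text \<open>A generating curve of \<open>A\<close> gives one at constant \<open>t\<close>, and the
  vectors with the claimed property form a subspace, so the whole span inherits it.\<close>

lemma tangent_space_slice:
  assumes "v \<in> tangent_space A x"
  shows "(0, v) \<in> tangent_space (UNIV \<times> A) (t, x)"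
proof -
  have "(0, v) \<in> tangent_space (UNIV \<times> A) (t, x)"
    if "e > 0" "smooth_on {0..<e} g" "g ` {0..<e} \<subseteq> A" "g 0 = x"
      "(g has_vector_derivative v) (at 0 within {0..<e::real})" for v g e
  proof (rule tangent_spaceI[OF that(1), where g = "\<lambda>r. (t, g r)"])
    show "((\<lambda>r. (t, g r)) has_vector_derivative (0, v)) (at 0 within {0..<e})"
      by (intro has_vector_derivative_Pair has_vector_derivative_const that)
  qed (use that in \<open>auto intro: smooth_on_Pair smooth_on_const\<close>)
  moreover have "subspace {v. (0, v) \<in> tangent_space (UNIV \<times> A) (t, x)}"
    using subspace_tangent_space[of "UNIV \<times> A" "(t, x)"]
    unfolding subspace_def by (auto simp: zero_prod_def) (metis add_Pair add_0, metis scaleR_Pair scaleR_zero_right)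
  ultimately have "tangent_space A x \<subseteq> {v. (0, v) \<in> tangent_space (UNIV \<times> A) (t, x)}"
    unfolding tangent_space_def[of A x] by (intro span_minimal) auto
  then show ?thesis using assms by auto
qed

lemma tangent_space_vertical:
  assumes "x \<in> A"
  shows "(1, 0) \<in> tangent_space (UNIV \<times> A) (t :: real, x)"
proof (rule tangent_spaceI[of 1 "\<lambda>r. (t + r, x)"])
  show "smooth_on {0..<1} (\<lambda>r. (t + r, x))"
    by (intro smooth_on_Pair smooth_on_add smooth_on_const smooth_on_ident)
  show "((\<lambda>r. (t + r, x)) has_vector_derivative (1, 0)) (at 0 within {0..<1})"
    by (intro has_vector_derivative_Pair has_vector_derivative_const) (auto intro!: derivative_eq_intros)
qed (use assms in auto)

lemma tangent_space_rotate:
  assumes "z \<in> A" "\<And>r. (cis (a * r) * fst z, cis (b * r) * snd z) \<in> A"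
  shows "(a *\<^sub>R (\<i> * fst z), b *\<^sub>R (\<i> * snd z)) \<in> tangent_space A z"
proof (rule tangent_spaceI[of 1 "\<lambda>r. (cis (a * r) * fst z, cis (b * r) * snd z)"])
  have "smooth_on {0..<1} (\<lambda>r. cis (a * r) * w)" for a w
    by (rule smooth_on_linear_compose[OF bounded_linear_mult_left
          smooth_on_compose[OF smooth_onI[OF open_UNIV order_refl Ck_on_cis] smooth_on_bounded_linear[OF bounded_linear_mult_right]]]) auto
  then show "smooth_on {0..<1} (\<lambda>r. (cis (a * r) * fst z, cis (b * r) * snd z))"
    by (intro smooth_on_Pair)
  have "((\<lambda>r. cis (a * r) * w) has_vector_derivative a *\<^sub>R (\<i> * w)) (at 0 within {0..<1})" for a w
    unfolding has_vector_derivative_def by (auto intro!: derivative_eq_intros simp: scaleR_conv_of_real)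
  then show "((\<lambda>r. (cis (a * r) * fst z, cis (b * r) * snd z)) has_vector_derivative
     (a *\<^sub>R (\<i> * fst z), b *\<^sub>R (\<i> * snd z))) (at 0 within {0..<1})"
    by (intro has_vector_derivative_Pair)
qed (use assms in auto)

lemma nbhd_rotate: "z \<in> nbhd \<epsilon> \<Longrightarrow> (cis a * fst z, cis b * snd z) \<in> nbhd \<epsilon>"
  by (simp add: nbhd_def norm_mult)

text \<open>The velocity of a curve that scales \<open>r\<^sub>2\<close> by \<open>1 + x\<close> and
  adjusts \<open>r\<^sub>1\<close> to \<open>h x\<close> so as to stay on \<open>N\<close>.
  Differentiating the relation between the radii gives the relative rate
  \<open>r\<^sup>2 / R\<^sup>2\<close> for \<open>r\<^sub>1\<close>.\<close>

lemma nbhd_radial: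
  assumes z: "z \<in> nbhd \<epsilon>" "snd z \<noteq> 0"
  shows "(((norm (snd z))\<^sup>2 / (norm (fst z))\<^sup>2) *\<^sub>R fst z, snd z) \<in> tangent_space (nbhd \<epsilon>) z"
proof -
  define r where "r = norm (snd z)"
  define R where "R = norm (fst z)"
  have r: "0 < r" "r < \<epsilon>" and R2: "R\<^sup>2 = 1 + r\<^sup>2" using z by (auto simp: nbhd_def r_def R_def)
  have R: "R > 0" using nbhd_fst_nonzero[OF z(1)] by (simp add: R_def)
  define h where "h x = sqrt (1 + (r * (1 + x))\<^sup>2)" for x
  define C where "C x = ((h x / R) *\<^sub>R fst z, (1 + x) *\<^sub>R snd z)" for x
  \<comment> \<open>The largest range of \<open>x\<close> on which the scaled radius stays below
    \<open>\<epsilon>\<close>.\<close>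
  define e where "e = \<epsilon> / r - 1"
  have "e > 0" using r by (simp add: e_def)
  have e: "r * (1 + x) < \<epsilon>" if "x < e" for x using that r by (simp add: e_def field_simps)
  show ?thesis
  proof (rule tangent_spaceI[OF \<open>e > 0\<close>, where g = C])
    have 0: "smooth_on {0..<e} (\<lambda>x. r * (1 + x))"
      by (intro smooth_on_linear_compose[OF bounded_linear_mult_right] smooth_on_add smooth_on_const smooth_on_ident)
    have "smooth_on {0..<e} (\<lambda>x. 1 + (r * (1 + x)) * (r * (1 + x)))"
      by (intro smooth_on_add smooth_on_const smooth_on_bilinear[OF bounded_bilinear_mult] 0)
    then have 1: "smooth_on {0..<e} h"
      unfolding h_def power2_eq_square
      by (rule smooth_on_compose[OF smooth_onI[OF open_greaterThan order_refl Ck_on_sqrt]])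
         (auto simp: add_pos_nonneg)
    show "smooth_on {0..<e} C"
      unfolding C_def
      by (intro smooth_on_Pair smooth_on_linear_compose[OF bounded_linear_scaleR_left]
           smooth_on_linear_compose[OF bounded_linear_divide 1] smooth_on_add smooth_on_const smooth_on_ident)
    show "C x \<in> nbhd \<epsilon>" if "0 \<le> x" "x < e" for x
    proof -
      have "norm (fst (C x)) = h x" "norm (snd (C x)) = r * (1 + x)"
        using R that by (simp_all add: C_def R_def r_def h_def)
      then show ?thesis using e[OF that(2)] by (simp add: nbhd_def h_def add_nonneg_nonneg)
    qed
    have h0: "h 0 = R" using R R2 by (simp add: h_def real_sqrt_unique)
    show "C 0 = z" using R h0 by (simp add: C_def)
    have "((\<lambda>x. 1 + (r * (1 + x))\<^sup>2) has_field_derivative 2 * r\<^sup>2) (at 0)"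
      by (auto intro!: derivative_eq_intros simp: power2_eq_square)
    then have "(h has_field_derivative inverse (sqrt (1 + (r * (1 + 0))\<^sup>2)) / 2 * (2 * r\<^sup>2)) (at 0)"
      unfolding h_def by (intro DERIV_chain2[OF DERIV_real_sqrt]) (auto simp: add_pos_nonneg)
    moreover have "sqrt (1 + (r * (1 + 0))\<^sup>2) = R" using h0 by (simp add: h_def)
    ultimately have dh: "(h has_field_derivative r\<^sup>2 / R) (at 0 within {0..<e})"
      by (simp add: field_simps has_field_derivative_at_within)
    have "((\<lambda>x. (h x / R) *\<^sub>R fst z) has_vector_derivative (r\<^sup>2 / R / R) *\<^sub>R fst z) (at 0 within {0..<e})"
      by (intro has_vector_derivative_scaleR[where g = "\<lambda>_. fst z" and g' = 0, simplified] DERIV_cdivide dh)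
    moreover have "((\<lambda>x. (1 + x) *\<^sub>R snd z) has_vector_derivative snd z) (at 0 within {0..<e})"
      unfolding has_vector_derivative_def by (auto intro!: derivative_eq_intros)
    ultimately show "(C has_vector_derivative (((norm (snd z))\<^sup>2 / (norm (fst z))\<^sup>2) *\<^sub>R fst z, snd z)) (at 0 within {0..<e})"
      unfolding C_def r_def R_def
      by (intro has_vector_derivative_Pair) (simp_all add: power2_eq_square)
  qed
qed

text \<open>Away from \<open>z\<^sub>2 = 0\<close>, a vector of \<open>\<complex>\<^sup>2\<close> is a combination of \<open>Y\<close>, the two rotations and the radial
  direction of the solid torus, so the embedding of \<open>\<real> \<times> N\<close> is onto on tangent spaces.\<close>

lemma Yflow_derivative_onto:
  assumes z: "z \<in> nbhd \<epsilon>" "snd z \<noteq> 0" and c: "c > 0"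
  shows "\<exists>w \<in> tangent_space (UNIV \<times> nbhd \<epsilon>) (t, z).
    (case w of (\<tau>, \<zeta>) \<Rightarrow> (exp (- t) *\<^sub>R (fst \<zeta> - \<tau> *\<^sub>R fst z), exp (c * t) *\<^sub>R (snd \<zeta> + (c * \<tau>) *\<^sub>R snd z))) = p"
proof -
  define k where "k = (norm (snd z))\<^sup>2 / (norm (fst z))\<^sup>2"
  have "k \<ge> 0" by (simp add: k_def)
  then have ck: "1 + c * k > 0" using c by (simp add: add_pos_nonneg)
  have z1: "fst z \<noteq> 0" using nbhd_fst_nonzero z by auto
  \<comment> \<open>The target vector is scaled back to \<open>z\<close> and divided by the
    coordinates of \<open>z\<close>. Imaginary parts are rotations; real parts give two linear
    equations for the coefficients \<open>\<tau>\<close> of \<open>Y\<close> and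
    \<open>\<mu>\<close> of the radial vector, with determinant \<open>1 + c * k\<close>.\<close>
  define q1 where "q1 = exp t *\<^sub>R fst p / fst z"
  define q2 where "q2 = exp (- (c * t)) *\<^sub>R snd p / snd z"
  define \<tau> where "\<tau> = (k * Re q2 - Re q1) / (1 + c * k)"
  define \<mu> where "\<mu> = Re q2 - c * \<tau>"
  have e1: "\<mu> * k - \<tau> = Re q1"
  proof -
    have "\<tau> * (1 + c * k) = k * Re q2 - Re q1" using ck by (simp add: \<tau>_def)
    then show ?thesis by (simp add: \<mu>_def algebra_simps)
  qed
  have e2: "\<mu> + c * \<tau> = Re q2" by (simp add: \<mu>_def)
  define w where "w = \<tau> *\<^sub>R (1::real, 0) + (0, (Im q1 *\<^sub>R (\<i> * fst z), Im q2 *\<^sub>R (\<i> * snd z))) + \<mu> *\<^sub>R (0, (k *\<^sub>R fst z, snd z))"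
  have "w \<in> tangent_space (UNIV \<times> nbhd \<epsilon>) (t, z)"
    unfolding w_def k_def
    by (intro subspace_add[OF subspace_tangent_space] subspace_scale[OF subspace_tangent_space]
       tangent_space_vertical tangent_space_slice nbhd_radial tangent_space_rotate nbhd_rotate z)
  moreover have "exp (- t) *\<^sub>R (fst (snd w) - fst w *\<^sub>R fst z) = fst p"
  proof -
    have "fst (snd w) - fst w *\<^sub>R fst z = (of_real (\<mu> * k - \<tau>) + \<i> * of_real (Im q1)) * fst z"
      by (simp add: w_def scaleR_conv_of_real algebra_simps)
    also have "\<dots> = q1 * fst z" unfolding e1 by (metis complex_eq)
    finally show ?thesis using z1 by (simp add: q1_def scaleR_conv_of_real exp_minus field_simps flip: exp_of_real)
  qed
  moreover have "exp (c * t) *\<^sub>R (snd (snd w) + (c * fst w) *\<^sub>R snd z) = snd p"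
  proof -
    have "snd (snd w) + (c * fst w) *\<^sub>R snd z = (of_real (\<mu> + c * \<tau>) + \<i> * of_real (Im q2)) * snd z"
      by (simp add: w_def scaleR_conv_of_real algebra_simps)
    also have "\<dots> = q2 * snd z" unfolding e2 by (metis complex_eq)
    finally show ?thesis using z(2) by (simp add: q2_def scaleR_conv_of_real exp_minus field_simps flip: exp_of_real)
  qed
  ultimately show ?thesis
    by (intro bexI[of _ w]) (simp_all add: case_prod_unfold)
qed

text \<open>Velocities of a curve in \<open>A\<close> are tangent to \<open>A\<close>, so a
  Cauchy-Riemann equation seen through \<open>E\<close> passes to \<open>F\<close>.\<close>

lemma structures_agree_curve:
  fixes v :: "complex \<Rightarrow> 'x::euclidean_space"
  assumes "structures_agree A E JE F JF" "smooth_on V v" "open V" "w \<in> V" "v ` V \<subseteq> A"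
    "(E has_derivative DE) (at (v w) within A)" "(F has_derivative DF) (at (v w) within A)"
    "(v has_derivative D) (at w)" "DE (D b) = JE (E (v w)) (DE (D a))"
  shows "DF (D b) = JF (F (v w)) (DF (D a))"
  using assms derivative_in_tangent_space[OF assms(2,3,4,5,8)]
  unfolding structures_agree_def by blast

text \<open>\<open>F\<close> is differentiated only along \<open>A\<close>, yet the composite has a
  full derivative because \<open>V\<close> is open.\<close>

lemma compose_derivative_on:
  assumes "open V" "w \<in> V" "v ` V \<subseteq> A" "(v has_derivative D) (at w)" "(F has_derivative DF) (at (v w) within A)"
    "\<And>x. x \<in> V \<Longrightarrow> u x = F (v x)"
  shows "(u has_derivative (\<lambda>a. DF (D a))) (at w)"
proof -
  have "(v has_derivative D) (at w within V)" using assms(4) by (rule has_derivative_at_withinI)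
  moreover have "(F has_derivative DF) (at (v w) within v ` V)"
    using assms(3,5) by (rule has_derivative_subset[rotated])
  ultimately have "(F \<circ> v has_derivative DF \<circ> D) (at w within V)" by (rule diff_chain_within)
  then have "(F \<circ> v has_derivative DF \<circ> D) (at w)" unfolding at_within_open[OF assms(2,1)] .
  then show ?thesis
    using has_derivative_transform_within_open[OF _ assms(1,2), of "F \<circ> v" "DF \<circ> D" UNIV u] assms(6)
    by (simp add: o_def)
qed

section \<open>Lifting holomorphic curves\<close>

lemma Xflow_add: "Xflow c a (Xflow c b z) = Xflow c (a + b) z"
  by (simp add: Xflow_def cis_mult mult.assoc[symmetric] distrib_left)

lemma Xflow_0 [simp]: "Xflow c 0 z = z"
  by (simp add: Xflow_def)

lemma id_times_derivative:
  fixes f :: "'x::euclidean_space \<Rightarrow> 'y::euclidean_space"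
  assumes "smooth_on A f" "z \<in> A"
  obtains DF where "((\<lambda>(t, z). (t, f z)) has_derivative DF) (at (t::real, z) within UNIV \<times> A)"
proof -
  have "smooth_on (UNIV \<times> A) (\<lambda>y::real\<times>_. (fst y, f (snd y)))"
    by (rule smooth_on_Pair[OF smooth_on_fst[OF smooth_on_ident]
            smooth_on_compose[OF assms(1) smooth_on_snd[OF smooth_on_ident]]]) auto
  then have "\<exists>DF. ((\<lambda>y. (fst y, f (snd y))) has_derivative DF) (at (t, z) within UNIV \<times> A)"
    by (rule smooth_on_has_derivative) (use assms in auto)
  with that show ?thesis by (auto simp: case_prod_unfold)
qed

lemma structures_agreeD:
  "structures_agree A E JE F JF \<Longrightarrow> x \<in> A \<Longrightarrow> (E has_derivative DE) (at x within A) \<Longrightarrow>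
    (F has_derivative DF) (at x within A) \<Longrightarrow> v \<in> tangent_space A x \<Longrightarrow> w \<in> tangent_space A x \<Longrightarrow>
    DE w = JE (E x) (DE v) \<Longrightarrow> DF w = JF (F x) (DF v)"
  unfolding structures_agree_def by blast

locale lift = surgery c \<epsilon> \<epsilon>' s for c \<epsilon> \<epsilon>' :: real and s :: "real \<Rightarrow> real" +
  fixes \<epsilon>1 :: real and S Sh D :: "'a::euclidean_space set" and \<omega> :: "'a \<Rightarrow> 'a \<Rightarrow> 'a \<Rightarrow> real"
    and \<phi> \<phi>h :: "'a \<Rightarrow> 'a" and \<beta> :: "real \<times> real \<Rightarrow> 'a"
    and M :: "'m::euclidean_space set" and q :: "'a \<times> real \<Rightarrow> 'm"
    and \<Psi> :: "complex \<times> complex \<Rightarrow> 'm" and \<alpha> :: "'m \<Rightarrow> 'm \<Rightarrow> real" and R :: "'m \<Rightarrow> 'm"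
    and J :: "real \<times> 'm \<Rightarrow> real \<times> 'm \<Rightarrow> real \<times> 'm"
    and Mh :: "'n::euclidean_space set" and qh :: "'a \<times> real \<Rightarrow> 'n"
    and \<psi> :: "'m \<Rightarrow> 'n" and \<Psi>h :: "complex \<times> complex \<Rightarrow> 'n"
    and Jh :: "real \<times> 'n \<Rightarrow> real \<times> 'n \<Rightarrow> real \<times> 'n"
  assumes book: "open_book \<epsilon> \<epsilon>1 S \<omega> \<phi> \<beta> M q \<Psi>"
    and adm: "admissible M \<alpha> R J"
    and std: "standard_complex_on c (nbhd \<epsilon>) \<Psi> J"
    and zero: "zero_surgery c \<epsilon> \<epsilon>' s S \<phi> M q \<Psi> Sh D \<phi>h Mh qh \<psi> \<Psi>h"
    and inv_Jh: "invariant_almost_complex Mh Jh"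
    and agree: "structures_agree (UNIV \<times> q ` (S \<times> UNIV)) id J (\<lambda>(t, x). (t, \<psi> x)) Jh"
    and std_h: "standard_complex_on c (nhat c \<epsilon> s) \<Psi>h Jh"
begin

section \<open>Topology of the pieces of \<open>M\<close>\<close>

definition Sig :: "'m set" where "Sig = q ` (S \<times> UNIV)"
definition N :: "'m set" where "N = \<Psi> ` nbhd \<epsilon>"
text \<open>\<open>N0\<close> and \<open>M0\<close> turn out to be relatively open and to cover the
  complement of the binding. The identification has one formula on each, and they overlap in the
  part of \<open>N\<close> where \<open>r\<^sub>2\<close> exceeds
  \<open>\<epsilon>'\<close>.\<close>

definition N0 :: "'m set" where "N0 = \<Psi> ` {z \<in> nbhd \<epsilon>. snd z \<noteq> 0}"
definition M0 :: "'m set" where "M0 = M - \<Psi> ` {z \<in> nbhd \<epsilon>. norm (snd z) \<le> \<epsilon>'}"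
definition \<Psi>i :: "'m \<Rightarrow> complex \<times> complex" where "\<Psi>i = the_inv_into (nbhd \<epsilon>) \<Psi>"

abbreviation tr :: "real \<times> 'm \<Rightarrow> real \<times> 'n" where "tr \<equiv> transfer c \<epsilon> s \<Psi> \<psi> \<Psi>h"

lemma eps1: "\<epsilon> < \<epsilon>1" and Psi_diffeo: "diffeo (nbhd \<epsilon>1) (\<Psi> ` nbhd \<epsilon>1) \<Psi>"
  and M_eq: "M = Sig \<union> \<Psi> ` nbhd \<epsilon>1"
  and Sig_Int: "Sig \<inter> \<Psi> ` nbhd \<epsilon>1 = \<Psi> ` {z \<in> nbhd \<epsilon>1. norm (snd z) \<ge> \<epsilon>}"
  and compact_M: "compact M" and compact_S: "compact S" and diffeo_phi: "diffeo S S \<phi>"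
  and torus: "mapping_torus S \<phi> Sig q"
  using book by (auto simp: open_book_def Sig_def closed_three_manifold_def page_with_monodromy_def
      compact_surface_def symplecto_def)

lemma nbhd_subset: "nbhd \<epsilon> \<subseteq> nbhd \<epsilon>1"
  using eps1 by (auto simp: nbhd_def)

lemma Psi_inj1: "inj_on \<Psi> (nbhd \<epsilon>1)"
  using Psi_diffeo by (auto simp: diffeo_def bij_betw_def)

lemma Psi_inj: "inj_on \<Psi> (nbhd \<epsilon>)"
  using Psi_inj1 nbhd_subset by (rule inj_on_subset)

lemma Psi_smooth: "smooth_on (nbhd \<epsilon>) \<Psi>"
  using Psi_diffeo nbhd_subset by (auto simp: diffeo_def intro: smooth_on_subset)

lemma Psii: "z \<in> nbhd \<epsilon> \<Longrightarrow> \<Psi>i (\<Psi> z) = z"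
  by (simp add: \<Psi>i_def the_inv_into_f_f Psi_inj)

lemma Psii_N: "x \<in> N \<Longrightarrow> \<Psi>i x \<in> nbhd \<epsilon>" "x \<in> N \<Longrightarrow> \<Psi> (\<Psi>i x) = x"
  by (auto simp: N_def Psii)

lemma Psii_smooth: "smooth_on N \<Psi>i"
proof (rule smooth_on_cong)
  show "smooth_on N (the_inv_into (nbhd \<epsilon>1) \<Psi>)"
    using Psi_diffeo nbhd_subset by (auto simp: diffeo_def N_def intro: smooth_on_subset)
  show "the_inv_into (nbhd \<epsilon>1) \<Psi> x = \<Psi>i x" if "x \<in> N" for x
  proof -
    from that obtain z where z: "z \<in> nbhd \<epsilon>" "x = \<Psi> z" by (auto simp: N_def)
    with nbhd_subset have "z \<in> nbhd \<epsilon>1" by auto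
    then show ?thesis using z Psii by (simp add: the_inv_into_f_f Psi_inj1)
  qed
qed

text \<open>The periodicity of \<open>q\<close> moves every parameter into the unit interval:
  lowering \<open>t\<close> applies \<open>\<phi>\<close> to the point of the page, raising it takes
  a preimage under \<open>\<phi>\<close>. Compactness is wanted because \<open>N\<close> is the
  complement of \<open>Sig\<close> and becomes relatively open.\<close>

lemma compact_Sig: "compact Sig"
proof -
  have phi: "\<phi> ` S = S" using diffeo_phi by (auto simp: diffeo_def bij_betw_def)
  have per: "q (\<phi> x, t) = q (x, t + 1)" if "x \<in> S" for x t
    using torus that by (auto simp: mapping_torus_def)
  have down: "\<exists>x'\<in>S. q (x, t + real n) = q (x', t)" if "x \<in> S" for x t n
    using that
  proof (induction n arbitrary: x)
    case (Suc n)
    have "q (x, t + real (Suc n)) = q (\<phi> x, t + real n)"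
      using per[OF Suc.prems, of "t + real n"] by (simp add: add_ac)
    then show ?case using Suc.IH[of "\<phi> x"] Suc.prems phi by auto
  qed auto
  have up: "\<exists>x'\<in>S. q (x, t) = q (x', t + real n)" if "x \<in> S" for x t n
    using that
  proof (induction n arbitrary: x t)
    case (Suc n)
    obtain y where y: "y \<in> S" "x = \<phi> y" using Suc.prems phi by auto
    have "q (x, t) = q (y, t + 1)" using per[OF y(1)] y(2) by simp
    then show ?case using Suc.IH[OF y(1), of "t + 1"] by (simp add: add_ac)
  qed auto
  have "\<exists>x'\<in>S. q (x, t) = q (x', frac t)" if "x \<in> S" for x t
  proof (cases "t \<ge> 0")
    case True
    then have "t = frac t + real (nat \<lfloor>t\<rfloor>)" by (simp add: frac_def)
    then show ?thesis using down[OF that] by metis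
  next
    case False
    then have "frac t = t + real (nat (- \<lfloor>t\<rfloor>))" by (simp add: frac_def)
    then show ?thesis using up[OF that] by metis
  qed
  then have "Sig \<subseteq> q ` (S \<times> {0..1})"
    unfolding Sig_def
    by (auto simp: image_iff) (metis atLeastAtMost_iff frac_ge_0 frac_lt_1 less_imp_le mem_Sigma_iff)
  then have "Sig = q ` (S \<times> {0..1})" by (auto simp: Sig_def)
  moreover have "continuous_on (S \<times> UNIV) q"
    using torus by (auto simp: mapping_torus_def immersion_on_def smooth_on_continuous)
  then have "continuous_on (S \<times> {0..1}) q" by (rule continuous_on_subset) auto
  ultimately show ?thesis
    using compact_continuous_image compact_Times[OF compact_S compact_Icc] by metis
qed

lemma N_subset: "N \<subseteq> M"
  using M_eq nbhd_subset by (auto simp: N_def)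

lemma M_minus_N: "M - N = Sig"
proof (intro set_eqI iffI)
  fix x assume x: "x \<in> M - N"
  show "x \<in> Sig"
  proof (rule ccontr)
    assume "x \<notin> Sig"
    with x M_eq obtain z where z: "z \<in> nbhd \<epsilon>1" "x = \<Psi> z" by auto
    have "\<not> norm (snd z) \<ge> \<epsilon>" using Sig_Int z \<open>x \<notin> Sig\<close> by blast
    then have "z \<in> nbhd \<epsilon>" using z by (auto simp: nbhd_def)
    then show False using x z by (auto simp: N_def)
  qed
next
  fix x assume x: "x \<in> Sig"
  have "x \<notin> N"
  proof
    assume "x \<in> N"
    then obtain z where z: "z \<in> nbhd \<epsilon>" "x = \<Psi> z" by (auto simp: N_def)
    then have "x \<in> Sig \<inter> \<Psi> ` nbhd \<epsilon>1" using x nbhd_subset by auto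
    then obtain z' where "z' \<in> nbhd \<epsilon>1" "norm (snd z') \<ge> \<epsilon>" "\<Psi> z' = \<Psi> z" using z Sig_Int by auto
    then have "z' = z" using z nbhd_subset Psi_inj1 by (auto dest: inj_onD)
    then show False using z \<open>norm (snd z') \<ge> \<epsilon>\<close> by (auto simp: nbhd_def)
  qed
  then show "x \<in> M - N" using x M_eq by auto
qed

lemma openin_N: "openin (top_of_set M) N"
proof -
  have "closed Sig" using compact_Sig by (rule compact_imp_closed)
  then have "openin (top_of_set M) (M - Sig)" by (metis Diff_eq open_Compl openin_open)
  moreover have "M - Sig = N" using M_minus_N N_subset by auto
  ultimately show ?thesis by simp
qed

lemma compact_sub: "compact {z \<in> nbhd \<epsilon>. norm (snd z) \<in> K}" if "compact K" "K \<subseteq> {..<\<epsilon>}" for K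
proof -
  \<comment> \<open>Because \<open>K\<close> lies strictly below \<open>\<epsilon>\<close>, the
    strict inequality in \<open>nbhd\<close> is implied and only closed conditions remain.\<close>
  have eq: "{z \<in> nbhd \<epsilon>. norm (snd z) \<in> K} =
      {z. - (norm (fst z))\<^sup>2 + (norm (snd z))\<^sup>2 = -1} \<inter> (\<lambda>z. norm (snd z)) -` K"
    using that(2) by (auto simp: nbhd_def)
  have "closed ({z::complex \<times> complex. - (norm (fst z))\<^sup>2 + (norm (snd z))\<^sup>2 = -1} \<inter> (\<lambda>z. norm (snd z)) -` K)"
    by (intro closed_Int closed_Collect_eq closed_vimage compact_imp_closed that continuous_intros)
  moreover have "bounded {z \<in> nbhd \<epsilon>. norm (snd z) \<in> K}"
  proof (rule boundedI)
    fix z assume z: "z \<in> {z \<in> nbhd \<epsilon>. norm (snd z) \<in> K}"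
    then have "(norm (snd z))\<^sup>2 \<le> \<epsilon>\<^sup>2" "(norm (fst z))\<^sup>2 = 1 + (norm (snd z))\<^sup>2"
      by (auto simp: nbhd_def intro: power_mono)
    then show "norm z \<le> sqrt (1 + 2 * \<epsilon>\<^sup>2)"
      by (simp add: norm_prod_def)
  qed
  ultimately show ?thesis unfolding eq by (simp add: compact_eq_bounded_closed)
qed

lemma compact_Psi_image: "compact (\<Psi> ` {z \<in> nbhd \<epsilon>. norm (snd z) \<in> K})" if "compact K" "K \<subseteq> {..<\<epsilon>}" for K
  by (rule compact_continuous_image[OF continuous_on_subset[OF smooth_on_continuous[OF Psi_smooth]] compact_sub[OF that]]) auto

lemma binding_eq: "binding \<Psi> = \<Psi> ` {z \<in> nbhd \<epsilon>. snd z = 0}"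
proof -
  have "range (\<lambda>p. Phi p 0 0) = {z \<in> nbhd \<epsilon>. snd z = 0}"
  proof (intro set_eqI iffI)
    fix z assume z: "z \<in> {z \<in> nbhd \<epsilon>. snd z = 0}"
    then have "norm (fst z) = 1" by (auto simp: nbhd_def power2_eq_1_iff) (smt (verit) norm_ge_zero)
    then obtain p where "fst z = cis p" by (metis cis_Arg complex_norm_eq_1_exp complex_unit_circle rcis_cmod_Arg rcis_def mult_1 of_real_1)
    then have "z = Phi (- p) 0 0" using z by (simp add: Phi_def prod_eq_iff)
    then show "z \<in> range (\<lambda>p. Phi p 0 0)" by blast
  qed (use eps in \<open>auto simp: Phi_def nbhd_def\<close>)
  then show ?thesis unfolding binding_def by (metis image_image)
qed

lemma compact_binding: "compact (binding \<Psi>)"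
proof -
  have "compact (\<Psi> ` {z \<in> nbhd \<epsilon>. norm (snd z) \<in> {0}})"
    by (rule compact_Psi_image) (use eps in auto)
  then show ?thesis by (simp add: binding_eq)
qed

lemma N0_eq: "N0 = N - binding \<Psi>"
proof -
  have "N0 = \<Psi> ` (nbhd \<epsilon> - {z \<in> nbhd \<epsilon>. snd z = 0})"
    unfolding N0_def by (rule arg_cong[of _ _ "image \<Psi>"]) auto
  then show ?thesis
    unfolding N_def binding_eq using inj_on_image_set_diff[OF Psi_inj, of "nbhd \<epsilon>"] by auto
qed

lemma openin_N0: "openin (top_of_set M) N0"
proof -
  have "N0 = N \<inter> (- binding \<Psi>)" using N0_eq by auto
  then show ?thesis
    using openin_N compact_binding by (simp add: compact_imp_closed open_Compl openin_Int_open)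
qed

lemma binding_subset: "binding \<Psi> \<subseteq> N"
  unfolding binding_eq N_def by auto

lemma openin_M0: "openin (top_of_set M) M0"
proof -
  have "{z \<in> nbhd \<epsilon>. norm (snd z) \<le> \<epsilon>'} = {z \<in> nbhd \<epsilon>. norm (snd z) \<in> {0..\<epsilon>'}}" by auto
  then have "compact (\<Psi> ` {z \<in> nbhd \<epsilon>. norm (snd z) \<le> \<epsilon>'})"
    using compact_Psi_image[of "{0..\<epsilon>'}"] eps by (simp add: subset_iff)
  then show ?thesis
    unfolding M0_def by (metis Diff_eq compact_imp_closed open_Compl openin_open)
qed

lemma M_cover: "M - binding \<Psi> = N0 \<union> M0"
proof -
  have "M0 \<inter> binding \<Psi> = {}" using eps by (auto simp: M0_def binding_eq)
  moreover have "M - binding \<Psi> \<subseteq> N0 \<union> M0" by (auto simp: N0_def M0_def binding_eq)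
  moreover have "M0 \<subseteq> M" by (auto simp: M0_def)
  ultimately show ?thesis using N0_eq N_subset by blast
qed

lemma N0_M0_subset: "N0 \<subseteq> M - binding \<Psi>" "M0 \<subseteq> M - binding \<Psi>"
  unfolding M_cover by auto

lemma Sig_subset_M0: "Sig \<subseteq> M0"
  using M_minus_N by (auto simp: M0_def N_def)

lemma psi_smooth: "smooth_on M0 \<psi>" and Psih_smooth: "smooth_on (nhat c \<epsilon> s) \<Psi>h"
  and psi_Psi: "\<And>z. z \<in> nbhd \<epsilon> \<Longrightarrow> norm (snd z) > \<epsilon>' \<Longrightarrow> \<psi> (\<Psi> z) = \<Psi>h z"
  and Mh_eq: "Mh = \<psi> ` Sig \<union> \<Psi>h ` nhat c \<epsilon> s"
  using zero by (auto simp: zero_surgery_def diffeo_def M0_def Sig_def)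

section \<open>The identification in the two charts\<close>

lemma tr_N: "z \<in> nbhd \<epsilon> \<Longrightarrow> snd z \<noteq> 0 \<Longrightarrow> tr (t, \<Psi> z) = (t + delta (norm (snd z)), \<Psi>h (hat z))"
  using Psii[of z] by (simp add: transfer_def the_inv_into_Yflow \<Psi>i_def)

text \<open>Consistency of the two formulas: on the part of \<open>N\<close> beyond
  \<open>\<epsilon>'\<close> the shift vanishes, and \<open>\<Psi>h\<close> is \<open>\<psi>\<close>
  after \<open>\<Psi>\<close>.\<close>

lemma tr_M0:
  assumes "x \<in> M0"
  shows "tr (t, x) = (t, \<psi> x)"
proof (cases "x \<in> N")
  case True
  then obtain z where z: "z \<in> nbhd \<epsilon>" "x = \<Psi> z" by (auto simp: N_def)
  then have big: "norm (snd z) > \<epsilon>'" using assms by (auto simp: M0_def not_le[symmetric])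
  then have nz: "snd z \<noteq> 0" using eps by auto
  have "norm (snd z) < \<epsilon>" using z by (simp add: nbhd_def)
  then show ?thesis
    using tr_N[OF z(1) nz, of t] z(2) big psi_Psi[OF z(1) big] by (simp add: delta_outer hat_outer)
next
  case False
  then show ?thesis by (simp add: transfer_def N_def)
qed

text \<open>Equivariance under translation of the real factor lets the linear term of an end be
  subtracted before or after the identification.\<close>

lemma tr_shift:
  assumes "x \<in> M - binding \<Psi>"
  shows "tr (t + r, x) = tr (t, x) + (r, 0)"
proof -
  from assms M_cover have "x \<in> N0 \<or> x \<in> M0" by auto
  then show ?thesis
  proof
    assume "x \<in> N0"
    then obtain z where z: "z \<in> nbhd \<epsilon>" "snd z \<noteq> 0" "x = \<Psi> z" by (auto simp: N0_def)
    then show ?thesis by (simp add: tr_N)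
  qed (simp add: tr_M0)
qed

lemma tr_in_Mh: "x \<in> M - binding \<Psi> \<Longrightarrow> tr (t, x) \<in> UNIV \<times> Mh"
proof -
  assume x: "x \<in> M - binding \<Psi>"
  show ?thesis
  proof (cases "x \<in> N")
    case True
    with x N0_eq have "x \<in> N0" by auto
    then obtain z where z: "z \<in> nbhd \<epsilon>" "snd z \<noteq> 0" "x = \<Psi> z" by (auto simp: N0_def)
    then show ?thesis using hat_in_nhat by (simp add: tr_N Mh_eq)
  next
    case False
    with x M_minus_N have "x \<in> Sig" by auto
    then show ?thesis using Sig_subset_M0 by (auto simp: tr_M0 Mh_eq)
  qed
qed

lemma delta_norm_smooth: "smooth_on {z. 0 < norm (snd z) \<and> norm (snd z) < \<epsilon>} (\<lambda>z::complex\<times>complex. delta (norm (snd z)))"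
proof -
  have "smooth_on {z. 0 < norm (snd z) \<and> norm (snd z) < \<epsilon>} (\<lambda>z::complex\<times>complex. norm (snd z))"
    by (rule smooth_on_compose[OF smooth_onI[OF _ order_refl Ck_on_norm_complex] smooth_on_snd[OF smooth_on_ident]]) auto
  then show ?thesis
    by (rule smooth_on_compose[OF smooth_onI[OF open_greaterThanLessThan order_refl delta_smooth]]) auto
qed

lemma hat_smooth: "smooth_on {z. 0 < norm (snd z) \<and> norm (snd z) < \<epsilon>} hat"
proof -
  have "smooth_on {z. 0 < norm (snd z) \<and> norm (snd z) < \<epsilon>} (\<lambda>z. Yflow c (- delta (norm (snd z))) z)"
    by (rule smooth_on_Yflow[OF smooth_on_linear_compose[OF bounded_linear_minus[OF bounded_linear_ident] delta_norm_smooth] smooth_on_ident])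
  then show ?thesis by (simp add: hat_def[abs_def])
qed

lemma Psii_N0: "x \<in> N0 \<Longrightarrow> \<Psi>i x \<in> nbhd \<epsilon>" "x \<in> N0 \<Longrightarrow> snd (\<Psi>i x) \<noteq> 0" "x \<in> N0 \<Longrightarrow> \<Psi> (\<Psi>i x) = x"
  by (auto simp: N0_def Psii)

text \<open>The identification over \<open>N0\<close> before the embedding \<open>\<Psi>h\<close> is
  applied; in this form the preservation of the image in \<open>\<complex>\<^sup>2\<close> can be
  stated, as in \<open>lift_coord_Yflow\<close>.\<close>

definition lift_coord :: "real \<times> 'm \<Rightarrow> real \<times> complex \<times> complex" where
  "lift_coord y = (fst y + delta (norm (snd (\<Psi>i (snd y)))), hat (\<Psi>i (snd y)))"

lemma lift_coord_smooth: "smooth_on (UNIV \<times> N0) lift_coord"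
proof -
  have 1: "smooth_on (UNIV \<times> N0) (\<lambda>y. \<Psi>i (snd y))"
    by (rule smooth_on_compose[OF Psii_smooth smooth_on_snd[OF smooth_on_ident]]) (auto simp: N0_eq)
  have im: "(\<lambda>y. \<Psi>i (snd y)) ` (UNIV \<times> N0) \<subseteq> {z. 0 < norm (snd z) \<and> norm (snd z) < \<epsilon>}"
    using Psii_N0(2) nbhd_snd[OF Psii_N0(1)] by auto
  show ?thesis
    unfolding lift_coord_def[abs_def]
    by (intro smooth_on_Pair smooth_on_add smooth_on_fst smooth_on_ident
         smooth_on_compose[OF delta_norm_smooth 1 im] smooth_on_compose[OF hat_smooth 1 im])
qed

lemma lift_coord_in: "y \<in> UNIV \<times> N0 \<Longrightarrow> lift_coord y \<in> UNIV \<times> nhat c \<epsilon> s"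
  using hat_in_nhat[OF Psii_N0(1,2)] by (simp add: lift_coord_def mem_Times_iff)

lemma lift_coord_Yflow: 
  "Yflow c (fst (lift_coord y)) (snd (lift_coord y)) = Yflow c (fst y) (\<Psi>i (snd y))"
  by (simp add: lift_coord_def Yflow_hat)

lemma tr_lift_coord: "y \<in> UNIV \<times> N0 \<Longrightarrow> tr y = (fst (lift_coord y), \<Psi>h (snd (lift_coord y)))"
  using tr_N[of "\<Psi>i (snd y)" "fst y"] Psii_N0[of "snd y"] by (cases y) (auto simp: lift_coord_def)

lemma tr_smooth: "smooth_on (UNIV \<times> (M - binding \<Psi>)) tr"
proof (rule smooth_on_openin_cover)
  fix y :: "real \<times> 'm" assume y: "y \<in> UNIV \<times> (M - binding \<Psi>)"
  have op: "openin (top_of_set ((UNIV :: real set) \<times> (M - binding \<Psi>))) (UNIV \<times> X)"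
    if "openin (top_of_set M) X" "X \<subseteq> M - binding \<Psi>" for X
    by (intro openin_Times openin_subset_trans[OF that]) auto
  from y have "snd y \<in> M - binding \<Psi>" by auto
  then have "snd y \<in> N0 \<union> M0" unfolding M_cover .
  then consider "snd y \<in> N0" | "snd y \<in> M0" by blast
  then show "\<exists>B. openin (top_of_set (UNIV \<times> (M - binding \<Psi>))) B \<and> y \<in> B \<and> smooth_on B tr"
  proof cases
    case 1
    have im: "(\<lambda>y. snd (lift_coord y)) ` (UNIV \<times> N0) \<subseteq> nhat c \<epsilon> s"
      by (rule image_subsetI) (drule lift_coord_in, simp add: mem_Times_iff)
    have "smooth_on (UNIV \<times> N0) (\<lambda>y. (fst (lift_coord y), \<Psi>h (snd (lift_coord y))))"
      by (rule smooth_on_Pair[OF smooth_on_fst[OF lift_coord_smooth]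
            smooth_on_compose[OF Psih_smooth smooth_on_snd[OF lift_coord_smooth] im]])
    then have "smooth_on (UNIV \<times> N0) tr" by (rule smooth_on_cong) (simp add: tr_lift_coord)
    then show ?thesis
      using op[OF openin_N0 N0_M0_subset(1)] 1 by (intro exI[of _ "UNIV \<times> N0"]) (simp add: mem_Times_iff)
  next
    case 2
    have "smooth_on (UNIV \<times> M0) (\<lambda>y. (fst y, \<psi> (snd y)))"
      by (rule smooth_on_Pair[OF smooth_on_fst[OF smooth_on_ident]
            smooth_on_compose[OF psi_smooth smooth_on_snd[OF smooth_on_ident]]]) auto
    then have "smooth_on (UNIV \<times> M0) tr"
      by (rule smooth_on_cong) (auto simp: tr_M0)
    then show ?thesis
      using op[OF openin_M0 N0_M0_subset(2)] 2 by (intro exI[of _ "UNIV \<times> M0"]) (simp add: mem_Times_iff)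
  qed
qed

section \<open>Cauchy-Riemann equations through the charts\<close>

lemma id_times_Psi_left_inverse:
  assumes "((\<lambda>(t, z). (t, \<Psi> z)) has_derivative DF) (at (t::real, z) within UNIV \<times> nbhd \<epsilon>)" "z \<in> nbhd \<epsilon>"
  obtains DG where "((\<lambda>(t, x). (t, \<Psi>i x)) has_derivative DG) (at (t::real, \<Psi> z) within UNIV \<times> N)"
    "\<And>v. v \<in> tangent_space (UNIV \<times> nbhd \<epsilon>) (t, z) \<Longrightarrow> DG (DF v) = v"
proof -
  have "\<Psi> z \<in> N" using assms by (auto simp: N_def)
  then obtain DG where DG: "((\<lambda>(t, x). (t, \<Psi>i x)) has_derivative DG) (at (t::real, \<Psi> z) within UNIV \<times> N)"
    using id_times_derivative[OF Psii_smooth] by blast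
  have im: "(\<lambda>(t::real, z). (t, \<Psi> z)) ` (UNIV \<times> nbhd \<epsilon>) \<subseteq> UNIV \<times> N" by (auto simp: N_def)
  show ?thesis
  proof (rule that[OF DG])
    fix v assume "v \<in> tangent_space (UNIV \<times> nbhd \<epsilon>) (t, z)"
    show "DG (DF v) = v"
      by (rule derivative_left_inverse[OF assms(1), where G = "\<lambda>(t, x). (t, \<Psi>i x)"])
         (use has_derivative_subset[OF DG im] assms Psii \<open>v \<in> _\<close> in auto)
  qed
qed

text \<open>The picture of \<open>\<real> \<times> N\<close> in \<open>\<complex>\<^sup>2\<close>,
  through which \<open>J\<close> and \<open>Jh\<close> are compared.\<close>

definition Zcoord :: "real \<times> 'm \<Rightarrow> complex \<times> complex" where
  "Zcoord y = Yflow c (fst y) (\<Psi>i (snd y))"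

text \<open>\<open>standard_complex_on\<close> turns a relation in \<open>\<complex>\<^sup>2\<close>
  into one in \<open>M\<close>, the reverse of what is wanted. As the differential of the flow chart
  is onto off \<open>z\<^sub>2 = 0\<close>, a tangent vector satisfying the desired relation exists;
  it is carried to \<open>M\<close> and identified there by injectivity of the differential of the
  embedding.\<close>

lemma Zcoord_holomorphic:
  assumes V: "open V" "w \<in> V" and u: "smooth_on V u" "u ` V \<subseteq> UNIV \<times> N"
    and w: "snd (\<Psi>i (snd (u w))) \<noteq> 0"
    and D: "(u has_derivative Du) (at w)" and CR: "\<And>v. Du (\<i> * v) = J (u w) (Du v)"
  obtains DZ where "((\<lambda>w. Zcoord (u w)) has_derivative DZ) (at w)" "\<And>v. DZ (\<i> * v) = Jo (DZ v)"
proof -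
  obtain t x where tx: "u w = (t, x)" by (cases "u w")
  define z where "z = \<Psi>i x"
  have x: "x \<in> N" using u V tx by fastforce
  have z: "z \<in> nbhd \<epsilon>" "snd z \<noteq> 0" "\<Psi> z = x" using w tx Psii_N[OF x] by (auto simp: z_def)
  define v where "v = (\<lambda>w. (fst (u w), \<Psi>i (snd (u w))))"
  have vw: "v w = (t, z)" by (simp add: v_def tx z_def)
  have vA: "v ` V \<subseteq> UNIV \<times> nbhd \<epsilon>" using u(2) Psii_N by (fastforce simp: v_def)
  have vs: "smooth_on V v"
    unfolding v_def by (rule smooth_on_Pair[OF smooth_on_fst[OF u(1)] smooth_on_compose[OF Psii_smooth smooth_on_snd[OF u(1)]]])
      (use u(2) in auto)
  obtain Dv where Dv: "(v has_derivative Dv) (at w)"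
    using smooth_on_frechet_derivative[OF vs V] by blast
  obtain DF where DF: "((\<lambda>(t, z). (t, \<Psi> z)) has_derivative DF) (at (t, z) within UNIV \<times> nbhd \<epsilon>)"
    using id_times_derivative[OF Psi_smooth z(1)] .
  obtain DG where DG: "((\<lambda>(t, x). (t, \<Psi>i x)) has_derivative DG) (at (t, \<Psi> z) within UNIV \<times> N)"
    and inv: "\<And>v. v \<in> tangent_space (UNIV \<times> nbhd \<epsilon>) (t, z) \<Longrightarrow> DG (DF v) = v"
    using id_times_Psi_left_inverse[OF DF z(1)] by blast
  define DE where "DE = (\<lambda>(\<tau>, \<zeta>). (exp (- t) *\<^sub>R (fst \<zeta> - \<tau> *\<^sub>R fst z), exp (c * t) *\<^sub>R (snd \<zeta> + (c * \<tau>) *\<^sub>R snd z)))"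
  have DE: "((\<lambda>(t, z). Yflow c t z) has_derivative DE) (at (t, z) within UNIV \<times> nbhd \<epsilon>)"
    unfolding DE_def by (rule Yflow_has_derivative)
  have uF: "u y = (\<lambda>(t, z). (t, \<Psi> z)) (v y)" if "y \<in> V" for y
    using u(2) that Psii_N(2) by (auto simp: v_def prod_eq_iff)
  have "(u has_derivative (\<lambda>a. DF (Dv a))) (at w)"
    by (rule compose_derivative_on[where F = "\<lambda>(t, z). (t, \<Psi> z)", OF V vA Dv _ uF]) (use DF vw in auto)
  then have Du: "Du a = DF (Dv a)" for a using has_derivative_unique[OF D] by metis
  have tan: "Dv a \<in> tangent_space (UNIV \<times> nbhd \<epsilon>) (t, z)" for a
    using derivative_in_tangent_space[OF vs V vA Dv] vw by simp
  have key: "DE (Dv (\<i> * a)) = Jo (DE (Dv a))" for a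
  proof -
    \<comment> \<open>The candidate for \<open>Dv (\<i> * a)\<close>, satisfying the equation in
      \<open>\<complex>\<^sup>2\<close> by construction.\<close>
    obtain b where b: "b \<in> tangent_space (UNIV \<times> nbhd \<epsilon>) (t, z)" "DE b = Jo (DE (Dv a))"
      using Yflow_derivative_onto[OF z(1,2) c_pos, of t "Jo (DE (Dv a))"] unfolding DE_def by blast
    have "DF b = J (t, \<Psi> z) (DF (Dv a))"
      using structures_agreeD[OF std[unfolded standard_complex_on_def] _ DE DF tan b(1)] b(2) z(1) by simp
    also have "\<dots> = DF (Dv (\<i> * a))" using CR[of a] Du tx z by simp
    finally have "b = Dv (\<i> * a)" using inv[OF b(1)] inv[OF tan] by metis
    then show ?thesis using b by simp
  qed
  show ?thesis
  proof (rule that[of "\<lambda>a. DE (Dv a)"])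
    show "((\<lambda>w. Zcoord (u w)) has_derivative (\<lambda>a. DE (Dv a))) (at w)"
      by (rule compose_derivative_on[OF V vA Dv]) (use DE vw in \<open>auto simp: v_def Zcoord_def\<close>)
  qed (rule key)
qed

text \<open>The holomorphic map to \<open>\<complex>\<^sup>2\<close> is also the flow image of
  \<open>lift_coord\<close>, so \<open>standard_complex_on\<close> for the new torus, used in its
  given direction, carries its equation over to \<open>Jh\<close>.\<close>

lemma lift_CR_N:
  assumes V: "open V" "w \<in> V" and u: "smooth_on V u" "u ` V \<subseteq> UNIV \<times> N0"
    and D: "(u has_derivative Du) (at w)" and CR: "\<And>v. Du (\<i> * v) = J (u w) (Du v)"
    and Dt: "((\<lambda>w. tr (u w)) has_derivative Dt) (at w)"
  shows "Dt (\<i> * a) = Jh (tr (u w)) (Dt a)"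
proof -
  have uN: "u ` V \<subseteq> UNIV \<times> N" using u(2) N0_eq by auto
  have "snd (\<Psi>i (snd (u w))) \<noteq> 0" using Psii_N0(2) u(2) V(2) by auto
  from Zcoord_holomorphic[OF V u(1) uN this D CR] obtain DZ
    where DZ: "((\<lambda>w. Zcoord (u w)) has_derivative DZ) (at w)" "\<And>v. DZ (\<i> * v) = Jo (DZ v)" by blast
  define v where "v = (\<lambda>w. lift_coord (u w))"
  have vs: "smooth_on V v"
    unfolding v_def by (rule smooth_on_compose[OF lift_coord_smooth u])
  have vA: "v ` V \<subseteq> UNIV \<times> nhat c \<epsilon> s" using u(2) lift_coord_in unfolding v_def by blast
  obtain Dv where Dv: "(v has_derivative Dv) (at w)"
    using smooth_on_frechet_derivative[OF vs V] by blast
  obtain t z where tz: "v w = (t, z)" by (cases "v w")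
  have z: "z \<in> nhat c \<epsilon> s" using vA V tz by fastforce
  obtain DF where DF: "((\<lambda>(t, z). (t, \<Psi>h z)) has_derivative DF) (at (t, z) within UNIV \<times> nhat c \<epsilon> s)"
    using id_times_derivative[OF Psih_smooth z] .
  define DE where "DE = (\<lambda>(\<tau>, \<zeta>). (exp (- t) *\<^sub>R (fst \<zeta> - \<tau> *\<^sub>R fst z), exp (c * t) *\<^sub>R (snd \<zeta> + (c * \<tau>) *\<^sub>R snd z)))"
  have DE: "((\<lambda>(t, z). Yflow c t z) has_derivative DE) (at (t, z) within UNIV \<times> nhat c \<epsilon> s)"
    unfolding DE_def by (rule Yflow_has_derivative)
  have uF: "tr (u y) = (\<lambda>(t, z). (t, \<Psi>h z)) (v y)" if "y \<in> V" for y
  proof -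
    have "u y \<in> UNIV \<times> N0" using u(2) that by blast
    then show ?thesis by (simp add: v_def tr_lift_coord case_prod_unfold)
  qed
  have "((\<lambda>w. tr (u w)) has_derivative (\<lambda>a. DF (Dv a))) (at w)"
    by (rule compose_derivative_on[where F = "\<lambda>(t, z). (t, \<Psi>h z)", OF V vA Dv _ uF]) (use DF tz in auto)
  then have Dt': "Dt a = DF (Dv a)" for a using has_derivative_unique[OF Dt] by metis
  have "((\<lambda>w. Zcoord (u w)) has_derivative (\<lambda>a. DE (Dv a))) (at w)"
    by (rule compose_derivative_on[OF V vA Dv]) (use DE tz in \<open>auto simp: v_def Zcoord_def lift_coord_Yflow case_prod_unfold\<close>)
  then have DZ': "DZ a = DE (Dv a)" for a using has_derivative_unique[OF DZ(1)] by metis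
  have "DF (Dv (\<i> * a)) = Jh ((\<lambda>(t, z). (t, \<Psi>h z)) (v w)) (DF (Dv a))"
    by (rule structures_agree_curve[OF std_h[unfolded standard_complex_on_def] vs V vA _ _ Dv])
       (use DE DF tz DZ(2) DZ' in auto)
  then show ?thesis using Dt' uF[OF V(2)] by simp
qed

lemma lift_CR_Sig:
  assumes V: "open V" "w \<in> V" and u: "smooth_on V u" "u ` V \<subseteq> UNIV \<times> Sig"
    and D: "(u has_derivative Du) (at w)" and CR: "\<And>v. Du (\<i> * v) = J (u w) (Du v)"
    and Dt: "((\<lambda>w. tr (u w)) has_derivative Dt) (at w)"
  shows "Dt (\<i> * a) = Jh (tr (u w)) (Dt a)"
proof -
  obtain t x where tx: "u w = (t, x)" by (cases "u w")
  have x: "x \<in> Sig" using u V tx by fastforce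
  obtain DF where DF: "((\<lambda>(t, z). (t, \<psi> z)) has_derivative DF) (at (t, x) within UNIV \<times> Sig)"
    using id_times_derivative[OF smooth_on_subset[OF psi_smooth Sig_subset_M0] x] .
  have uF: "tr (u y) = (\<lambda>(t, z). (t, \<psi> z)) (u y)" if "y \<in> V" for y
    using u(2) that Sig_subset_M0 by (cases "u y") (force simp: tr_M0)
  have "((\<lambda>w. tr (u w)) has_derivative (\<lambda>a. DF (Du a))) (at w)"
    by (rule compose_derivative_on[where F = "\<lambda>(t, z). (t, \<psi> z)", OF V u(2) D _ uF]) (use DF tx in auto)
  then have Dt': "Dt a = DF (Du a)" for a using has_derivative_unique[OF Dt] by metis
  have "DF (Du (\<i> * a)) = Jh ((\<lambda>(t, z). (t, \<psi> z)) (u w)) (DF (Du a))"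
    by (rule structures_agree_curve[OF agree[folded Sig_def] u(1) V u(2) _ _ D, where DE = id])
       (use DF tx CR in \<open>auto simp: id_def\<close>)
  then show ?thesis using Dt' uF[OF V(2)] by simp
qed

text \<open>At boundary points of \<open>N\<close> neither chart contains a neighbourhood of the curve.  There the equation
  holds because its defect \<open>h\<close> is continuous: \<open>h\<close> vanishes over \<open>N0\<close>, so where \<open>h \<noteq> 0\<close> the curve stays in
  \<open>Sig\<close>, and there \<open>h = 0\<close> as well.\<close>

lemma lift_holomorphic:
  assumes u: "J_holomorphic_on U M J u" and V: "open V" "V \<subseteq> U" "u ` V \<subseteq> UNIV \<times> (M - binding \<Psi>)"
  shows "J_holomorphic_on V Mh Jh (tr \<circ> u)"
proof -
  have us: "smooth_on V u" using u V by (auto simp: J_holomorphic_on_def intro: smooth_on_subset)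
  have ucont: "continuous_on V u" by (rule smooth_on_continuous[OF us])
  have Du: "(u has_derivative frechet_derivative u (at w)) (at w)" if "w \<in> V" for w
    by (rule smooth_on_frechet_derivative[OF us V(1) that])
  have CR: "frechet_derivative u (at w) (\<i> * v) = J (u w) (frechet_derivative u (at w) v)" if "w \<in> V" for w v
    using u that V by (auto simp: J_holomorphic_on_def)
  have ts: "smooth_on V (\<lambda>w. tr (u w))" by (rule smooth_on_compose[OF tr_smooth us V(3)])
  define Dt where "Dt w = frechet_derivative (\<lambda>w. tr (u w)) (at w)" for w
  have Dt: "((\<lambda>w. tr (u w)) has_derivative Dt w) (at w)" if "w \<in> V" for w
    unfolding Dt_def by (rule smooth_on_frechet_derivative[OF ts V(1) that])
  have Mh: "(\<lambda>w. tr (u w)) ` V \<subseteq> UNIV \<times> Mh" 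
  proof (rule image_subsetI)
    fix w assume "w \<in> V"
    then have "snd (u w) \<in> M - binding \<Psi>" using V(3) by auto
    from tr_in_Mh[OF this, of "fst (u w)"] show "tr (u w) \<in> UNIV \<times> Mh" by simp
  qed
  have pre: "\<exists>W. open W \<and> V \<inter> (\<lambda>w. snd (u w)) -` X = V \<inter> W" if X: "openin (top_of_set M) X" for X
  proof -
    have "continuous_on V (\<lambda>w. snd (u w))" by (intro continuous_intros ucont)
    then have "openin (top_of_set V) (V \<inter> (\<lambda>w. snd (u w)) -` X)"
      by (rule continuous_openin_preimage[OF _ _ X]) (use V in auto)
    then show ?thesis by (auto simp: openin_open)
  qed
  have main: "Dt w (\<i> * a) = Jh (tr (u w)) (Dt w a)" if w: "w \<in> V" for w a
  proof (rule ccontr)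
    define h where "h y = Dt y (\<i> * a) - Jh (tr (u y)) (Dt y a)" for y
    assume "\<not> ?thesis"
    then have "h w \<noteq> 0" by (simp add: h_def)
    have hN: "h y = 0" if y: "y \<in> V" "snd (u y) \<in> N0" for y
    proof -
      obtain W where W: "open W" "V \<inter> (\<lambda>w. snd (u w)) -` N0 = V \<inter> W" using pre[OF openin_N0] by blast
      have "open (V \<inter> W)" using V W by auto
      moreover have "u ` (V \<inter> W) \<subseteq> UNIV \<times> N0" 
      proof (rule image_subsetI)
        fix x assume "x \<in> V \<inter> W"
        then have "x \<in> V \<inter> (\<lambda>w. snd (u w)) -` N0" using W(2) by blast
        then show "u x \<in> UNIV \<times> N0" by (simp add: mem_Times_iff)
      qed
      moreover have "y \<in> V \<inter> W" using y W(2) by auto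
      moreover have "smooth_on (V \<inter> W) u" by (rule smooth_on_subset[OF us]) auto
      ultimately show ?thesis
        unfolding h_def by (simp add: lift_CR_N[OF _ _ _ _ Du[OF y(1)] CR[OF y(1)] Dt[OF y(1)]])
    qed
    have "continuous_on V h"
    proof -
      have D: "continuous_on V (\<lambda>w. Dt w b)" for b
        unfolding Dt_def by (rule smooth_on_continuous_frechet_derivative[OF ts V(1)])
      have "smooth_on (UNIV \<times> Mh) (\<lambda>p. Jh p b)" for b
        using inv_Jh unfolding invariant_almost_complex_def by blast
      moreover have "linear (Jh p)" if "p \<in> UNIV \<times> Mh" for p
        using inv_Jh that unfolding invariant_almost_complex_def by blast
      ultimately have "continuous_on V (\<lambda>w. Jh (tr (u w)) (Dt w a))"
        by (rule continuous_on_apply_linear[OF smooth_on_continuous _ smooth_on_continuous[OF ts] Mh D])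
      with D show ?thesis
        unfolding h_def by (rule continuous_on_diff)
    qed
    then have "open (V \<inter> h -` (- {0}))"
      using V(1) by (intro continuous_open_preimage) auto
    moreover have "w \<in> V \<inter> h -` (- {0})" using w \<open>h w \<noteq> 0\<close> by auto
    moreover have "u ` (V \<inter> h -` (- {0})) \<subseteq> UNIV \<times> Sig"
    proof (rule image_subsetI)
      fix y assume "y \<in> V \<inter> h -` (- {0})"
      then have y: "y \<in> V" "h y \<noteq> 0" by auto
      then have "snd (u y) \<notin> N0" "snd (u y) \<in> M - binding \<Psi>" using hN V(3) by auto
      then have "snd (u y) \<in> Sig" using M_minus_N N0_eq by blast
      then show "u y \<in> UNIV \<times> Sig" by (simp add: mem_Times_iff)
    qed
    moreover have "smooth_on (V \<inter> h -` (- {0})) u" by (rule smooth_on_subset[OF us]) auto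
    ultimately have "Dt w (\<i> * a) = Jh (tr (u w)) (Dt w a)"
      by (intro lift_CR_Sig[OF _ _ _ _ Du[OF w] CR[OF w] Dt[OF w]])
    then have "h w = 0" by (simp add: h_def)
    with \<open>h w \<noteq> 0\<close> show False by simp
  qed
  show ?thesis
    unfolding J_holomorphic_on_def o_def using V(1) ts Mh main by (auto simp: Dt_def)
qed

end

section \<open>Reeb orbits and the ends of the lift\<close>

context lift
begin

lemma Xflow_nbhd: "z \<in> nbhd \<epsilon> \<Longrightarrow> Xflow c t z \<in> nbhd \<epsilon>"
  unfolding Xflow_def by (rule nbhd_rotate)

lemma Xflow_has_derivative:
  "((\<lambda>t. Xflow c (t - t0) z) has_vector_derivative Xfield c (Xflow c (t - t0) z)) (at t within A)"
proof -
  have "((\<lambda>t. cis (a * (t - t0)) * w) has_vector_derivative \<i> * a * (cis (a * (t - t0)) * w)) (at t within A)" for a :: real and w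
    unfolding has_vector_derivative_def by (auto intro!: derivative_eq_intros simp: scaleR_conv_of_real algebra_simps)
  from has_vector_derivative_Pair[OF this[of "-1" "fst z"] this[of c "snd z"]]
  show ?thesis by (simp add: Xflow_def[abs_def] Xfield_def mult.commute mult.left_commute)
qed

lemma Xfield_tangent: "z \<in> nbhd \<epsilon> \<Longrightarrow> Xfield c z \<in> tangent_space (nbhd \<epsilon>) z"
  using tangent_space_rotate[of z "nbhd \<epsilon>" "-1" c] nbhd_rotate
  by (simp add: Xfield_def scaleR_conv_of_real mult.assoc)

text \<open>This comes from \<open>J \<partial>\<^sub>t = R\<close> and \<open>J\<^sub>o Y = X\<close> rather than from the contact form.\<close>

lemma Reeb_on_N:
  assumes z: "z \<in> nbhd \<epsilon>" and D: "(\<Psi>i has_derivative DG) (at (\<Psi> z) within N)"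
  shows "DG (R (\<Psi> z)) = Xfield c z"
proof -
  obtain DP where DP: "(\<Psi> has_derivative DP) (at z within nbhd \<epsilon>)"
    using smooth_on_has_derivative[OF Psi_smooth z] by blast
  define DF where "DF = (\<lambda>(\<tau>::real, \<zeta>). (\<tau>, DP \<zeta>))"
  have "((\<lambda>y. (fst y, \<Psi> (snd y))) has_derivative (\<lambda>y. (fst y, DP (snd y)))) (at (0::real, z) within UNIV \<times> nbhd \<epsilon>)"
  proof (intro has_derivative_Pair has_derivative_fst has_derivative_ident)
    have "(\<Psi> has_derivative DP) (at (snd (0::real, z)) within snd ` ((UNIV::real set) \<times> nbhd \<epsilon>))"
      using DP by simp
    from diff_chain_within[OF has_derivative_snd[OF has_derivative_ident] this]
    show "((\<lambda>y. \<Psi> (snd y)) has_derivative (\<lambda>y. DP (snd y))) (at (0::real, z) within UNIV \<times> nbhd \<epsilon>)"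
      by (simp add: o_def)
  qed
  then have DF: "((\<lambda>(t, z). (t, \<Psi> z)) has_derivative DF) (at (0, z) within UNIV \<times> nbhd \<epsilon>)"
    by (simp add: DF_def case_prod_unfold)
  have "DF (0, Xfield c z) = J (0, \<Psi> z) (DF (1, 0))"
    using structures_agreeD[OF std[unfolded standard_complex_on_def] _ Yflow_has_derivative DF
        tangent_space_vertical[OF z] tangent_space_slice[OF Xfield_tangent[OF z]]] z
    by (simp add: Xfield_def Jo_def scaleR_conv_of_real)
  moreover have "DP 0 = 0" using has_derivative_linear[OF DP] by (rule linear_0)
  moreover have "\<Psi> z \<in> M" using z N_subset by (auto simp: N_def)
  then have "J (0, \<Psi> z) (1, 0) = (0, R (\<Psi> z))" using adm by (simp add: admissible_def)
  ultimately have "DP (Xfield c z) = R (\<Psi> z)" by (simp add: DF_def)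
  moreover have "DG (DP (Xfield c z)) = Xfield c z"
    by (rule derivative_left_inverse[OF DP, where G = \<Psi>i]) (use D z Psii Xfield_tangent in \<open>auto simp: N_def\<close>)
  ultimately show ?thesis by simp
qed

text \<open>The times at which the orbit agrees with the explicit flow form a closed, open and
  nonempty set. In particular an orbit that meets \<open>N\<close> never leaves it.\<close>

lemma orbit_on_N:
  assumes \<gamma>: "closed_orbit M R \<gamma> T" and z0: "z0 \<in> nbhd \<epsilon>" "\<gamma> t0 = \<Psi> z0"
  shows "\<gamma> t = \<Psi> (Xflow c (t - t0) z0)"
proof -
  have \<gamma>M: "\<gamma> t \<in> M" and \<gamma>': "(\<gamma> has_vector_derivative R (\<gamma> t)) (at t)" for t
    using \<gamma> by (auto simp: closed_orbit_def)
  have cont: "continuous_on UNIV \<gamma>"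
    by (intro continuous_at_imp_continuous_on ballI has_vector_derivative_continuous[OF \<gamma>'])
  define Q where "Q = {t. \<gamma> t = \<Psi> (Xflow c (t - t0) z0)}"
  have "continuous_on UNIV (\<lambda>t. \<Psi> (Xflow c (t - t0) z0))"
  proof (rule continuous_on_compose2[OF smooth_on_continuous[OF Psi_smooth]])
    show "continuous_on UNIV (\<lambda>t. Xflow c (t - t0) z0)"
      by (intro continuous_at_imp_continuous_on ballI has_vector_derivative_continuous[OF Xflow_has_derivative])
  qed (use Xflow_nbhd[OF z0(1)] in auto)
  then have "closed Q" unfolding Q_def by (intro closed_Collect_eq cont)
  moreover have "open Q"
    unfolding open_dist
  proof
    fix t1 assume "t1 \<in> Q"
    then have t1: "\<gamma> t1 = \<Psi> (Xflow c (t1 - t0) z0)" by (simp add: Q_def)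
    obtain W where W: "open W" "N = M \<inter> W" using openin_N by (auto simp: openin_open)
    have "open (\<gamma> -` W)" by (rule open_vimage[OF W(1) cont])
    moreover have "t1 \<in> \<gamma> -` W"
      using t1 W(2) Xflow_nbhd[OF z0(1)] by (auto simp: N_def)
    ultimately obtain e where e: "e > 0" "ball t1 e \<subseteq> \<gamma> -` W" by (meson open_contains_ball)
    have N: "\<gamma> t \<in> N" if "t \<in> ball t1 e" for t using e(2) that W(2) \<gamma>M by auto
    \<comment> \<open>Undoing the explicit flow along the orbit gives a curve with zero derivative,
      so uniqueness follows without a general theorem on differential equations.\<close>
    define y where "y t = Xflow c (t0 - t) (\<Psi>i (\<gamma> t))" for t
    have y0: "(y has_vector_derivative 0) (at t within ball t1 e)" if t: "t \<in> ball t1 e" for t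
    proof -
      define z where "z = \<Psi>i (\<gamma> t)"
      have z: "z \<in> nbhd \<epsilon>" "\<gamma> t = \<Psi> z" using Psii_N[OF N[OF t]] by (auto simp: z_def)
      obtain DG where DG: "(\<Psi>i has_derivative DG) (at (\<gamma> t) within N)"
        using smooth_on_has_derivative[OF Psii_smooth N[OF t]] by blast
      have "(\<Psi>i \<circ> \<gamma> has_vector_derivative DG (R (\<gamma> t))) (at t within ball t1 e)"
        by (rule vector_derivative_diff_chain_within[OF has_vector_derivative_at_within[OF \<gamma>'] has_derivative_subset[OF DG]])
           (use N in auto)
      then have Dz: "((\<lambda>t. \<Psi>i (\<gamma> t)) has_vector_derivative Xfield c z) (at t within ball t1 e)"
        using Reeb_on_N[OF z(1)] DG z(2) by (simp add: o_def)
      have D1: "((\<lambda>t. fst (\<Psi>i (\<gamma> t))) has_vector_derivative - \<i> * fst z) (at t within ball t1 e)"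
        and D2: "((\<lambda>t. snd (\<Psi>i (\<gamma> t))) has_vector_derivative c * \<i> * snd z) (at t within ball t1 e)"
        using bounded_linear.has_vector_derivative[OF bounded_linear_fst Dz] bounded_linear.has_vector_derivative[OF bounded_linear_snd Dz]
        by (simp_all add: Xfield_def)
      have C: "((\<lambda>t. cis (a * (t0 - t))) has_vector_derivative - a * \<i> * cis (a * (t0 - t))) (at t within ball t1 e)" for a :: real
        unfolding has_vector_derivative_def by (auto intro!: derivative_eq_intros simp: scaleR_conv_of_real algebra_simps)
      have "((\<lambda>t. (cis ((-1) * (t0 - t)) * fst (\<Psi>i (\<gamma> t)), cis (c * (t0 - t)) * snd (\<Psi>i (\<gamma> t)))) has_vector_derivative
         (cis ((-1) * (t0 - t)) * (- \<i> * fst z) + (- (-1::real) * \<i> * cis ((-1) * (t0 - t))) * fst (\<Psi>i (\<gamma> t)),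
          cis (c * (t0 - t)) * (c * \<i> * snd z) + (- c * \<i> * cis (c * (t0 - t))) * snd (\<Psi>i (\<gamma> t)))) (at t within ball t1 e)"
        by (intro has_vector_derivative_Pair has_vector_derivative_mult C D1 D2)
      then show ?thesis
        by (simp add: y_def[abs_def] Xflow_def z_def[symmetric] algebra_simps zero_prod_def)
    qed
    from has_vector_derivative_zero_constant[OF convex_ball y0] obtain k
      where k: "\<And>t. t \<in> ball t1 e \<Longrightarrow> y t = k" by metis
    have yc: "y t = y t1" if "t \<in> ball t1 e" for t using k[OF that] k[of t1] e(1) by simp
    have "y t1 = z0"
      using t1 Psii[OF Xflow_nbhd[OF z0(1)]] by (simp add: y_def Xflow_add)
    have "t \<in> Q" if t: "t \<in> ball t1 e" for t
    proof -
      have "Xflow c (t - t0) z0 = Xflow c (t - t0) (y t)" using yc[OF t] \<open>y t1 = z0\<close> by simp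
      also have "\<dots> = \<Psi>i (\<gamma> t)" by (simp add: y_def Xflow_add)
      finally show ?thesis using Psii_N(2)[OF N[OF t]] by (simp add: Q_def)
    qed
    then show "\<exists>e>0. \<forall>y. dist y t1 < e \<longrightarrow> y \<in> Q" using e(1) by (metis dist_commute mem_ball)
  qed
  moreover have "t0 \<in> Q" using z0 by (simp add: Q_def)
  ultimately have "Q = UNIV" using clopen[of Q] by blast
  then show ?thesis by (auto simp: Q_def)
qed

text \<open>An orbit through the binding stays in it and runs around it at unit angular speed, so
  closing up after time \<open>T\<close> makes \<open>T\<close> a positive multiple of
  \<open>2 * pi\<close>, the excluded case.\<close>

lemma orbit_avoids_binding:
  assumes \<gamma>: "closed_orbit M R \<gamma> T" "\<not> multiple_of_binding \<Psi> \<gamma> T"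
  shows "\<gamma> t \<notin> binding \<Psi>"
proof
  assume "\<gamma> t \<in> binding \<Psi>"
  then obtain p where p: "\<gamma> t = \<Psi> (Phi p 0 0)" by (auto simp: binding_def)
  have z0: "Phi p 0 0 \<in> nbhd \<epsilon>" using eps by (simp add: Phi_def nbhd_def)
  have X: "Xflow c r (Phi p 0 0) = Phi (r + p) 0 0" for r
    by (simp add: Xflow_def Phi_def cis_mult)
  have *: "\<gamma> r = \<Psi> (Phi (r - t + p) 0 0)" for r
    using orbit_on_N[OF \<gamma>(1) z0 p, of r] X by simp
  have T: "T > 0" "\<gamma> (t + T) = \<gamma> t" using \<gamma>(1) by (auto simp: closed_orbit_def)
  have "\<Psi> (Phi (T + p) 0 0) = \<Psi> (Phi p 0 0)" using *[of "t + T"] T(2) p by simp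
  moreover have "Phi (T + p) 0 0 \<in> nbhd \<epsilon>" using Xflow_nbhd[OF z0] X by metis
  ultimately have "Phi (T + p) 0 0 = Phi p 0 0" using Psi_inj z0 by (auto dest: inj_onD)
  then have "cis (- (T + p)) = cis (- p)" by (simp add: Phi_def)
  then have "cis T = 1"
    by (metis (no_types, lifting) add.commute cis_cnj cis_mult cis_neq_zero complex_cnj_cancel_iff mult_cancel_right1)
  then have "cos T = 1" by (metis cis.sel(1) one_complex.sel(1))
  then obtain n :: int where n: "T = of_int n * 2 * pi" by (auto simp: cos_one_2pi_int)
  then have "n > 0" using T(1) by (simp add: zero_less_mult_iff)
  then have "T = real (nat n) * (2 * pi)" using n by simp
  moreover have "\<forall>r. \<gamma> r = \<Psi> (Phi (r + (p - t)) 0 0)" using * by (simp add: algebra_simps)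
  ultimately show False using \<gamma>(2) unfolding multiple_of_binding_def by blast
qed

text \<open>The explicit flow preserves \<open>r\<^sub>2\<close>, so \<open>delta\<close> is
  constant along an orbit meeting \<open>N\<close>; any other orbit lies in \<open>Sig\<close>,
  where nothing is shifted. Constancy is what allows a single constant \<open>a\<close> in the
  asymptotics of the lifted end.\<close>

lemma tr_fst_orbit:
  assumes \<gamma>: "closed_orbit M R \<gamma> T" "\<not> multiple_of_binding \<Psi> \<gamma> T"
  shows "fst (tr (a, \<gamma> t)) = a + fst (tr (0, \<gamma> 0))"
proof (cases "\<exists>t. \<gamma> t \<in> N")
  case True
  then obtain t0 z0 where z0: "z0 \<in> nbhd \<epsilon>" "\<gamma> t0 = \<Psi> z0" by (auto simp: N_def)
  have "snd z0 \<noteq> 0" using orbit_avoids_binding[OF \<gamma>, of t0] z0 by (auto simp: binding_eq)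
  have "fst (tr (a, \<gamma> t)) = a + delta (norm (snd z0))" for a t
  proof -
    define z where "z = Xflow c (t - t0) z0"
    have n: "norm (snd z) = norm (snd z0)" by (simp add: z_def Xflow_def norm_mult)
    moreover have "z \<in> nbhd \<epsilon>" "\<gamma> t = \<Psi> z"
      unfolding z_def using Xflow_nbhd[OF z0(1)] orbit_on_N[OF \<gamma>(1) z0] by blast+
    moreover from n \<open>snd z0 \<noteq> 0\<close> have "snd z \<noteq> 0" by auto
    ultimately show ?thesis by (simp add: tr_N)
  qed
  then show ?thesis by simp
next
  case False
  have "\<gamma> t \<in> M0" for t
  proof -
    have "\<gamma> t \<in> M" using \<gamma>(1) by (simp add: closed_orbit_def)
    then have "\<gamma> t \<in> Sig" using False M_minus_N by blast
    then show ?thesis using Sig_subset_M0 by blast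
  qed
  then show ?thesis by (simp add: tr_M0)
qed

lemma compact_orbit:
  assumes "closed_orbit M R \<gamma> T"
  shows "compact (range \<gamma>)"
proof -
  have T: "T > 0" and per: "\<And>t. \<gamma> (t + T) = \<gamma> t" and D: "\<And>t. (\<gamma> has_vector_derivative R (\<gamma> t)) (at t)"
    using assms by (auto simp: closed_orbit_def)
  have pern: "\<gamma> (t + real n * T) = \<gamma> t" for t n
  proof (induction n arbitrary: t)
    case (Suc n)
    have "\<gamma> (t + real (Suc n) * T) = \<gamma> ((t + real n * T) + T)" by (simp add: algebra_simps)
    then show ?case using per Suc by simp
  qed simp
  have "\<gamma> t \<in> \<gamma> ` {0..T}" for t
  proof -
    define k where "k = \<lfloor>t / T\<rfloor>"
    have k: "0 \<le> t - of_int k * T" "t - of_int k * T \<le> T"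
      using T floor_divide_lower[OF T, of t] floor_divide_upper[OF T, of t] by (auto simp: k_def algebra_simps)
    have "\<gamma> t = \<gamma> (t - of_int k * T)"
    proof (cases "k \<ge> 0")
      case True
      then show ?thesis using pern[of "t - of_int k * T" "nat k"] by simp
    next
      case False
      then show ?thesis using pern[of t "nat (- k)"] by simp
    qed
    then show ?thesis using k by (metis atLeastAtMost_iff imageI)
  qed
  then have "range \<gamma> = \<gamma> ` {0..T}" by auto
  moreover have "continuous_on {0..T} \<gamma>"
    by (intro continuous_at_imp_continuous_on ballI has_vector_derivative_continuous[OF D])
  ultimately show ?thesis using compact_continuous_image compact_Icc by metis
qed

text \<open>With the linear term removed first, the limits fill a compact set inside the domain on
  which the identification is continuous; equivariance then puts the linear term back.\<close>

lemma lift_end: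
  assumes \<gamma>: "closed_orbit M R \<gamma> T" "\<not> multiple_of_binding \<Psi> \<gamma> T"
    and lim: "uniform_limit UNIV (\<lambda>\<sigma> \<tau>. f \<sigma> \<tau> - (T * \<sigma>, 0)) (\<lambda>\<tau>. (a, \<gamma> (T * \<tau> + d))) F"
    and f: "\<And>\<sigma> \<tau>. snd (f \<sigma> \<tau>) \<in> M"
  shows "\<exists>a d. uniform_limit UNIV (\<lambda>\<sigma> \<tau>. tr (f \<sigma> \<tau>) - (T * \<sigma>, 0)) (\<lambda>\<tau>. (a, snd (tr (0, \<gamma> (T * \<tau> + d))))) F"
proof -
  define U where "U = (UNIV :: real set) \<times> (M - binding \<Psi>)"
  define K where "K = {a} \<times> range \<gamma>"
  have rng: "\<gamma> t \<in> M - binding \<Psi>" for t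
    using orbit_avoids_binding[OF \<gamma>] \<gamma>(1) by (simp add: closed_orbit_def)
  have K: "compact K" "K \<subseteq> U" using compact_orbit[OF \<gamma>(1)] rng by (auto simp: K_def U_def intro: compact_Times)
  \<comment> \<open>The orbit has positive distance \<open>e\<close> from the binding, so points of
    the curve closer than \<open>e\<close> to the orbit avoid the binding.\<close>
  obtain e where e: "e > 0" "\<And>x y. x \<in> range \<gamma> \<Longrightarrow> y \<in> binding \<Psi> \<Longrightarrow> e \<le> dist x y"
    using separate_compact_closed[OF compact_orbit[OF \<gamma>(1)] compact_imp_closed[OF compact_binding]] rng by blast
  have ev: "\<forall>\<^sub>F \<sigma> in F. \<forall>\<tau>\<in>UNIV. f \<sigma> \<tau> - (T * \<sigma>, 0) \<in> U"
    using uniform_limitD[OF lim e(1)]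
  proof eventually_elim
    case (elim \<sigma>)
    show ?case
    proof
      fix \<tau> :: real
      have "dist (f \<sigma> \<tau> - (T * \<sigma>, 0)) (a, \<gamma> (T * \<tau> + d)) < e" using elim by blast
      moreover have "dist (snd (f \<sigma> \<tau> - (T * \<sigma>, 0))) (\<gamma> (T * \<tau> + d)) \<le> dist (f \<sigma> \<tau> - (T * \<sigma>, 0)) (a, \<gamma> (T * \<tau> + d))"
        using dist_snd_le[of "f \<sigma> \<tau> - (T * \<sigma>, 0)" "(a, \<gamma> (T * \<tau> + d))"] by (simp only: snd_conv)
      ultimately have "dist (snd (f \<sigma> \<tau> - (T * \<sigma>, 0))) (\<gamma> (T * \<tau> + d)) < e" by linarith
      then have "snd (f \<sigma> \<tau>) \<notin> binding \<Psi>"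
        using e(2)[of "\<gamma> (T * \<tau> + d)" "snd (f \<sigma> \<tau>)"] by (auto simp: dist_commute)
      then show "f \<sigma> \<tau> - (T * \<sigma>, 0) \<in> U" using f by (simp add: U_def mem_Times_iff)
    qed
  qed
  have "uniform_limit UNIV (\<lambda>\<sigma> \<tau>. tr (f \<sigma> \<tau> - (T * \<sigma>, 0))) (\<lambda>\<tau>. tr (a, \<gamma> (T * \<tau> + d))) F"
    by (rule uniform_limit_compose_compact[OF lim K(1) _ K(2) smooth_on_continuous[OF tr_smooth, folded U_def] ev])
       (auto simp: K_def)
  moreover have "\<forall>\<^sub>F \<sigma> in F. \<forall>\<tau>\<in>UNIV. tr (f \<sigma> \<tau> - (T * \<sigma>, 0)) = tr (f \<sigma> \<tau>) - (T * \<sigma>, 0)"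
    using ev
  proof eventually_elim
    case (elim \<sigma>)
    show ?case
    proof
      fix \<tau> :: real
      have "snd (f \<sigma> \<tau>) \<in> M - binding \<Psi>" using elim by (auto simp: U_def mem_Times_iff)
      from tr_shift[OF this, of "fst (f \<sigma> \<tau>) - T * \<sigma>" "T * \<sigma>"]
      have "tr (f \<sigma> \<tau>) = tr (fst (f \<sigma> \<tau>) - T * \<sigma>, snd (f \<sigma> \<tau>)) + (T * \<sigma>, 0)" by simp
      moreover have "(fst (f \<sigma> \<tau>) - T * \<sigma>, snd (f \<sigma> \<tau>)) = f \<sigma> \<tau> - (T * \<sigma>, 0)" by (simp add: prod_eq_iff)
      ultimately show "tr (f \<sigma> \<tau> - (T * \<sigma>, 0)) = tr (f \<sigma> \<tau>) - (T * \<sigma>, 0)" by simp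
    qed
  qed
  moreover have "tr (a, \<gamma> t) = (a + fst (tr (0, \<gamma> 0)), snd (tr (0, \<gamma> t)))" for t
    using tr_fst_orbit[OF \<gamma>, of a t] tr_shift[OF rng, of 0 a t] by (simp add: prod_eq_iff)
  ultimately have "uniform_limit UNIV (\<lambda>\<sigma> \<tau>. tr (f \<sigma> \<tau>) - (T * \<sigma>, 0))
      (\<lambda>\<tau>. (a + fst (tr (0, \<gamma> 0)), snd (tr (0, \<gamma> (T * \<tau> + d))))) F"
    using uniform_limit_cong[of UNIV "\<lambda>\<sigma> \<tau>. tr (f \<sigma> \<tau> - (T * \<sigma>, 0))" "\<lambda>\<sigma> \<tau>. tr (f \<sigma> \<tau>) - (T * \<sigma>, 0)" F
        "\<lambda>\<tau>. tr (a, \<gamma> (T * \<tau> + d))"] by simp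
  then show ?thesis by blast
qed

end

section \<open>The extra punctures\<close>

text \<open>The logarithmic derivative of the path is the constant \<open>2 * pi * \<i> * n\<close>,
  which makes the contour integral immediate.\<close>

lemma winding_number_circle_power:
  assumes "\<rho> > 0" "k \<noteq> 0"
  shows "winding_number (\<lambda>x. k * (circlepath p \<rho> x - p) ^ n) 0 = of_nat n"
proof -
  define g where "g = (\<lambda>x. k * (circlepath p \<rho> x - p) ^ n)"
  define K where "K = k * of_real \<rho> ^ n"
  have K: "K \<noteq> 0" using assms by (simp add: K_def)
  have geq: "g x = K * cis (2 * pi * real n * x)" for x
  proof -
    have "exp (2 * of_real pi * \<i> * of_real x) = cis (2 * pi * x)" by (simp add: cis_conv_exp mult_ac)
    then show ?thesis
      by (simp add: g_def circlepath K_def power_mult_distrib Complex.DeMoivre mult_ac)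
  qed
  have valid: "valid_path g"
    using valid_path_compose_holomorphic[OF valid_path_circlepath, of "\<lambda>w. k * (w - p) ^ n" UNIV p \<rho>]
    by (simp add: g_def o_def holomorphic_intros)
  have nz: "g x \<noteq> 0" for x using K by (simp add: geq)
  have D: "(g has_vector_derivative (2 * of_real pi * \<i> * of_nat n) * g x) (at x within {0..1})" for x
    unfolding geq[abs_def] has_vector_derivative_def
    by (auto intro!: derivative_eq_intros simp: scaleR_conv_of_real algebra_simps)
  have "((\<lambda>w. 1 / (w - 0)) has_contour_integral (2 * of_real pi * \<i> * of_nat n)) g"
    unfolding has_contour_integral_def
  proof (rule has_integral_eq)
    show "((\<lambda>x. 2 * of_real pi * \<i> * of_nat n) has_integral (2 * of_real pi * \<i> * of_nat n)) {0..1::real}"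
      using has_integral_const_real[of "2 * of_real pi * \<i> * of_nat n" 0 1] by simp
    show "2 * of_real pi * \<i> * of_nat n = 1 / (g x - 0) * vector_derivative g (at x within {0..1})"
      if "x \<in> {0..1}" for x
      using vector_derivative_within_closed_interval[OF zero_less_one that D] nz[of x] by simp
  qed
  then have "contour_integral g (\<lambda>w. 1 / (w - 0)) = 2 * of_real pi * \<i> * of_nat n"
    by (rule contour_integral_unique)
  moreover have "0 \<notin> path_image g" using nz by (auto simp: path_image_def)
  ultimately show ?thesis
    using winding_number_valid_path[OF valid, of 0] by (simp add: g_def)
qed

lemma complex_linear_derivative:
  fixes f :: "complex \<Rightarrow> complex"
  assumes "(f has_derivative D) (at w)" "\<And>v. D (\<i> * v) = \<i> * D v"
  shows "f field_differentiable at w"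
proof -
  have lin: "linear D" using has_derivative_linear assms by blast
  have "D v = D 1 * v" for v
  proof -
    have "v = Re v *\<^sub>R 1 + Im v *\<^sub>R (\<i> * 1)" by (simp add: complex_eq_iff)
    then have "D v = Re v *\<^sub>R D 1 + Im v *\<^sub>R (\<i> * D 1)"
      using linear_add[OF lin] linear_scale[OF lin] assms(2)[of 1] by metis
    also have "\<dots> = D 1 * (of_real (Re v) + \<i> * of_real (Im v))" by (simp add: scaleR_conv_of_real algebra_simps)
    finally show ?thesis by (metis complex_eq)
  qed
  then have eq: "D = (*) (D 1)" by (rule ext)
  have "(f has_field_derivative D 1) (at w)"
    unfolding has_field_derivative_def by (subst eq[symmetric]) (rule assms(1))
  then show ?thesis by (auto simp: field_differentiable_def)
qed

text \<open>The distance to \<open>p\<close> is \<open>exp (2 * pi * \<sigma>)\<close> whatever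
  \<open>\<tau>\<close> is, so a punctured neighbourhood contains a whole half-cylinder.\<close>

lemma eventually_at_bot_exp:
  assumes "\<forall>\<^sub>F w in at p. P w"
  shows "\<forall>\<^sub>F \<sigma> in at_bot. \<forall>\<tau>. P (p + exp (of_real (2 * pi) * Complex \<sigma> \<tau>))"
proof -
  obtain d where d: "d > 0" "\<And>w. w \<noteq> p \<Longrightarrow> dist w p < d \<Longrightarrow> P w"
    using assms by (auto simp: eventually_at)
  show ?thesis
    unfolding eventually_at_bot_dense
  proof (intro exI[of _ "ln d / (2 * pi)"] allI impI)
    fix \<sigma> \<tau> :: real assume "\<sigma> < ln d / (2 * pi)"
    then have "2 * pi * \<sigma> < ln d" using pi_gt_zero by (simp add: field_simps)
    then have "exp (2 * pi * \<sigma>) < d" using d(1) by (metis exp_less_cancel_iff exp_ln)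
    then show "P (p + exp (of_real (2 * pi) * Complex \<sigma> \<tau>))"
      by (intro d(2)) (auto simp: dist_norm)
  qed
qed

context lift
begin

text \<open>Once the phase \<open>cis (2 * pi * real m * \<tau>)\<close> and the linear term are
  taken out exactly, the error is bounded by a function \<open>H\<close> of the point alone with
  limit 0 at \<open>p\<close>. Uniformity in the angle then reduces to a limit at a point.\<close>

lemma puncture_end:
  assumes u: "J_holomorphic_on U M J u" and p: "p \<in> U" "snd (u p) \<in> binding \<Psi>"
    and iso: "\<forall>\<^sub>F w in at p. snd (u w) \<notin> binding \<Psi>"
    and mult: "intersection_multiplicity \<epsilon> \<Psi> u p m"
    and z: "z \<in> gamma_hat c \<epsilon> s"
  shows "negative_end_at p (tr \<circ> u) (\<lambda>t. \<Psi>h (Xflow c t z)) (real m * (2 * pi / c))"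
proof -
  have Uo: "open U" and us: "smooth_on U u" and uM: "u ` U \<subseteq> UNIV \<times> M"
    and CR: "\<And>w v. w \<in> U \<Longrightarrow> frechet_derivative u (at w) (\<i> * v) = J (u w) (frechet_derivative u (at w) v)"
    using u by (auto simp: J_holomorphic_on_def)
  have ucont: "continuous_on U u" by (rule smooth_on_continuous[OF us])
  obtain W where W: "open W" "N = M \<inter> W" using openin_N by (auto simp: openin_open)
  have "continuous_on U (\<lambda>w. snd (u w))" by (intro continuous_intros ucont)
  then have "open (U \<inter> (\<lambda>w. snd (u w)) -` W)" using Uo W(1) by (rule continuous_open_preimage)
  moreover have "p \<in> U \<inter> (\<lambda>w. snd (u w)) -` W" using p binding_subset W(2) by auto
  ultimately obtain e1 where e1: "e1 > 0" "ball p e1 \<subseteq> U \<inter> (\<lambda>w. snd (u w)) -` W"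
    by (meson open_contains_ball)
  obtain e2 where e2: "e2 > 0" "\<And>w. w \<noteq> p \<Longrightarrow> dist w p < e2 \<Longrightarrow> snd (u w) \<notin> binding \<Psi>"
    using iso by (auto simp: eventually_at)
  \<comment> \<open>Small enough that the curve stays in \<open>N\<close> and meets the binding at
    \<open>p\<close> only.\<close>
  define V where "V = ball p (min e1 e2)"
  have V: "open V" "connected V" "p \<in> V" "V \<subseteq> U" using e1 e2 by (auto simp: V_def)
  have uN: "snd (u w) \<in> N" if "w \<in> V" for w
  proof -
    have w: "w \<in> U" "snd (u w) \<in> W" using that e1(2) by (auto simp: V_def)
    then have "u w \<in> UNIV \<times> M" using uM by blast
    then show ?thesis using w W(2) by (auto simp: mem_Times_iff)
  qed
  have uVN: "u ` V \<subseteq> UNIV \<times> N"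
    by (rule image_subsetI) (simp add: mem_Times_iff uN)
  have uB: "snd (u w) \<notin> binding \<Psi>" if "w \<in> V" "w \<noteq> p" for w
    using that e2(2) by (auto simp: V_def dist_commute)
  define \<zeta> where "\<zeta> w = \<Psi>i (snd (u w))" for w
  have \<zeta>: "\<zeta> w \<in> nbhd \<epsilon>" "\<Psi> (\<zeta> w) = snd (u w)" if "w \<in> V" for w
    using Psii_N uN[OF that] by (auto simp: \<zeta>_def)
  have \<zeta>0: "snd (\<zeta> w) = 0 \<longleftrightarrow> w = p" if "w \<in> V" for w
  proof
    show "w = p" if "snd (\<zeta> w) = 0"
      using uB[OF \<open>w \<in> V\<close>] \<zeta>[OF \<open>w \<in> V\<close>] that by (force simp: binding_eq)
    assume "w = p"
    then obtain y where "y \<in> nbhd \<epsilon>" "snd y = 0" "snd (u w) = \<Psi> y" using p by (auto simp: binding_eq)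
    then show "snd (\<zeta> w) = 0" by (simp add: \<zeta>_def Psii)
  qed
  have usV: "smooth_on V u" using us V(4) by (rule smooth_on_subset)
  have \<zeta>cont: "continuous_on V \<zeta>"
    unfolding \<zeta>_def
    by (rule continuous_on_compose2[OF smooth_on_continuous[OF Psii_smooth]])
       (use uN V ucont in \<open>auto intro!: continuous_intros intro: continuous_on_subset\<close>)
  define Z where "Z w = snd (Zcoord (u w))" for w
  have Zeq: "Z w = of_real (exp (c * fst (u w))) * snd (\<zeta> w)" for w
    by (simp add: Z_def Zcoord_def Yflow_def \<zeta>_def)
  have Zcont: "continuous_on V Z"
    unfolding Zeq[abs_def] using continuous_on_subset[OF ucont V(4)]
    by (intro continuous_intros \<zeta>cont)
  have "Z holomorphic_on (V - {p})"
    unfolding holomorphic_on_def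
  proof
    fix w assume w: "w \<in> V - {p}"
    then have "snd (\<Psi>i (snd (u w))) \<noteq> 0" using \<zeta>0[of w] by (simp add: \<zeta>_def)
    from Zcoord_holomorphic[OF V(1) _ usV uVN this smooth_on_frechet_derivative[OF us Uo] CR] w V(4)
    obtain DZ where DZ: "((\<lambda>w. Zcoord (u w)) has_derivative DZ) (at w)" "\<And>v. DZ (\<i> * v) = Jo (DZ v)"
      by blast
    have "(Z has_derivative (\<lambda>v. snd (DZ v))) (at w)"
      unfolding Z_def by (rule has_derivative_snd[OF DZ(1)])
    then have "Z field_differentiable at w"
      by (rule complex_linear_derivative) (simp add: DZ(2) Jo_def)
    then show "Z field_differentiable (at w within V - {p})" by (rule field_differentiable_at_within)
  qed
  \<comment> \<open>The Cauchy-Riemann equation was obtained only where \<open>z\<^sub>2\<close> is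
    nonzero; continuity at \<open>p\<close> closes the gap.\<close>
  then have Zhol: "Z holomorphic_on V"
    using no_isolated_singularity[OF Zcont _ V(1), of "{p}"] by simp
  have Z0: "Z w = 0 \<longleftrightarrow> w = p" if "w \<in> V" for w using \<zeta>0[OF that] by (simp add: Zeq)
  have nc: "\<not> Z constant_on V"
  proof
    assume "Z constant_on V"
    then have *: "Z w = 0" if "w \<in> V" for w using Z0[OF V(3)] V(3) that by (force simp: constant_on_def)
    have "p + of_real (min e1 e2 / 2) \<in> V" using e1(1) e2(1) by (auto simp: V_def dist_norm min_def)
    with * Z0 have "p + of_real (min e1 e2 / 2) = p" by blast
    with e1(1) e2(1) show False by (simp add: min_def split: if_splits)
  qed
  have Zp: "Z p = 0" using Z0[OF V(3)] by simp
  obtain G r n where G: "0 < n" "0 < r" "ball p r \<subseteq> V" "G holomorphic_on ball p r"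
    "\<And>w. w \<in> ball p r \<Longrightarrow> Z w = (w - p) ^ n * G w" "\<And>w. w \<in> ball p r \<Longrightarrow> G w \<noteq> 0"
  proof (rule holomorphic_factor_zero_nonconstant[OF Zhol V(1,2,3) Zp nc])
    fix G r n
    assume G: "0 < n" "0 < r" "ball p r \<subseteq> V" "G holomorphic_on ball p r"
      "\<And>w. w \<in> ball p r \<Longrightarrow> Z w = (w - p) ^ n * G w" "\<And>w. w \<in> ball p r \<Longrightarrow> G w \<noteq> 0"
    show thesis by (rule that[OF G])
  qed
  have Gcont: "isCont G p"
    using holomorphic_on_imp_continuous_on[OF G(4)] G(2) by (simp add: continuous_on_eq_continuous_at)
  have near: "\<forall>\<^sub>F w in at p. w \<in> ball p r \<and> w \<noteq> p"
    using G(2) by (auto simp: eventually_at dist_commute intro!: exI[of _ r])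

  have ufst: "isCont (\<lambda>w. fst (u w)) p"
    using ucont Uo p(1) by (intro continuous_intros) (simp add: continuous_on_eq_continuous_at)
  \<comment> \<open>Undoes the positive factor by which \<open>Z\<close> differs from the coordinate
    \<open>z\<^sub>2\<close>, in which the intersection multiplicity is counted.\<close>
  define k where "k w = of_real (exp (- (c * fst (u w)))) * G w" for w
  have keq: "snd (\<zeta> w) = k w * (w - p) ^ n" if "w \<in> ball p r" for w
    using G(5)[OF that] Zeq[of w] by (simp add: k_def exp_minus field_simps)
  have kp: "k p \<noteq> 0" using G by (simp add: k_def)
  have kcont: "isCont k p" unfolding k_def by (intro continuous_intros ufst Gcont)
  have "n = m"
  proof -
    have "\<forall>\<^sub>F w in at p. dist (k w) (k p) < norm (k p)"
      using tendstoD[of k "k p" "at p" "norm (k p)"] kcont kp by (simp add: isCont_def)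
    then obtain d where d: "d > 0" "\<And>w. w \<noteq> p \<Longrightarrow> dist w p < d \<Longrightarrow> dist (k w) (k p) < norm (k p)"
      by (auto simp: eventually_at)
    have "\<forall>\<^sub>F \<rho> in at_right 0. \<rho> \<in> {0<..<min d r}"
      using d(1) G(2) by (intro eventually_at_right_real) auto
    moreover have "winding_number (\<lambda>x. snd (\<zeta> (circlepath p \<rho> x))) 0 = of_nat n" if \<rho>: "\<rho> \<in> {0<..<min d r}" for \<rho>
    proof -
      have cp: "norm (circlepath p \<rho> x - p) = \<rho>" for x using \<rho> by (simp add: circlepath norm_mult)
      have inb: "circlepath p \<rho> x \<in> ball p r" for x
        using cp[of x] \<rho> by (simp add: dist_norm norm_minus_commute)
      \<comment> \<open>As \<open>k w\<close> stays within \<open>norm (k p)\<close> of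
        \<open>k p\<close>, replacing it by \<open>k p\<close> moves the loop by less than its
        distance from 0, and the winding number is unchanged.\<close>
      have "winding_number (\<lambda>x. snd (\<zeta> (circlepath p \<rho> x))) 0 = winding_number (\<lambda>x. k p * (circlepath p \<rho> x - p) ^ n) 0"
      proof (rule winding_number_nearby_loops_eq)
        have c1: "continuous_on {0..1} (circlepath p \<rho>)" using path_circlepath by (simp add: path_def)
        then show "path (\<lambda>x. k p * (circlepath p \<rho> x - p) ^ n)"
          unfolding path_def by (intro continuous_intros)
        have "continuous_on {0..1} (\<lambda>x. \<zeta> (circlepath p \<rho> x))"
          by (rule continuous_on_compose2[OF \<zeta>cont c1]) (use inb G(3) in blast)
        then show "path (\<lambda>x. snd (\<zeta> (circlepath p \<rho> x)))"
          unfolding path_def by (rule continuous_on_snd)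
        have "circlepath p \<rho> 1 = circlepath p \<rho> 0" by (simp add: circlepath)
        then show "pathfinish (\<lambda>x. k p * (circlepath p \<rho> x - p) ^ n) = pathstart (\<lambda>x. k p * (circlepath p \<rho> x - p) ^ n)"
          "pathfinish (\<lambda>x. snd (\<zeta> (circlepath p \<rho> x))) = pathstart (\<lambda>x. snd (\<zeta> (circlepath p \<rho> x)))"
          by (simp_all add: pathfinish_def pathstart_def)
        fix x :: real
        define w where "w = circlepath p \<rho> x"
        have w: "w \<in> ball p r" "norm (w - p) = \<rho>" using inb cp by (simp_all add: w_def)
        then have "dist (k w) (k p) < norm (k p)" using d(2)[of w] \<rho> by (auto simp: dist_norm)
        then have "norm (k w - k p) * norm (w - p) ^ n < norm (k p) * norm (w - p) ^ n"
          using \<rho> w(2) by (simp add: dist_norm)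
        then have "norm ((k w - k p) * (w - p) ^ n) < norm (k p * (w - p) ^ n)"
          by (simp add: norm_mult norm_power)
        then show "norm (snd (\<zeta> (circlepath p \<rho> x)) - k p * (circlepath p \<rho> x - p) ^ n) < norm (k p * (circlepath p \<rho> x - p) ^ n - 0)"
          using keq[OF w(1)] by (simp add: w_def[symmetric] left_diff_distrib)
      qed
      then show ?thesis using winding_number_circle_power[OF _ kp, of \<rho> p n] \<rho> by simp
    qed
    ultimately have "\<forall>\<^sub>F \<rho> in at_right 0. winding_number (\<lambda>x. snd (\<zeta> (circlepath p \<rho> x))) 0 = of_nat n"
      by (rule eventually_mono)
    moreover have "\<forall>\<^sub>F \<rho> in at_right 0. winding_number (\<lambda>x. snd (\<zeta> (circlepath p \<rho> x))) 0 = of_nat m"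
      using mult by (simp add: intersection_multiplicity_def \<zeta>_def \<Psi>i_def)
    ultimately have "\<forall>\<^sub>F \<rho> in at_right (0::real). (of_nat n :: complex) = of_nat m"
      by eventually_elim simp
    then show ?thesis by simp
  qed

  define R where "R w = norm (snd (\<zeta> w))" for w
  have Rpos: "0 < R w" "R w < \<epsilon>" if "w \<in> ball p r" "w \<noteq> p" for w
    using \<zeta>0[of w] \<zeta>(1)[of w] nbhd_snd[of "\<zeta> w"] that G(3) by (auto simp: R_def)
  have "filterlim R (at_right 0) (at p)"
    unfolding filterlim_at
  proof
    show "\<forall>\<^sub>F w in at p. R w \<in> {0<..} \<and> R w \<noteq> 0"
      using near by eventually_elim (use Rpos in force)
    have "isCont \<zeta> p" using \<zeta>cont V(1,3) by (simp add: continuous_on_eq_continuous_at)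
    then have "isCont R p" unfolding R_def by (intro continuous_intros)
    then show "(R \<longlongrightarrow> 0) (at p)" using \<zeta>0[OF V(3)] by (simp add: isCont_def R_def)
  qed
  from filterlim_compose[OF rho_tendsto this] have rholim: "((\<lambda>w. rho (R w)) \<longlongrightarrow> r0) (at p)" .
  \<comment> \<open>\<open>A\<close> is the real coordinate of the lift without its linear term, and
    \<open>B\<close> its \<open>z\<^sub>2\<close> coordinate with the phase divided out;
    \<open>a\<close> and \<open>b\<close> are the limits. The unbounded \<open>ln (R w)\<close>
    cancels between the real coordinate of the curve and the shift.\<close>
  define A where "A w = (ln (norm (G w)) - ln (rho (R w))) / c" for w
  define B where "B w = of_real (rho (R w) / norm (G w)) * G w" for w
  define a where "a = (ln (norm (G p)) - ln r0) / c"
  define b where "b = of_real (r0 / norm (G p)) * G p"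
  have Glim: "(G \<longlongrightarrow> G p) (at p)" and Gp: "norm (G p) \<noteq> 0" using Gcont G by (auto simp: isCont_def)
  have Alim: "(A \<longlongrightarrow> a) (at p)"
    unfolding A_def a_def using Gp r0(1) c_pos by (intro tendsto_intros Glim rholim) auto
  have Blim: "(B \<longlongrightarrow> b) (at p)"
    unfolding B_def b_def by (intro tendsto_intros Glim rholim Gp)
  define H where "H w = \<bar>A w - a\<bar> + (sqrt (rsq (rho (R w))) + norm (B w - b))" for w
  have "((\<lambda>w. rsq (rho (R w))) \<longlongrightarrow> 0) (at p)"
    using isCont_tendsto_compose[OF rsq_cont[OF r0(1,2)] rholim] r0(3) by simp
  from tendsto_real_sqrt[OF this] have "((\<lambda>w. sqrt (rsq (rho (R w)))) \<longlongrightarrow> 0) (at p)" by simp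
  moreover have "((\<lambda>w. \<bar>A w - a\<bar>) \<longlongrightarrow> 0) (at p)" using Alim by (simp add: LIM_zero tendsto_rabs_zero)
  moreover have "((\<lambda>w. norm (B w - b)) \<longlongrightarrow> 0) (at p)" using Blim by (simp add: LIM_zero tendsto_norm_zero)
  ultimately have Hlim: "(H \<longlongrightarrow> 0) (at p)"
    unfolding H_def by (intro tendsto_add_zero)

  define T where "T = real m * (2 * pi / c)"
  define pt where "pt \<sigma> \<tau> = p + exp (of_real (2 * pi) * Complex \<sigma> \<tau>)" for \<sigma> \<tau>
  have pt_norm: "norm (pt \<sigma> \<tau> - p) = exp (2 * pi * \<sigma>)" for \<sigma> \<tau>
    by (simp add: pt_def)
  have pt_eq: "pt \<sigma> \<tau> - p = of_real (exp (2 * pi * \<sigma>)) * cis (2 * pi * \<tau>)" for \<sigma> \<tau>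
  proof -
    have "of_real (2 * pi) * Complex \<sigma> \<tau> = of_real (2 * pi * \<sigma>) + \<i> * of_real (2 * pi * \<tau>)"
      by (simp add: complex_eq_iff)
    then show ?thesis unfolding pt_def by (simp only: exp_add cis_conv_exp exp_of_real add_diff_cancel_left')
  qed
  define X where "X \<sigma> \<tau> = (fst (u (pt \<sigma> \<tau>)) + delta (R (pt \<sigma> \<tau>)) - T * \<sigma>, hat (\<zeta> (pt \<sigma> \<tau>)))" for \<sigma> \<tau>
  define L where "L \<tau> = (a, (0::complex, cis (2 * pi * real m * \<tau>) * b))" for \<tau>
  have near': "\<forall>\<^sub>F \<sigma> in at_bot. \<forall>\<tau>. pt \<sigma> \<tau> \<in> ball p r \<and> pt \<sigma> \<tau> \<noteq> p"
    unfolding pt_def by (rule eventually_at_bot_exp[OF near])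
  have est: "dist (X \<sigma> \<tau>) (L \<tau>) \<le> H (pt \<sigma> \<tau>)" if w: "pt \<sigma> \<tau> \<in> ball p r" "pt \<sigma> \<tau> \<noteq> p" for \<sigma> \<tau>
  proof -
    define w where "w = pt \<sigma> \<tau>"
    have wV: "w \<in> V" using w G(3) by (auto simp: w_def)
    have \<zeta>w: "\<zeta> w \<in> nbhd \<epsilon>" "snd (\<zeta> w) \<noteq> 0" using \<zeta>(1)[OF wV] \<zeta>0[OF wV] w by (auto simp: w_def)
    have Rw: "0 < R w" "R w < \<epsilon>" using Rpos w by (auto simp: w_def)
    have rw: "0 < rho (R w)" using rho_pos Rw by auto
    have Zw: "Z w = (w - p) ^ n * G w" "G w \<noteq> 0" using G(5,6) w by (auto simp: w_def)
    have nZ: "norm (Z w) = exp (c * fst (u w)) * R w" by (simp add: Zeq norm_mult R_def)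
    \<comment> \<open>The modulus of \<open>Z\<close> is known both from the position of the curve
      and from the factorization; comparing the logarithms determines the real coordinate.\<close>
    have "ln (norm (Z w)) = c * fst (u w) + ln (R w)" using Rw by (simp add: nZ ln_mult)
    moreover have "ln (norm (Z w)) = real m * (2 * pi * \<sigma>) + ln (norm (G w))"
      unfolding Zw(1) norm_mult norm_power pt_norm[of \<sigma> \<tau>, folded w_def]
      using Zw(2) \<open>n = m\<close> by (simp add: ln_mult ln_realpow)
    moreover have "c * delta (R w) = ln (R w) - ln (rho (R w))" "c * A w = ln (norm (G w)) - ln (rho (R w))"
      "c * (T * \<sigma>) = real m * (2 * pi * \<sigma>)"
      using c_pos by (simp_all add: A_def delta_def T_def)
    ultimately have "c * (fst (u w) + delta (R w) - T * \<sigma>) = c * A w"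
      unfolding right_diff_distrib distrib_left by linarith
    then have e1: "fst (u w) + delta (R w) - T * \<sigma> = A w" using c_pos by simp
    have e2: "norm (fst (hat (\<zeta> w))) = sqrt (rsq (rho (R w)))"
      using norm_fst_hat[OF \<zeta>w] by (metis R_def norm_ge_zero real_sqrt_abs abs_of_nonneg)
    have "snd (hat (\<zeta> w)) = of_real (rho (R w) / R w) * snd (\<zeta> w)"
    proof -
      have "exp (- (c * delta (R w))) = rho (R w) / R w" using exp_delta[OF Rw] Rw by (simp add: field_simps)
      then show ?thesis by (simp add: hat_def Yflow_def R_def[symmetric])
    qed
    also have "\<dots> = of_real (rho (R w) / norm (Z w)) * Z w"
      unfolding nZ unfolding Zeq using Rw by simp
    also have "\<dots> = ((w - p) / of_real (norm (w - p))) ^ m * B w"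
      using Zw \<open>n = m\<close> by (simp add: Zw(1) B_def norm_mult norm_power power_divide)
    also have "(w - p) / of_real (norm (w - p)) = cis (2 * pi * \<tau>)"
      using pt_eq[of \<sigma> \<tau>] pt_norm[of \<sigma> \<tau>] by (simp add: w_def)
    also have "cis (2 * pi * \<tau>) ^ m = cis (2 * pi * real m * \<tau>)"
      by (simp add: Complex.DeMoivre mult_ac)
    finally have e3: "norm (snd (hat (\<zeta> w)) - cis (2 * pi * real m * \<tau>) * b) = norm (B w - b)"
      by (simp add: right_diff_distrib[symmetric] norm_mult)
    have "dist (X \<sigma> \<tau>) (L \<tau>) = norm (A w - a, (fst (hat (\<zeta> w)), snd (hat (\<zeta> w)) - cis (2 * pi * real m * \<tau>) * b))"
      using e1 by (simp add: dist_norm X_def L_def w_def minus_prod_def)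
    also have "\<dots> \<le> \<bar>A w - a\<bar> + norm (fst (hat (\<zeta> w)), snd (hat (\<zeta> w)) - cis (2 * pi * real m * \<tau>) * b)"
      using norm_Pair_le[of "A w - a"] by simp
    also have "\<dots> \<le> \<bar>A w - a\<bar> + (norm (fst (hat (\<zeta> w))) + norm (snd (hat (\<zeta> w)) - cis (2 * pi * real m * \<tau>) * b))"
      by (intro add_left_mono norm_Pair_le)
    finally show ?thesis by (simp add: H_def e2[unfolded w_def] e3[unfolded w_def] w_def)
  qed
  have Xlim: "uniform_limit UNIV X L at_bot"
  proof (rule uniform_limitI)
    fix e :: real assume "e > 0"
    then have "\<forall>\<^sub>F w in at p. H w < e" using Hlim order_tendstoD(2) by blast
    then have "\<forall>\<^sub>F \<sigma> in at_bot. \<forall>\<tau>. H (pt \<sigma> \<tau>) < e" unfolding pt_def by (rule eventually_at_bot_exp)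
    then show "\<forall>\<^sub>F \<sigma> in at_bot. \<forall>\<tau>\<in>UNIV. dist (X \<sigma> \<tau>) (L \<tau>) < e"
      using near' by eventually_elim (use est le_less_trans in blast)
  qed
  have b: "norm b = r0" using Gp r0(1) by (simp add: b_def norm_mult norm_divide)
  \<comment> \<open>The limit values have real part \<open>a\<close> and lie over the core, a
    compact part of the new torus on which \<open>\<Psi>h\<close> is continuous.\<close>
  have K: "compact ({a} \<times> ({0::complex} \<times> sphere (0::complex) r0))" by (intro compact_Times) auto
  have "{0::complex} \<times> sphere (0::complex) r0 \<subseteq> nhat c \<epsilon> s"
  proof -
    have "{0::complex} \<times> sphere (0::complex) r0 = gamma_hat c \<epsilon> s" unfolding gamma_hat_eq by auto
    then show ?thesis by (auto simp: gamma_hat_def)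
  qed
  then have KU: "{a} \<times> ({0::complex} \<times> sphere (0::complex) r0) \<subseteq> UNIV \<times> nhat c \<epsilon> s" by auto
  have cT: "continuous_on ((UNIV :: real set) \<times> nhat c \<epsilon> s) (\<lambda>y. (fst y, \<Psi>h (snd y)))"
    by (intro continuous_intros continuous_on_compose2[OF smooth_on_continuous[OF Psih_smooth]]) auto
  have XU: "\<forall>\<^sub>F \<sigma> in at_bot. \<forall>\<tau>\<in>UNIV. X \<sigma> \<tau> \<in> UNIV \<times> nhat c \<epsilon> s"
    using near'
  proof eventually_elim
    case (elim \<sigma>)
    show ?case
    proof
      fix \<tau>
      have "pt \<sigma> \<tau> \<in> V" "pt \<sigma> \<tau> \<noteq> p" using elim G(3) by auto
      then show "X \<sigma> \<tau> \<in> UNIV \<times> nhat c \<epsilon> s" using hat_in_nhat[OF \<zeta>(1)] \<zeta>0 by (simp add: X_def)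
    qed
  qed
  have "uniform_limit UNIV (\<lambda>\<sigma> \<tau>. (fst (X \<sigma> \<tau>), \<Psi>h (snd (X \<sigma> \<tau>)))) (\<lambda>\<tau>. (fst (L \<tau>), \<Psi>h (snd (L \<tau>)))) at_bot"
    by (rule uniform_limit_compose_compact[OF Xlim K _ KU cT XU]) (auto simp: L_def norm_mult b)
  moreover have "\<forall>\<^sub>F \<sigma> in at_bot. \<forall>\<tau>\<in>UNIV. (fst (X \<sigma> \<tau>), \<Psi>h (snd (X \<sigma> \<tau>))) = tr (u (pt \<sigma> \<tau>)) - (T * \<sigma>, 0)"
    using near'
  proof eventually_elim
    case (elim \<sigma>)
    show ?case
    proof
      fix \<tau>
      have V': "pt \<sigma> \<tau> \<in> V" "pt \<sigma> \<tau> \<noteq> p" using elim G(3) by auto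
      have "tr (u (pt \<sigma> \<tau>)) = tr (fst (u (pt \<sigma> \<tau>)), \<Psi> (\<zeta> (pt \<sigma> \<tau>)))" using \<zeta>(2)[OF V'(1)] by simp
      also have "\<dots> = (fst (u (pt \<sigma> \<tau>)) + delta (R (pt \<sigma> \<tau>)), \<Psi>h (hat (\<zeta> (pt \<sigma> \<tau>))))"
        using tr_N[OF \<zeta>(1)[OF V'(1)]] \<zeta>0[OF V'(1)] V'(2) by (simp add: R_def)
      finally show "(fst (X \<sigma> \<tau>), \<Psi>h (snd (X \<sigma> \<tau>))) = tr (u (pt \<sigma> \<tau>)) - (T * \<sigma>, 0)" by (simp add: X_def)
    qed
  qed
  moreover have "\<exists>d. \<forall>\<tau>. Xflow c (T * \<tau> + d) z = snd (L \<tau>)"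
  proof -
    \<comment> \<open>The time the flow of \<open>X\<close> takes to turn \<open>z\<close> into
      \<open>b\<close>; both have modulus \<open>r0\<close> in the second coordinate, so every
      starting point on the core works.\<close>
    define d where "d = (Arg b - Arg (snd z)) / c"
    have z': "fst z = 0" "norm (snd z) = r0" using z by (auto simp: gamma_hat_eq)
    have "b = of_real r0 * cis (Arg b)" "snd z = of_real r0 * cis (Arg (snd z))"
      using rcis_cmod_Arg[of b] rcis_cmod_Arg[of "snd z"] b z' by (simp_all add: rcis_def)
    then have "cis (c * d) * snd z = b"
      using c_pos by (metis (no_types, lifting) d_def cis_mult diff_add_cancel mult.left_commute nonzero_mult_div_cancel_left less_irrefl times_divide_eq_right)
    moreover have "cis (c * (T * \<tau> + d)) = cis (2 * pi * real m * \<tau>) * cis (c * d)" for \<tau>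
      using c_pos by (simp add: cis_mult T_def distrib_left mult_ac add_ac)
    ultimately have "Xflow c (T * \<tau> + d) z = snd (L \<tau>)" for \<tau>
      using z' by (simp add: Xflow_def L_def mult.assoc)
    then show ?thesis by blast
  qed
  then obtain d where "\<And>\<tau>. Xflow c (T * \<tau> + d) z = snd (L \<tau>)" by blast
  ultimately have "uniform_limit UNIV (\<lambda>\<sigma> \<tau>. tr (u (pt \<sigma> \<tau>)) - (T * \<sigma>, 0)) (\<lambda>\<tau>. (a, \<Psi>h (Xflow c (T * \<tau> + d) z))) at_bot"
    using uniform_limit_cong[of UNIV "\<lambda>\<sigma> \<tau>. (fst (X \<sigma> \<tau>), \<Psi>h (snd (X \<sigma> \<tau>)))" "\<lambda>\<sigma> \<tau>. tr (u (pt \<sigma> \<tau>)) - (T * \<sigma>, 0)" at_bot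
        "\<lambda>\<tau>. (fst (L \<tau>), \<Psi>h (snd (L \<tau>)))" "\<lambda>\<tau>. (a, \<Psi>h (Xflow c (T * \<tau> + d) z))"]
    by (simp add: L_def)
  then show ?thesis
    unfolding negative_end_at_def T_def pt_def o_def by blast
qed

end

text \<open>The cylinder is \<open>\<complex>\<close> without the origin, with ends at infinity and
  0, and the lift lives on the sphere without these two points and the \<open>k\<close> intersection
  points. The orbits at the old ends are read off at level 0 of the real factor: another level
  changes only the real coordinate, which the constants of the ends absorb.\<close>

theorem lemma1p1:
  fixes c \<epsilon> \<epsilon>1 \<epsilon>' :: real and s :: "real \<Rightarrow> real"
    and S Sh D :: "'a::euclidean_space set" and \<omega> :: "'a \<Rightarrow> 'a \<Rightarrow> 'a \<Rightarrow> real"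
    and \<phi> \<phi>h :: "'a \<Rightarrow> 'a" and \<beta> :: "real \<times> real \<Rightarrow> 'a"
    and M :: "'m::euclidean_space set" and q :: "'a \<times> real \<Rightarrow> 'm"
    and \<Psi> :: "complex \<times> complex \<Rightarrow> 'm" and \<alpha> :: "'m \<Rightarrow> 'm \<Rightarrow> real" and R :: "'m \<Rightarrow> 'm"
    and J :: "real \<times> 'm \<Rightarrow> real \<times> 'm \<Rightarrow> real \<times> 'm"
    and Mh :: "'n::euclidean_space set" and qh :: "'a \<times> real \<Rightarrow> 'n"
    and \<psi> :: "'m \<Rightarrow> 'n" and \<Psi>h :: "complex \<times> complex \<Rightarrow> 'n"
    and Jh :: "real \<times> 'n \<Rightarrow> real \<times> 'n \<Rightarrow> real \<times> 'n"
    and u :: "complex \<Rightarrow> real \<times> 'm" and \<gamma>p \<gamma>m :: "real \<Rightarrow> 'm" and Tp Tm :: real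
    and k :: nat and w :: "nat \<Rightarrow> complex" and m :: "nat \<Rightarrow> nat"
  assumes "c > 0" and "c \<notin> \<rat>"
    and "surgery_profile c \<epsilon> \<epsilon>' s"
    and "open_book \<epsilon> \<epsilon>1 S \<omega> \<phi> \<beta> M q \<Psi>"
    and "contact_form M \<alpha>" and "supported_by \<alpha> S \<omega> q \<Psi>"
    and "standard_near_binding c \<epsilon> \<Psi> \<alpha>"
    and "reeb_field M \<alpha> R"
    and "admissible M \<alpha> R J"
    and "standard_complex_on c (nbhd \<epsilon>) \<Psi> J"
    and "zero_surgery c \<epsilon> \<epsilon>' s S \<phi> M q \<Psi> Sh D \<phi>h Mh qh \<psi> \<Psi>h"
    and "invariant_almost_complex Mh Jh"
    and "structures_agree (UNIV \<times> q ` (S \<times> UNIV)) id J (\<lambda>(t, x). (t, \<psi> x)) Jh"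
    and "standard_complex_on c (nhat c \<epsilon> s) \<Psi>h Jh"
    and "J_holomorphic_on (- {0}) M J u"
    and "closed_orbit M R \<gamma>p Tp" and "\<not> multiple_of_binding \<Psi> \<gamma>p Tp"
    and "closed_orbit M R \<gamma>m Tm" and "\<not> multiple_of_binding \<Psi> \<gamma>m Tm"
    and "positive_end_at_infinity u \<gamma>p Tp" and "negative_end_at 0 u \<gamma>m Tm"
    and "inj_on w {1..k}"
    and "{v \<in> - {0}. snd (u v) \<in> binding \<Psi>} = w ` {1..k}"
    and "\<And>i. i \<in> {1..k} \<Longrightarrow> m i > 0 \<and> intersection_multiplicity \<epsilon> \<Psi> u (w i) (m i)"
  shows "J_holomorphic_on (- insert 0 (w ` {1..k})) Mh Jh (transfer c \<epsilon> s \<Psi> \<psi> \<Psi>h \<circ> u) \<and>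
    positive_end_at_infinity (transfer c \<epsilon> s \<Psi> \<psi> \<Psi>h \<circ> u)
      (\<lambda>t. snd (transfer c \<epsilon> s \<Psi> \<psi> \<Psi>h (0, \<gamma>p t))) Tp \<and>
    negative_end_at 0 (transfer c \<epsilon> s \<Psi> \<psi> \<Psi>h \<circ> u)
      (\<lambda>t. snd (transfer c \<epsilon> s \<Psi> \<psi> \<Psi>h (0, \<gamma>m t))) Tm \<and>
    (\<forall>i\<in>{1..k}. \<forall>z\<in>gamma_hat c \<epsilon> s.
       negative_end_at (w i) (transfer c \<epsilon> s \<Psi> \<psi> \<Psi>h \<circ> u)
         (\<lambda>t. \<Psi>h (Xflow c t z)) (real (m i) * (2 * pi / c)))"
proof -
  interpret lift c \<epsilon> \<epsilon>' s \<epsilon>1 S Sh D \<omega> \<phi> \<phi>h \<beta> M q \<Psi> \<alpha> R J Mh qh \<psi> \<Psi>h Jh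
    by (intro lift.intro surgery.intro lift_axioms.intro assms)
  note hol = \<open>J_holomorphic_on (- {0}) M J u\<close>
  define P where "P = w ` {1..k}"
  have P: "{v \<in> - {0}. snd (u v) \<in> binding \<Psi>} = P"
    using assms unfolding P_def by blast
  have fin: "finite P" by (simp add: P_def)
  have uM: "snd (u v) \<in> M" if "v \<noteq> 0" for v
  proof -
    have "u v \<in> UNIV \<times> M" using hol that unfolding J_holomorphic_on_def by blast
    then show ?thesis by (simp add: mem_Times_iff)
  qed
  have "J_holomorphic_on (- insert 0 P) Mh Jh (tr \<circ> u)"
  proof (rule lift_holomorphic[OF hol])
    show "open (- insert 0 P)" using fin by (intro open_Compl finite_imp_closed) simp
    show "u ` (- insert 0 P) \<subseteq> UNIV \<times> (M - binding \<Psi>)"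
    proof (rule image_subsetI)
      fix v assume "v \<in> - insert 0 P"
      then have "v \<noteq> 0" "snd (u v) \<notin> binding \<Psi>" using P by auto
      with uM show "u v \<in> UNIV \<times> (M - binding \<Psi>)" by (simp add: mem_Times_iff)
    qed
  qed auto
  moreover have "positive_end_at_infinity (tr \<circ> u) (\<lambda>t. snd (tr (0, \<gamma>p t))) Tp"
  proof -
    obtain a d where "uniform_limit UNIV (\<lambda>\<sigma> \<tau>. u (exp (of_real (2 * pi) * Complex \<sigma> \<tau>)) - (Tp * \<sigma>, 0))
        (\<lambda>\<tau>. (a, \<gamma>p (Tp * \<tau> + d))) at_top"
      using \<open>positive_end_at_infinity u \<gamma>p Tp\<close> unfolding positive_end_at_infinity_def by blast
    from lift_end[OF \<open>closed_orbit M R \<gamma>p Tp\<close> \<open>\<not> multiple_of_binding \<Psi> \<gamma>p Tp\<close> this uM[OF exp_not_eq_zero]]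
    show ?thesis unfolding positive_end_at_infinity_def o_def .
  qed
  moreover have "negative_end_at 0 (tr \<circ> u) (\<lambda>t. snd (tr (0, \<gamma>m t))) Tm"
  proof -
    obtain a d where "uniform_limit UNIV (\<lambda>\<sigma> \<tau>. u (0 + exp (of_real (2 * pi) * Complex \<sigma> \<tau>)) - (Tm * \<sigma>, 0))
        (\<lambda>\<tau>. (a, \<gamma>m (Tm * \<tau> + d))) at_bot"
      using \<open>negative_end_at 0 u \<gamma>m Tm\<close> unfolding negative_end_at_def by blast
    from lift_end[OF \<open>closed_orbit M R \<gamma>m Tm\<close> \<open>\<not> multiple_of_binding \<Psi> \<gamma>m Tm\<close> this] uM
    show ?thesis unfolding negative_end_at_def o_def by simp
  qed
  moreover have "negative_end_at (w i) (tr \<circ> u) (\<lambda>t. \<Psi>h (Xflow c t z)) (real (m i) * (2 * pi / c))"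
    if i: "i \<in> {1..k}" and z: "z \<in> gamma_hat c \<epsilon> s" for i z
  proof (rule puncture_end[OF hol _ _ _ _ z])
    have "w i \<in> {v \<in> - {0}. snd (u v) \<in> binding \<Psi>}" using P i by (auto simp: P_def)
    then show "w i \<in> - {0}" "snd (u (w i)) \<in> binding \<Psi>" by auto
    \<comment> \<open>Finiteness of \<open>P\<close> separates \<open>w i\<close> from the other
      intersection points, and it is also separated from the origin, which is outside the domain of
      the curve.\<close>
    then have "\<forall>\<^sub>F v in at (w i). v \<in> - (insert 0 P - {w i})"
      using fin by (intro eventually_at_in_open' open_Compl finite_imp_closed) auto
    moreover have "\<forall>\<^sub>F v in at (w i). v \<noteq> w i" by (rule eventually_neq_at_within)
    ultimately show "\<forall>\<^sub>F v in at (w i). snd (u v) \<notin> binding \<Psi>"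
      by eventually_elim (use P in auto)
    show "intersection_multiplicity \<epsilon> \<Psi> u (w i) (m i)" using assms i by blast
  qed
  ultimately show ?thesis unfolding P_def by blast
qed

end
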